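(* Let $G_1$ and $G_2$ be finitely generated groups admitting finite graph of groups decompositions. Assume that one of the following holds: (a) there exists $d\in\mathbb{N}$, $d\geq 1$, such that, for both decompositions, all vertex-groups lie in $\mathfrak{M}_d$ and all edge-groups are finitely generated with relative growth $o(r^{d-1})$; (b) for both decompositions, all vertex-groups lie in $\mathfrak{M}_{exp}$ and all edge-groups are finitely generated with subexponential relative growth. Then any quasi-isometry between $G_1$ and $G_2$ quasi-preserves the vertex-groups.
   Context: Given a finitely generated group $G$ with a word metric $d_G$ and a subgroup $H$, the relative growth of $H$ is $\beta_H^G(r)=|\{h\in H : d_G(e,h)\leq r\}|$; it is subexponential if $\limsup_{r\to\infty}\frac1r\log\beta_H^G(r)=0$. A quasi-isometry $f:G_1\to G_2$ quasi-preserves the vertex-groups if it sends every left coset of a vertex-group of $G_1$ to a subset at finite Hausdorff distance from a left coset of some vertex-group of $G_2$, and similarly for a quasi-inverse of $f$. Vertex-groups are finitely generated (as members of the classes below, with word metrics). For a metric space $X$, a subset $C\subset X$ and $R\geq 0$, $C^{+R}=\{x\in X : d(x,C)\leq R\}$. A $k$-path is a finite sequence of points whose consecutive points are at distance $\leq k$; a subset is $k$-coarsely connected if any two of its points are joined by a $k$-path contained in it; the $k$-coarsely connected components of a subset are its maximal $k$-coarsely connected subsets. A collection $\mathcal{Z}$ of subsets of $X$ coarsely separates $X$ if there exist $k,L\geq 0$ such that $X$ is $k$-coarsely connected and, for every $D\geq 0$, there is some $Z\in\mathcal{Z}$ such that $X\setminus Z^{+L}$ has at least two $k$-coarsely connected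 components containing points at distance $\geq D$ from $Z$. Graphs are connected and identified with their vertex sets with the path metric. For a bounded degree graph $X$ and a family $\mathcal{S}$ of sets of vertices, $V_{\mathcal{S}}(r)=\sup\{|B_X(s,r)\cap S| : s\in S,\ S\in\mathcal{S}\}$. $f\gtrsim g$ means that there is $C>0$ with $f(t)\geq Cg(Ct+C)+C$ for all $t\geq0$. A metric space belongs to $\mathfrak{M}_{exp}$ (resp. $\mathfrak{M}_d$) if it is quasi-isometric to a bounded degree graph in which every coarsely separating family $\mathcal{S}$ satisfies $V_{\mathcal{S}}(r)\gtrsim e^r$ (resp. $V_{\mathcal{S}}(r)\gtrsim r^d$).
   Formalization: Added assumption: finite vertex-groups occur in both decompositions or in neither. Finite groups lie vacuously in all the classes, so the claim fails otherwise (Z^3 versus Z^3 * 1, d = 2); the assumption is implied by the conclusion. *)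

theory Defs
  imports
    "HOL-Analysis.Analysis"
    "HOL-Library.Landau_Symbols"
    "HOL-Algebra.Generated_Groups"
    "Graph_Theory.Graph_Theory"
begin

section \<open>Coarse geometry\<close>

text \<open>
  The value is an extended real, so that every point is at distance \<open>\<infinity>\<close> from the empty set.
\<close>
definition dist_to_set :: "'a metric \<Rightarrow> 'a \<Rightarrow> 'a set \<Rightarrow> ereal" where
  "dist_to_set m x A = (INF a\<in>A. ereal (mdist m x a))"

definition thickening :: "'a metric \<Rightarrow> real \<Rightarrow> 'a set \<Rightarrow> 'a set" where
  "thickening m R A = {x \<in> mspace m. dist_to_set m x A \<le> ereal R}"

definition hausdorff_distance :: "'a metric \<Rightarrow> 'a set \<Rightarrow> 'a set \<Rightarrow> ereal" where
  "hausdorff_distance m A B =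
     max (SUP a\<in>A. dist_to_set m a B) (SUP b\<in>B. dist_to_set m b A)"

definition coarse_path :: "'a metric \<Rightarrow> real \<Rightarrow> 'a list \<Rightarrow> bool" where
  "coarse_path m k xs \<longleftrightarrow> (\<forall>i. Suc i < length xs \<longrightarrow> mdist m (xs ! i) (xs ! Suc i) \<le> k)"

definition coarsely_connected :: "'a metric \<Rightarrow> real \<Rightarrow> 'a set \<Rightarrow> bool" where
  "coarsely_connected m k A \<longleftrightarrow>
     (\<forall>x\<in>A. \<forall>y\<in>A. \<exists>xs. xs \<noteq> [] \<and> set xs \<subseteq> A \<and> hd xs = x \<and> last xs = y \<and> coarse_path m k xs)"

definition coarse_components :: "'a metric \<Rightarrow> real \<Rightarrow> 'a set \<Rightarrow> 'a set set" where
  "coarse_components m k A =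
     {C. C \<subseteq> A \<and> coarsely_connected m k C \<and>
         (\<forall>C'. C \<subseteq> C' \<and> C' \<subseteq> A \<and> coarsely_connected m k C' \<longrightarrow> C' = C)}"

definition coarsely_separates :: "'a metric \<Rightarrow> 'a set set \<Rightarrow> bool" where
  "coarsely_separates m \<Z> \<longleftrightarrow>
     (\<exists>k\<ge>0. \<exists>L\<ge>0. coarsely_connected m k (mspace m) \<and>
        (\<forall>D\<ge>0. \<exists>Z\<in>\<Z>.
           \<exists>C\<in>coarse_components m k (mspace m - thickening m L Z).
           \<exists>C'\<in>coarse_components m k (mspace m - thickening m L Z).
             C \<noteq> C' \<and> (\<exists>x\<in>C. dist_to_set m x Z \<ge> ereal D) \<and>
             (\<exists>x\<in>C'. dist_to_set m x Z \<ge> ereal D)))"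

definition quasi_isometry :: "'a metric \<Rightarrow> 'b metric \<Rightarrow> ('a \<Rightarrow> 'b) \<Rightarrow> bool" where
  "quasi_isometry m1 m2 f \<longleftrightarrow>
     f ` mspace m1 \<subseteq> mspace m2 \<and>
     (\<exists>A\<ge>1. \<exists>B\<ge>0.
        (\<forall>x\<in>mspace m1. \<forall>y\<in>mspace m1.
           mdist m1 x y / A - B \<le> mdist m2 (f x) (f y) \<and>
           mdist m2 (f x) (f y) \<le> A * mdist m1 x y + B) \<and>
        (\<forall>y\<in>mspace m2. \<exists>x\<in>mspace m1. mdist m2 (f x) y \<le> B))"

definition quasi_inverse :: "'a metric \<Rightarrow> 'b metric \<Rightarrow> ('a \<Rightarrow> 'b) \<Rightarrow> ('b \<Rightarrow> 'a) \<Rightarrow> bool" where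
  "quasi_inverse m1 m2 f g \<longleftrightarrow>
     quasi_isometry m2 m1 g \<and>
     (\<exists>B. \<forall>x\<in>mspace m1. mdist m1 (g (f x)) x \<le> B) \<and>
     (\<exists>B. \<forall>y\<in>mspace m2. mdist m2 (f (g y)) y \<le> B)"

definition quasi_preserves ::
    "'a metric \<Rightarrow> 'b metric \<Rightarrow> 'a set set \<Rightarrow> 'b set set \<Rightarrow> ('a \<Rightarrow> 'b) \<Rightarrow> bool" where
  "quasi_preserves m1 m2 \<A> \<B> f \<longleftrightarrow>
     (\<forall>A\<in>\<A>. \<exists>B\<in>\<B>. hausdorff_distance m2 (f ` A) B < \<infinity>) \<and>
     (\<exists>g. quasi_inverse m1 m2 f g \<and>
          (\<forall>B\<in>\<B>. \<exists>A\<in>\<A>. hausdorff_distance m1 (g ` B) A < \<infinity>))"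


section \<open>The classes of spaces that are hard to separate\<close>

definition path_dist :: "('v, 'e) pre_digraph \<Rightarrow> 'v \<Rightarrow> 'v \<Rightarrow> real" where
  "path_dist X u v = real (LEAST n. \<exists>p. pre_digraph.awalk X u p v \<and> length p = n)"

definition path_metric :: "('v, 'e) pre_digraph \<Rightarrow> 'v metric" where
  "path_metric X = metric (verts X, path_dist X)"

text \<open>Finiteness of \<open>out_arcs\<close> is stated separately because \<open>card\<close> of an infinite set is 0.\<close>
definition bounded_degree_graph :: "'v pair_pre_digraph \<Rightarrow> bool" where
  "bounded_degree_graph X \<longleftrightarrow>
     pair_bidirected_digraph X \<and> Digraph_Component.connected (with_proj X) \<and>
     (\<exists>N. \<forall>v\<in>pverts X. finite (out_arcs (with_proj X) v) \<and> out_degree (with_proj X) v \<le> N)"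

text \<open>
  Used only for families of subsets of a bounded degree graph, where the set of cardinalities
  is bounded.
\<close>
definition family_growth :: "'a metric \<Rightarrow> 'a set set \<Rightarrow> real \<Rightarrow> real" where
  "family_growth m \<S> r = Sup {real (card (mcball_of m s r \<inter> S)) | s S. S \<in> \<S> \<and> s \<in> S}"

definition dominates_growth :: "(real \<Rightarrow> real) \<Rightarrow> (real \<Rightarrow> real) \<Rightarrow> bool" (infix \<open>\<greatersim>\<close> 50) where
  "f \<greatersim> g \<longleftrightarrow> (\<exists>C>0. \<forall>t\<ge>0. f t \<ge> C * g (C * t + C) + C)"

text \<open>
  Connected bounded degree graphs are countable, so vertices may be taken in \<open>nat\<close>.
\<close>
definition separation_class :: "(real \<Rightarrow> real) \<Rightarrow> 'a metric set" where
  "separation_class g =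
     {m. \<exists>X :: nat pair_pre_digraph. bounded_degree_graph X \<and>
         (\<exists>f. quasi_isometry m (path_metric (with_proj X)) f) \<and>
         (\<forall>\<S>. \<S> \<subseteq> Pow (pverts X) \<and> coarsely_separates (path_metric (with_proj X)) \<S> \<longrightarrow>
              family_growth (path_metric (with_proj X)) \<S> \<greatersim> g)}"

definition M_exp :: "'a metric set" where
  "M_exp = separation_class exp"

definition M_poly :: "nat \<Rightarrow> 'a metric set" where
  "M_poly d = separation_class (\<lambda>r. r ^ d)"


section \<open>Word metrics and relative growth\<close>

definition finite_generating_set :: "('g, 'm) monoid_scheme \<Rightarrow> 'g set \<Rightarrow> bool" where
  "finite_generating_set G S \<longleftrightarrow> finite S \<and> S \<subseteq> carrier G \<and> generate G S = carrier G"

definition finitely_generated :: "('g, 'm) monoid_scheme \<Rightarrow> bool" where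
  "finitely_generated G \<longleftrightarrow> (\<exists>S. finite_generating_set G S)"

definition word_length :: "('g, 'm) monoid_scheme \<Rightarrow> 'g set \<Rightarrow> 'g \<Rightarrow> nat" where
  "word_length G S x =
     (LEAST n. \<exists>ws. length ws = n \<and> set ws \<subseteq> S \<union> m_inv G ` S \<and>
                    foldr (\<otimes>\<^bsub>G\<^esub>) ws \<one>\<^bsub>G\<^esub> = x)"

text \<open>The library's notion of metric requires symmetry outside the carrier as well.\<close>
definition word_dist :: "('g, 'm) monoid_scheme \<Rightarrow> 'g set \<Rightarrow> 'g \<Rightarrow> 'g \<Rightarrow> real" where
  "word_dist G S x y =
     (if x \<in> carrier G \<and> y \<in> carrier G
      then real (word_length G S (inv\<^bsub>G\<^esub> x \<otimes>\<^bsub>G\<^esub> y)) else 0)"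

definition word_metric :: "('g, 'm) monoid_scheme \<Rightarrow> 'g set \<Rightarrow> 'g metric" where
  "word_metric G S = metric (carrier G, word_dist G S)"

definition relative_growth :: "('g, 'm) monoid_scheme \<Rightarrow> 'g set \<Rightarrow> 'g set \<Rightarrow> real \<Rightarrow> nat" where
  "relative_growth G S H r = card {h \<in> H. mdist (word_metric G S) \<one>\<^bsub>G\<^esub> h \<le> r}"

definition subexponential :: "(real \<Rightarrow> nat) \<Rightarrow> bool" where
  "subexponential \<beta> \<longleftrightarrow> Limsup at_top (\<lambda>r. ereal (1 / r * ln (real (\<beta> r)))) = 0"

definition group_in_class :: "('g, 'm) monoid_scheme \<Rightarrow> 'g metric set \<Rightarrow> bool" where
  "group_in_class G \<M> \<longleftrightarrow> (\<exists>S. finite_generating_set G S \<and> word_metric G S \<in> \<M>)"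


section \<open>Graphs of groups\<close>

text \<open>
  Graphs in the sense of Serre: every geometric edge is a pair \<open>e\<close>, \<open>gog_rev \<G> e\<close> of distinct
  arcs; loops and multiple edges are allowed. The monomorphism attached to \<open>e\<close> goes from the edge
  group to the group of the head of \<open>e\<close>.
\<close>
record ('v, 'e, 'a, 'b) graph_of_groups =
  gog_graph :: "('v, 'e) pre_digraph"
  gog_rev :: "'e \<Rightarrow> 'e"
  vertex_gp :: "'v \<Rightarrow> 'a monoid"
  edge_gp :: "'e \<Rightarrow> 'b monoid"
  edge_map :: "'e \<Rightarrow> 'b \<Rightarrow> 'a"

abbreviation gog_verts :: "('v, 'e, 'a, 'b) graph_of_groups \<Rightarrow> 'v set" where
  "gog_verts \<G> \<equiv> verts (gog_graph \<G>)"

abbreviation gog_arcs :: "('v, 'e, 'a, 'b) graph_of_groups \<Rightarrow> 'e set" where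
  "gog_arcs \<G> \<equiv> arcs (gog_graph \<G>)"

definition finite_graph_of_groups :: "('v, 'e, 'a, 'b) graph_of_groups \<Rightarrow> bool" where
  "finite_graph_of_groups \<G> \<longleftrightarrow>
     fin_digraph (gog_graph \<G>) \<and> bidirected_digraph (gog_graph \<G>) (gog_rev \<G>) \<and>
     Digraph_Component.connected (gog_graph \<G>) \<and>
     (\<forall>v\<in>gog_verts \<G>. group (vertex_gp \<G> v)) \<and>
     (\<forall>e\<in>gog_arcs \<G>. group (edge_gp \<G> e) \<and> edge_gp \<G> (gog_rev \<G> e) = edge_gp \<G> e \<and>
        edge_map \<G> e \<in> mon (edge_gp \<G> e) (vertex_gp \<G> (head (gog_graph \<G>) e)))"

text \<open>
  The library constant \<open>spanning_tree\<close> forbids all directed cycles, hence also the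
  walks \<open>e\<close>, \<open>rev e\<close>, so it is not the notion for graphs whose edges come in both orientations.
  Here these walks are the only cycles allowed; in particular there are no loops.
\<close>
definition maximal_tree :: "('v, 'e) pre_digraph \<Rightarrow> ('e \<Rightarrow> 'e) \<Rightarrow> 'e set \<Rightarrow> bool" where
  "maximal_tree \<Gamma> rv T \<longleftrightarrow>
     T \<subseteq> arcs \<Gamma> \<and> rv ` T \<subseteq> T \<and> Digraph_Component.connected (\<Gamma>\<lparr>arcs := T\<rparr>) \<and>
     (\<forall>p. pre_digraph.cycle (\<Gamma>\<lparr>arcs := T\<rparr>) p \<longrightarrow> (\<exists>e. p = [e, rv e]))"

text \<open>Monoid presentations: words over \<open>X\<close> modulo the congruence generated by \<open>R\<close>.\<close>
inductive word_cong :: "'x set \<Rightarrow> ('x list \<times> 'x list) set \<Rightarrow> 'x list \<Rightarrow> 'x list \<Rightarrow> bool"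
  for X R where
  rel: "(u, v) \<in> R \<Longrightarrow> p @ u @ q \<in> lists X \<Longrightarrow> p @ v @ q \<in> lists X \<Longrightarrow>
        word_cong X R (p @ u @ q) (p @ v @ q)"
| refl: "w \<in> lists X \<Longrightarrow> word_cong X R w w"
| sym: "word_cong X R u v \<Longrightarrow> word_cong X R v u"
| trans: "word_cong X R u v \<Longrightarrow> word_cong X R v w \<Longrightarrow> word_cong X R u w"

definition word_class :: "'x set \<Rightarrow> ('x list \<times> 'x list) set \<Rightarrow> 'x list \<Rightarrow> 'x list set" where
  "word_class X R w = {w'. word_cong X R w w'}"

definition presented_monoid :: "'x set \<Rightarrow> ('x list \<times> 'x list) set \<Rightarrow> 'x list set monoid" where
  "presented_monoid X R =
     \<lparr>carrier = word_class X R ` lists X,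
      mult = (\<lambda>A B. \<Union>a\<in>A. \<Union>b\<in>B. word_class X R (a @ b)),
      one = word_class X R []\<rparr>"

datatype ('v, 'e, 'a) gog_letter = Vertex_elt 'v 'a | Edge_elt 'e

definition gog_generators :: "('v, 'e, 'a, 'b) graph_of_groups \<Rightarrow> ('v, 'e, 'a) gog_letter set" where
  "gog_generators \<G> =
     {Vertex_elt v a | v a. v \<in> gog_verts \<G> \<and> a \<in> carrier (vertex_gp \<G> v)} \<union>
     Edge_elt ` gog_arcs \<G>"

text \<open>
  The last two kinds of relations are \<open>t\<^sub>e \<alpha>\<^sub>e(c) = \<alpha>\<^bsub>rev e\<^esub>(c) t\<^sub>e\<close> for \<open>c\<close> in the edge group
  and \<open>t\<^sub>e = 1\<close> for \<open>e\<close> in the maximal tree.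
\<close>
definition gog_relations ::
    "('v, 'e, 'a, 'b) graph_of_groups \<Rightarrow> 'e set \<Rightarrow>
      (('v, 'e, 'a) gog_letter list \<times> ('v, 'e, 'a) gog_letter list) set" where
  "gog_relations \<G> T =
     {([Vertex_elt v a, Vertex_elt v b], [Vertex_elt v (a \<otimes>\<^bsub>vertex_gp \<G> v\<^esub> b)]) | v a b.
        v \<in> gog_verts \<G> \<and> a \<in> carrier (vertex_gp \<G> v) \<and> b \<in> carrier (vertex_gp \<G> v)} \<union>
     {([Vertex_elt v \<one>\<^bsub>vertex_gp \<G> v\<^esub>], []) | v. v \<in> gog_verts \<G>} \<union>
     {([Edge_elt e, Edge_elt (gog_rev \<G> e)], []) | e. e \<in> gog_arcs \<G>} \<union>
     {([Edge_elt e, Vertex_elt (head (gog_graph \<G>) e) (edge_map \<G> e c)],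
       [Vertex_elt (tail (gog_graph \<G>) e) (edge_map \<G> (gog_rev \<G> e) c), Edge_elt e]) | e c.
        e \<in> gog_arcs \<G> \<and> c \<in> carrier (edge_gp \<G> e)} \<union>
     {([Edge_elt e], []) | e. e \<in> T}"

abbreviation gog_class ::
    "('v, 'e, 'a, 'b) graph_of_groups \<Rightarrow> 'e set \<Rightarrow> ('v, 'e, 'a) gog_letter list \<Rightarrow>
      ('v, 'e, 'a) gog_letter list set" where
  "gog_class \<G> T \<equiv> word_class (gog_generators \<G>) (gog_relations \<G> T)"

definition fundamental_group ::
    "('v, 'e, 'a, 'b) graph_of_groups \<Rightarrow> 'e set \<Rightarrow> ('v, 'e, 'a) gog_letter list set monoid" where
  "fundamental_group \<G> T = presented_monoid (gog_generators \<G>) (gog_relations \<G> T)"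

definition finite_gog_decomposition ::
    "('g, 'm) monoid_scheme \<Rightarrow> ('v, 'e, 'a, 'b) graph_of_groups \<Rightarrow> 'e set \<Rightarrow>
      (('v, 'e, 'a) gog_letter list set \<Rightarrow> 'g) \<Rightarrow> bool" where
  "finite_gog_decomposition G \<G> T \<phi> \<longleftrightarrow>
     finite_graph_of_groups \<G> \<and> maximal_tree (gog_graph \<G>) (gog_rev \<G>) T \<and>
     \<phi> \<in> iso (fundamental_group \<G> T) G"

text \<open>
  The images in \<open>G\<close> of the vertex groups and the edge groups. The two arcs of a geometric edge give
  conjugate edge subgroups.
\<close>
definition vertex_subgroup ::
    "('v, 'e, 'a, 'b) graph_of_groups \<Rightarrow> 'e set \<Rightarrow>
      (('v, 'e, 'a) gog_letter list set \<Rightarrow> 'g) \<Rightarrow> 'v \<Rightarrow> 'g set" where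
  "vertex_subgroup \<G> T \<phi> v =
     (\<lambda>a. \<phi> (gog_class \<G> T [Vertex_elt v a])) ` carrier (vertex_gp \<G> v)"

definition edge_subgroup ::
    "('v, 'e, 'a, 'b) graph_of_groups \<Rightarrow> 'e set \<Rightarrow>
      (('v, 'e, 'a) gog_letter list set \<Rightarrow> 'g) \<Rightarrow> 'e \<Rightarrow> 'g set" where
  "edge_subgroup \<G> T \<phi> e =
     (\<lambda>c. \<phi> (gog_class \<G> T [Vertex_elt (head (gog_graph \<G>) e) (edge_map \<G> e c)]))
       ` carrier (edge_gp \<G> e)"

definition vertex_cosets ::
    "('g, 'm) monoid_scheme \<Rightarrow> ('v, 'e, 'a, 'b) graph_of_groups \<Rightarrow> 'e set \<Rightarrow>
      (('v, 'e, 'a) gog_letter list set \<Rightarrow> 'g) \<Rightarrow> 'g set set" where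
  "vertex_cosets G \<G> T \<phi> =
     {x <#\<^bsub>G\<^esub> vertex_subgroup \<G> T \<phi> v | x v. x \<in> carrier G \<and> v \<in> gog_verts \<G>}"


definition vertex_groups_in :: "('v, 'e, 'a, 'b) graph_of_groups \<Rightarrow> 'a metric set \<Rightarrow> bool" where
  "vertex_groups_in \<G> \<M> \<longleftrightarrow> (\<forall>v\<in>gog_verts \<G>. group_in_class (vertex_gp \<G> v) \<M>)"

definition edge_groups_fg_with ::
    "('g, 'm) monoid_scheme \<Rightarrow> 'g set \<Rightarrow> ('v, 'e, 'a, 'b) graph_of_groups \<Rightarrow> 'e set \<Rightarrow>
      (('v, 'e, 'a) gog_letter list set \<Rightarrow> 'g) \<Rightarrow> ((real \<Rightarrow> nat) \<Rightarrow> bool) \<Rightarrow> bool" where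
  "edge_groups_fg_with G S \<G> T \<phi> P \<longleftrightarrow>
     (\<forall>e\<in>gog_arcs \<G>. finitely_generated (edge_gp \<G> e) \<and>
        P (relative_growth G S (edge_subgroup \<G> T \<phi> e)))"

text \<open>
  A bounded space has no coarsely separating family, so finite groups lie in all the classes
  above. A quasi-isometry sends cosets of a finite vertex group to bounded sets, and
  these are at finite Hausdorff distance from a coset of some vertex group only if the other
  decomposition also has a finite vertex group: compare the decomposition of \<open>\<int>\<^sup>3\<close> with a single
  vertex to the decomposition of \<open>\<int>\<^sup>3\<close> as the free product of \<open>\<int>\<^sup>3\<close> and the trivial group.
\<close>
definition has_finite_vertex_group :: "('v, 'e, 'a, 'b) graph_of_groups \<Rightarrow> bool" where
  "has_finite_vertex_group \<G> \<longleftrightarrow> (\<exists>v\<in>gog_verts \<G>. finite (carrier (vertex_gp \<G> v)))"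


section \<open>The objects defined above are metric spaces and groups\<close>

lemma (in wf_digraph) awalk_reverse:
  assumes "symmetric G" "awalk u p v"
  shows "\<exists>q. awalk v q u \<and> length q = length p"
  using assms(2)
proof (induction p arbitrary: u)
  case Nil
  then show ?case by (auto simp: awalk_Nil_iff)
next
  case (Cons e p)
  then obtain q where q: "awalk v q (head G e)" "length q = length p"
    by (auto simp: awalk_Cons_iff)
  from Cons.prems have e: "e \<in> arcs G" "tail G e = u" by (auto simp: awalk_Cons_iff)
  then obtain e' where e': "e' \<in> arcs G" "tail G e' = head G e" "head G e' = u"
    using assms(1) unfolding symmetric_conv by metis
  then have "awalk (head G e) [e'] u" by (auto simp: awalk_Cons_iff awalk_Nil_iff)
  with q have "awalk v (q @ [e']) u" by auto
  with q show ?case by (intro exI[of _ "q @ [e']"]) simp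
qed

lemma Metric_space_path_dist:
  assumes "wf_digraph X" "symmetric X" "Digraph_Component.connected X"
  shows "Metric_space (verts X) (path_dist X)"
proof -
  interpret wf_digraph X by fact
  define L where "L u v = (LEAST n. \<exists>p. awalk u p v \<and> length p = n)" for u v
  have pd: "path_dist X u v = real (L u v)" for u v
    by (simp add: path_dist_def L_def)
  have reach: "\<exists>p. awalk u p v" if "u \<in> verts X" "v \<in> verts X" for u v
  proof -
    have "parcs (mk_symmetric X) = arcs_ends X"
      using arcs_ends_symmetric[OF assms(2)]
      by (auto simp: parcs_mk_symmetric dest: in_arcs_imp_in_arcs_ends)
    then have "u \<rightarrow>\<^sup>*\<^bsub>X\<^esub> v"
      using assms(3) that unfolding Digraph_Component.connected_def strongly_connected_def
      by (auto simp: reachable_def)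
    then show ?thesis by (simp add: reachable_awalk)
  qed
  have wit: "\<exists>p. awalk u p v \<and> length p = L u v" if "u \<in> verts X" "v \<in> verts X" for u v
  proof -
    have "\<exists>n p. awalk u p v \<and> length p = n" using reach[OF that] by blast
    from LeastI_ex[OF this] show ?thesis unfolding L_def .
  qed
  have le: "L u v \<le> length p" if "awalk u p v" for u v p
    unfolding L_def by (rule Least_le) (use that in blast)
  have sym_le: "L u v \<le> L v u" if "u \<in> verts X" "v \<in> verts X" for u v
    using wit[OF that(2,1)] awalk_reverse[OF assms(2)] le by metis
  show ?thesis
  proof
    show "0 \<le> path_dist X u v" for u v by (simp add: pd)
    show "path_dist X u v = path_dist X v u" for u v
    proof (cases "u \<in> verts X \<and> v \<in> verts X")
      case True
      then show ?thesis using sym_le by (simp add: pd antisym)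
    next
      case False
      then have "\<not> awalk u p v" "\<not> awalk v p u" for p
        using awalk_last_in_verts awalk_hd_in_verts by auto
      then show ?thesis by (simp add: pd L_def)
    qed
    show "path_dist X u v = 0 \<longleftrightarrow> u = v" if "u \<in> verts X" "v \<in> verts X" for u v
      using wit[OF that] le[of u "[]" v] that by (auto simp: pd awalk_Nil_iff)
    show "path_dist X u w \<le> path_dist X u v + path_dist X v w"
      if uvw: "u \<in> verts X" "v \<in> verts X" "w \<in> verts X" for u v w
    proof -
      obtain p q where pq: "awalk u p v" "length p = L u v" "awalk v q w" "length q = L v w"
        using wit[OF uvw(1,2)] wit[OF uvw(2,3)] by blast
      then have "awalk u (p @ q) w" by auto
      then have "L u w \<le> L u v + L v w" using le[of u "p @ q" w] pq by simp
      then show ?thesis by (simp add: pd)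
    qed
  qed
qed

lemma mspace_path_metric:
  assumes "bounded_degree_graph X"
  shows "mspace (path_metric (with_proj X)) = pverts X"
    and "mdist (path_metric (with_proj X)) = path_dist (with_proj X)"
proof -
  interpret pair_bidirected_digraph X
    using assms by (simp add: bounded_degree_graph_def)
  have "symmetric (with_proj X)" by (rule pair_sym_arcs)
  then have "Metric_space (verts (with_proj X)) (path_dist (with_proj X))"
    using assms wf_digraph by (intro Metric_space_path_dist) (auto simp: bounded_degree_graph_def)
  then show "mspace (path_metric (with_proj X)) = pverts X"
    and "mdist (path_metric (with_proj X)) = path_dist (with_proj X)"
    by (simp_all add: path_metric_def Metric_space.mspace_metric Metric_space.mdist_metric)
qed

lemma Metric_space_word_dist:
  assumes "group G" "finite_generating_set G S"
  shows "Metric_space (carrier G) (word_dist G S)"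
proof -
  interpret group G by fact
  define A where "A = S \<union> m_inv G ` S"
  define p where "p ws = foldr (\<otimes>\<^bsub>G\<^esub>) ws \<one>\<^bsub>G\<^esub>" for ws
  have p_simps [simp]: "p [] = \<one>\<^bsub>G\<^esub>" "p (x # ws) = x \<otimes>\<^bsub>G\<^esub> p ws" for x ws
    by (simp_all add: p_def)
  have S: "S \<subseteq> carrier G" "generate G S = carrier G"
    using assms(2) by (auto simp: finite_generating_set_def)
  then have A: "A \<subseteq> carrier G" by (auto simp: A_def)
  have A_I: "s \<in> A" "inv\<^bsub>G\<^esub> s \<in> A" if "s \<in> S" for s
    using that by (auto simp: A_def)
  have A_inv: "inv\<^bsub>G\<^esub> x \<in> A" if "x \<in> A" for x
    using that S by (auto simp: A_def)
  have pc: "p ws \<in> carrier G" if "set ws \<subseteq> A" for ws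
    using that A by (induction ws) auto
  have pa: "p (us @ ws) = p us \<otimes>\<^bsub>G\<^esub> p ws" if "set us \<subseteq> A" "set ws \<subseteq> A" for us ws
    using that(1)
  proof (induction us)
    case Nil
    then show ?case using pc[OF that(2)] by simp
  next
    case (Cons x us)
    then have "x \<in> carrier G" using A by auto
    then show ?case using Cons pc[OF that(2)] pc[of us] by (simp add: m_assoc)
  qed
  have pinv: "\<exists>vs. set vs \<subseteq> A \<and> length vs = length us \<and> p vs = inv\<^bsub>G\<^esub> (p us)"
    if "set us \<subseteq> A" for us
    using that
  proof (induction us)
    case Nil
    then show ?case by simp
  next
    case (Cons x us)
    then obtain vs where vs: "set vs \<subseteq> A" "length vs = length us" "p vs = inv\<^bsub>G\<^esub> (p us)"
      by auto
    have x: "x \<in> carrier G" "inv\<^bsub>G\<^esub> x \<in> A" using Cons.prems A A_inv by auto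
    have "p (vs @ [inv\<^bsub>G\<^esub> x]) = inv\<^bsub>G\<^esub> (p us) \<otimes>\<^bsub>G\<^esub> inv\<^bsub>G\<^esub> x"
      using x vs by (subst pa) auto
    then show ?case
      using x vs pc[of us] Cons.prems
      by (intro exI[of _ "vs @ [inv\<^bsub>G\<^esub> x]"]) (auto simp: inv_mult_group)
  qed
  have ex: "\<exists>ws. set ws \<subseteq> A \<and> p ws = x" if "x \<in> carrier G" for x
  proof -
    have "x \<in> generate G S" using that S by simp
    then show ?thesis
    proof (induction rule: generate.induct)
      case one
      show ?case by (intro exI[of _ "[]"]) simp
    next
      case (incl h)
      then show ?case using S A_I by (intro exI[of _ "[h]"]) auto
    next
      case (inv h)
      then show ?case using S A_I by (intro exI[of _ "[inv\<^bsub>G\<^esub> h]"]) auto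
    next
      case (eng g h)
      then obtain us ws where "set us \<subseteq> A" "p us = g" "set ws \<subseteq> A" "p ws = h" by blast
      then show ?case using pa[of us ws] by (intro exI[of _ "us @ ws"]) auto
    qed
  qed
  have wl: "word_length G S x = (LEAST n. \<exists>ws. length ws = n \<and> set ws \<subseteq> A \<and> p ws = x)" for x
    by (simp add: word_length_def A_def p_def)
  have wit: "\<exists>ws. length ws = word_length G S x \<and> set ws \<subseteq> A \<and> p ws = x"
    if "x \<in> carrier G" for x
  proof -
    have "\<exists>n ws. length ws = n \<and> set ws \<subseteq> A \<and> p ws = x" using ex[OF that] by blast
    from LeastI_ex[OF this] show ?thesis unfolding wl .
  qed
  have le: "word_length G S (p ws) \<le> length ws" if "set ws \<subseteq> A" for ws
    unfolding wl by (rule Least_le) (use that in blast)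
  have inv_le: "word_length G S (inv\<^bsub>G\<^esub> x) \<le> word_length G S x" if "x \<in> carrier G" for x
  proof -
    obtain us where us: "length us = word_length G S x" "set us \<subseteq> A" "p us = x"
      using wit[OF \<open>x \<in> carrier G\<close>] by blast
    then obtain vs where "set vs \<subseteq> A" "length vs = length us" "p vs = inv\<^bsub>G\<^esub> x"
      using pinv by blast
    then show ?thesis using le[of vs] us by simp
  qed
  have inv_eq: "word_length G S (inv\<^bsub>G\<^esub> x) = word_length G S x" if "x \<in> carrier G" for x
    using inv_le[OF that] inv_le[of "inv\<^bsub>G\<^esub> x"] that by simp
  have mult_le: "word_length G S (x \<otimes>\<^bsub>G\<^esub> y) \<le> word_length G S x + word_length G S y"
    if xy: "x \<in> carrier G" "y \<in> carrier G" for x y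
  proof -
    obtain us ws where "length us = word_length G S x" "set us \<subseteq> A" "p us = x"
      "length ws = word_length G S y" "set ws \<subseteq> A" "p ws = y" using wit[OF xy(1)] wit[OF xy(2)] by blast
    then show ?thesis using le[of "us @ ws"] pa[of us ws] by simp
  qed
  have zero: "word_length G S x = 0 \<longleftrightarrow> x = \<one>\<^bsub>G\<^esub>" if "x \<in> carrier G" for x
  proof
    assume "word_length G S x = 0"
    then show "x = \<one>\<^bsub>G\<^esub>" using wit[OF that] by auto
  next
    assume "x = \<one>\<^bsub>G\<^esub>"
    then show "word_length G S x = 0" using le[of "[]"] by simp
  qed
  show ?thesis
  proof
    show "0 \<le> word_dist G S x y" for x y by (simp add: word_dist_def)
    show "word_dist G S x y = word_dist G S y x" for x y
      using inv_eq[of "inv\<^bsub>G\<^esub> x \<otimes>\<^bsub>G\<^esub> y"] by (auto simp: word_dist_def inv_mult_group)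
    show "word_dist G S x y = 0 \<longleftrightarrow> x = y" if "x \<in> carrier G" "y \<in> carrier G" for x y
      using that zero[of "inv\<^bsub>G\<^esub> x \<otimes>\<^bsub>G\<^esub> y"] inv_solve_left'[of "\<one>\<^bsub>G\<^esub>" x y]
      by (auto simp: word_dist_def)
    show "word_dist G S x z \<le> word_dist G S x y + word_dist G S y z"
      if "x \<in> carrier G" "y \<in> carrier G" "z \<in> carrier G" for x y z
    proof -
      have "inv\<^bsub>G\<^esub> x \<otimes>\<^bsub>G\<^esub> y \<otimes>\<^bsub>G\<^esub> (inv\<^bsub>G\<^esub> y \<otimes>\<^bsub>G\<^esub> z) = inv\<^bsub>G\<^esub> x \<otimes>\<^bsub>G\<^esub> z"
      proof -
        have "y \<otimes>\<^bsub>G\<^esub> (inv\<^bsub>G\<^esub> y \<otimes>\<^bsub>G\<^esub> z) = z"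
          using that by (simp add: m_assoc[symmetric])
        then show ?thesis using that by (simp add: m_assoc)
      qed
      then show ?thesis
        using mult_le[of "inv\<^bsub>G\<^esub> x \<otimes>\<^bsub>G\<^esub> y" "inv\<^bsub>G\<^esub> y \<otimes>\<^bsub>G\<^esub> z"] that
        by (simp add: word_dist_def)
    qed
  qed
qed

lemma mspace_word_metric:
  assumes "group G" "finite_generating_set G S"
  shows "mspace (word_metric G S) = carrier G" and "mdist (word_metric G S) = word_dist G S"
  using Metric_space_word_dist[OF assms]
  by (simp_all add: word_metric_def Metric_space.mspace_metric Metric_space.mdist_metric)

lemma word_cong_in_lists:
  "word_cong X R u v \<Longrightarrow> u \<in> lists X \<and> v \<in> lists X"
  by (induction rule: word_cong.induct) auto

lemma word_cong_append:
  assumes "word_cong X R u v" "word_cong X R u' v'"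
  shows "word_cong X R (u @ u') (v @ v')"
proof -
  have ctx: "word_cong X R (p @ x @ q) (p @ y @ q)"
    if "word_cong X R x y" "p \<in> lists X" "q \<in> lists X" for x y p q
    using that
  proof (induction rule: word_cong.induct)
    case (rel a b p' q')
    then have "word_cong X R ((p @ p') @ a @ (q' @ q)) ((p @ p') @ b @ (q' @ q))"
      by (intro word_cong.rel) auto
    then show ?case by simp
  next
    case (refl w)
    then show ?case by (intro word_cong.refl) auto
  next
    case (sym u v)
    then show ?case by (auto intro: word_cong.sym)
  next
    case (trans u v w)
    then show ?case by (auto intro: word_cong.trans)
  qed
  have "word_cong X R (u @ u') (v @ u')"
    using ctx[OF assms(1), of "[]" u'] word_cong_in_lists[OF assms(2)] by simp
  moreover have "word_cong X R (v @ u') (v @ v')"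
    using ctx[OF assms(2), of v "[]"] word_cong_in_lists[OF assms(1)] by simp
  ultimately show ?thesis by (rule word_cong.trans)
qed

lemma word_class_eq_iff:
  assumes "u \<in> lists X"
  shows "word_class X R u = word_class X R v \<longleftrightarrow> word_cong X R u v"
  unfolding word_class_def
  using assms by (blast intro: word_cong.refl word_cong.sym word_cong.trans)

lemma presented_monoid_mult:
  assumes "u \<in> lists X" "v \<in> lists X"
  shows "word_class X R u \<otimes>\<^bsub>presented_monoid X R\<^esub> word_class X R v = word_class X R (u @ v)"
proof -
  have eq: "word_class X R (a @ b) = word_class X R (u @ v)"
    if "a \<in> word_class X R u" "b \<in> word_class X R v" for a b
  proof -
    have "word_cong X R (u @ v) (a @ b)"
      using that by (auto simp: word_class_def intro: word_cong_append)
    then show ?thesis using word_class_eq_iff[of "u @ v" X R "a @ b"] assms by auto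
  qed
  have "u \<in> word_class X R u" "v \<in> word_class X R v"
    using assms by (auto simp: word_class_def intro: word_cong.refl)
  then have "(\<Union>a\<in>word_class X R u. \<Union>b\<in>word_class X R v. word_class X R (a @ b)) =
             word_class X R (u @ v)"
    using eq by blast
  then show ?thesis by (simp add: presented_monoid_def)
qed

lemma group_presented_monoid:
  assumes "\<And>x. x \<in> X \<Longrightarrow> \<exists>y\<in>X. word_cong X R [y, x] []"
  shows "group (presented_monoid X R)"
proof (rule groupI)
  let ?P = "presented_monoid X R"
  have car: "carrier ?P = word_class X R ` lists X" and one: "\<one>\<^bsub>?P\<^esub> = word_class X R []"
    by (simp_all add: presented_monoid_def)
  show "x \<otimes>\<^bsub>?P\<^esub> y \<in> carrier ?P" if xyz: "x \<in> carrier ?P" "y \<in> carrier ?P" for x y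
  proof -
    obtain u v where uv: "u \<in> lists X" "v \<in> lists X"
      and xy: "x = word_class X R u" "y = word_class X R v"
      using xyz unfolding car by blast
    show ?thesis
      unfolding xy presented_monoid_mult[OF uv] car
      by (rule imageI) (use uv in \<open>simp only: append_in_lists_conv\<close>)
  qed
  show "\<one>\<^bsub>?P\<^esub> \<in> carrier ?P" by (auto simp: car one)
  show "x \<otimes>\<^bsub>?P\<^esub> y \<otimes>\<^bsub>?P\<^esub> z = x \<otimes>\<^bsub>?P\<^esub> (y \<otimes>\<^bsub>?P\<^esub> z)"
    if xyz: "x \<in> carrier ?P" "y \<in> carrier ?P" "z \<in> carrier ?P" for x y z
  proof -
    obtain u v w where uvw: "u \<in> lists X" "v \<in> lists X" "w \<in> lists X"
      and eqs: "x = word_class X R u" "y = word_class X R v" "z = word_class X R w"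
      using xyz unfolding car by blast
    have "u @ v \<in> lists X" "v @ w \<in> lists X" using uvw by (simp_all only: append_in_lists_conv)
    then show ?thesis
      unfolding eqs presented_monoid_mult[OF uvw(1,2)] presented_monoid_mult[OF uvw(2,3)]
      using presented_monoid_mult[of "u @ v" X w R] presented_monoid_mult[of u X "v @ w" R] uvw
      by (simp only: append_assoc)
  qed
  show "\<one>\<^bsub>?P\<^esub> \<otimes>\<^bsub>?P\<^esub> x = x" if xyz: "x \<in> carrier ?P" for x
  proof -
    obtain u where u: "u \<in> lists X" "x = word_class X R u"
      using xyz unfolding car by blast
    show ?thesis
      unfolding u(2) one presented_monoid_mult[OF lists.Nil u(1)] by simp
  qed
  have inverse: "\<exists>v\<in>lists X. word_cong X R (v @ w) []" if "w \<in> lists X" for w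
    using that
  proof (induction w)
    case Nil
    show ?case by (rule bexI[of _ "[]"]) (simp_all add: word_cong.refl)
  next
    case (Cons x w)
    then obtain v where v: "v \<in> lists X" "word_cong X R (v @ w) []" by auto
    obtain y where y: "y \<in> X" "word_cong X R [y, x] []" using assms Cons.hyps by blast
    have "word_cong X R (v @ [y, x]) (v @ [])"
      by (rule word_cong_append[OF word_cong.refl[OF v(1)] y(2)])
    then have "word_cong X R ((v @ [y, x]) @ w) ((v @ []) @ w)"
      by (rule word_cong_append[OF _ word_cong.refl[OF Cons.hyps(2)]])
    then have "word_cong X R ((v @ [y]) @ x # w) (v @ w)" by simp
    from word_cong.trans[OF this v(2)] have "word_cong X R ((v @ [y]) @ x # w) []" .
    moreover have "v @ [y] \<in> lists X" using v y by simp
    ultimately show ?case by (rule bexI[of _ "v @ [y]"])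
  qed
  show "\<exists>y\<in>carrier ?P. y \<otimes>\<^bsub>?P\<^esub> x = \<one>\<^bsub>?P\<^esub>" if xyz: "x \<in> carrier ?P" for x
  proof -
    obtain u where u: "u \<in> lists X" "x = word_class X R u"
      using xyz unfolding car by blast
    obtain v where v: "v \<in> lists X" "word_cong X R (v @ u) []" using inverse[OF u(1)] by blast
    have "v @ u \<in> lists X" using u v by simp
    then have "word_class X R v \<otimes>\<^bsub>?P\<^esub> x = \<one>\<^bsub>?P\<^esub>"
      unfolding u(2) one presented_monoid_mult[OF v(1) u(1)] by (simp only: word_class_eq_iff v(2))
    moreover have "word_class X R v \<in> carrier ?P" unfolding car using v(1) by (rule imageI)
    ultimately show ?thesis by (rule bexI[of _ "word_class X R v"])
  qed
qed

lemma group_fundamental_group: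
  assumes "finite_graph_of_groups \<G>"
  shows "group (fundamental_group \<G> T)"
  unfolding fundamental_group_def
proof (rule group_presented_monoid)
  let ?X = "gog_generators \<G>" and ?R = "gog_relations \<G> T"
  interpret bidirected_digraph "gog_graph \<G>" "gog_rev \<G>"
    using assms by (simp add: finite_graph_of_groups_def)
  fix x assume x: "x \<in> ?X"
  show "\<exists>y\<in>?X. word_cong ?X ?R [y, x] []"
  proof (cases x)
    case (Vertex_elt v a)
    with x have v: "v \<in> gog_verts \<G>" and a: "a \<in> carrier (vertex_gp \<G> v)"
      by (auto simp: gog_generators_def)
    interpret V: group "vertex_gp \<G> v" using assms v by (simp add: finite_graph_of_groups_def)
    let ?b = "inv\<^bsub>vertex_gp \<G> v\<^esub> a"
    have gen: "Vertex_elt v c \<in> ?X" if "c \<in> carrier (vertex_gp \<G> v)" for c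
      using that v by (auto simp: gog_generators_def)
    have "([Vertex_elt v ?b, Vertex_elt v a], [Vertex_elt v (?b \<otimes>\<^bsub>vertex_gp \<G> v\<^esub> a)]) \<in> ?R"
      using v a V.inv_closed[OF a] by (simp add: gog_relations_def)
    from word_cong.rel[OF this, of "[]" "[]"] have 1:
      "word_cong ?X ?R [Vertex_elt v ?b, Vertex_elt v a] [Vertex_elt v \<one>\<^bsub>vertex_gp \<G> v\<^esub>]"
      using a gen by simp
    have "([Vertex_elt v \<one>\<^bsub>vertex_gp \<G> v\<^esub>], []) \<in> ?R"
      using v by (simp add: gog_relations_def)
    from word_cong.rel[OF this, of "[]" "[]"] have
      "word_cong ?X ?R [Vertex_elt v \<one>\<^bsub>vertex_gp \<G> v\<^esub>] []" using gen by simp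
    with 1 have "word_cong ?X ?R [Vertex_elt v ?b, Vertex_elt v a] []" by (rule word_cong.trans)
    then show ?thesis using gen a Vertex_elt by (intro bexI[of _ "Vertex_elt v ?b"]) auto
  next
    case (Edge_elt e)
    with x have e: "e \<in> gog_arcs \<G>" by (auto simp: gog_generators_def)
    let ?y = "Edge_elt (gog_rev \<G> e)"
    have y: "?y \<in> ?X" using e by (auto simp: gog_generators_def)
    have "([Edge_elt (gog_rev \<G> e), Edge_elt (gog_rev \<G> (gog_rev \<G> e))], []) \<in> ?R"
      using arev_in_arcs[OF e] by (simp add: gog_relations_def)
    from word_cong.rel[OF this, of "[]" "[]"] show ?thesis
      using x y Edge_elt by (intro bexI[of _ ?y]) simp_all
  qed
qed

end

theory Submission
  imports Defs "HOL-Real_Asymp.Real_Asymp"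
begin

text \<open>
  A decomposed group \<open>G\<close> acts on its Bass--Serre tree. The vertices of the tree are the cosets
  \<open>g H v\<close> of the vertex groups, its edges are the cosets \<open>h K e\<close> of the edge groups, and removing an
  edge disconnects it. So every edge coset cuts \<open>G\<close> into two sides, and a path in the Cayley graph
  that changes sides passes near that coset.

  Let \<open>X\<close> be a graph that is quasi-isometric to a vertex group and hard to separate, and map it
  coarsely into \<open>G\<close>. Preimages of neighbourhoods of edge cosets grow too slowly to form a coarsely
  separating family. Hence for each edge all points of \<open>X\<close> that are far from the edge coset lie on
  one side, and this orients the edge towards that side. Only finitely many edge cosets come close
  to a given point of the image, so a walk in the tree that starts at this point and follows the
  arrows must stop, at a vertex towards which all its edges point. The whole image of \<open>X\<close> then
  stays in a neighbourhood of the coset of this vertex (\<open>trapped_in_vertex_coset\<close>, \<open>trapped\<close>).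

  Apply this to a quasi-isometry \<open>f\<close> and to a quasi-inverse \<open>g\<close>: \<open>f\<close> sends a vertex coset near a
  vertex coset \<open>Q\<close>, and \<open>g\<close> sends \<open>Q\<close> near a vertex coset again. If the latter were not the initial
  one, then the initial coset would lie in a neighbourhood of an edge coset (\<open>close_vertex_cosets\<close>);
  spheres in a graph then grow too slowly to separate, which is impossible in an unbounded graph
  (\<open>bounded_if_near_edge_coset\<close>). So for infinite vertex groups one returns to the initial coset,
  which bounds the Hausdorff distance. Cosets of finite vertex groups are bounded, and here the
  other decomposition has to supply a finite vertex group.

  The Bass--Serre tree is not constructed. What is needed of it are the two sides of each edge, as
  functions on the vertex cosets that change across this edge only (\<open>wall_exists\<close>), and the
  injectivity of the vertex groups (\<open>vertex_inj\<close>). Both are consequences of the universal property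
  of the fundamental group, for actions on sets that are written down explicitly.
\<close>

section \<open>Actions assembled along a maximal tree\<close>

lemma symmetric_connected_walk:
  assumes "wf_digraph D" "symmetric D" "Digraph_Component.connected D" "u \<in> verts D" "v \<in> verts D"
  shows "\<exists>p. pre_digraph.awalk D u p v"
proof -
  interpret wf_digraph D by fact
  have "parcs (mk_symmetric D) = arcs_ends D"
    using arcs_ends_symmetric[OF assms(2)] in_arcs_imp_in_arcs_ends
    unfolding parcs_mk_symmetric by fast
  then have "u \<rightarrow>\<^sup>*\<^bsub>D\<^esub> v"
    using assms(3-5) unfolding Digraph_Component.connected_def strongly_connected_def
    by (auto simp: reachable_def)
  then show ?thesis by (simp add: reachable_awalk)
qed

locale gog_with_tree =
  fixes \<G> :: "('v, 'e, 'a, 'b) graph_of_groups" and T :: "'e set"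
  assumes finite_gog: "finite_graph_of_groups \<G>"
    and max_tree: "maximal_tree (gog_graph \<G>) (gog_rev \<G>) T"
begin

abbreviation "V \<equiv> gog_verts \<G>"
abbreviation "A \<equiv> gog_arcs \<G>"
abbreviation "src \<equiv> tail (gog_graph \<G>)"
abbreviation "tgt \<equiv> head (gog_graph \<G>)"
abbreviation "rv \<equiv> gog_rev \<G>"
abbreviation "gens \<equiv> gog_generators \<G>"
abbreviation "rels \<equiv> gog_relations \<G> T"
abbreviation "tree_graph \<equiv> (gog_graph \<G>)\<lparr>arcs := T\<rparr>"

lemma bidirected: "bidirected_digraph (gog_graph \<G>) rv"
  using finite_gog by (simp add: finite_graph_of_groups_def)

lemma finite_A: "finite A"
  using finite_gog by (auto simp: finite_graph_of_groups_def fin_digraph_def fin_digraph_axioms_def)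

lemma src_V [simp]: "e \<in> A \<Longrightarrow> src e \<in> V" and tgt_V [simp]: "e \<in> A \<Longrightarrow> tgt e \<in> V"
  using bidirected
  by (auto simp: bidirected_digraph_def wf_digraph.tail_in_verts wf_digraph.head_in_verts)

lemma rv_rv [simp]: "e \<in> A \<Longrightarrow> rv (rv e) = e"
  by (rule bidirected_digraph.arev_arev_raw[OF bidirected])

lemma rv_neq: "e \<in> A \<Longrightarrow> rv e \<noteq> e"
  using bidirected_digraph.arev_dom[OF bidirected] by blast

lemma rv_A [simp]: "e \<in> A \<Longrightarrow> rv e \<in> A"
  using bidirected_digraph.arev_dom[OF bidirected] rv_rv rv_neq by metis

lemma src_rv [simp]: "e \<in> A \<Longrightarrow> src (rv e) = tgt e"
  by (rule bidirected_digraph.tail_arev[OF bidirected])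

lemma tgt_rv [simp]: "e \<in> A \<Longrightarrow> tgt (rv e) = src e"
  using src_rv[of "rv e"] by simp

lemma group_vertex: "v \<in> V \<Longrightarrow> group (vertex_gp \<G> v)"
  using finite_gog by (simp add: finite_graph_of_groups_def)

lemma group_edge: "e \<in> A \<Longrightarrow> group (edge_gp \<G> e)"
  and edge_gp_rv: "e \<in> A \<Longrightarrow> edge_gp \<G> (rv e) = edge_gp \<G> e"
  and edge_map_mon: "e \<in> A \<Longrightarrow> edge_map \<G> e \<in> mon (edge_gp \<G> e) (vertex_gp \<G> (tgt e))"
  using finite_gog by (auto simp: finite_graph_of_groups_def)

lemma edge_map_closed:
  "e \<in> A \<Longrightarrow> c \<in> carrier (edge_gp \<G> e) \<Longrightarrow> edge_map \<G> e c \<in> carrier (vertex_gp \<G> (tgt e))"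
  using edge_map_mon[of e] by (auto simp: mon_def hom_def)

lemma edge_map_rv_closed:
  "e \<in> A \<Longrightarrow> c \<in> carrier (edge_gp \<G> e) \<Longrightarrow> edge_map \<G> (rv e) c \<in> carrier (vertex_gp \<G> (src e))"
  using edge_map_closed[of "rv e" c] by (simp add: edge_gp_rv)

lemma T_A: "e \<in> T \<Longrightarrow> e \<in> A" and T_rv: "e \<in> T \<Longrightarrow> rv e \<in> T"
  using max_tree by (auto simp: maximal_tree_def)

lemma tree_cycle: "pre_digraph.cycle tree_graph p \<Longrightarrow> \<exists>e. p = [e, rv e]"
  using max_tree by (auto simp: maximal_tree_def)

lemma tree_wf: "wf_digraph tree_graph"
  by unfold_locales (simp_all add: T_A)

sublocale tree: wf_digraph tree_graph
  by (rule tree_wf)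

lemma tree_symmetric: "symmetric tree_graph"
  unfolding symmetric_conv
proof (intro ballI)
  fix e assume "e \<in> arcs tree_graph"
  then show "\<exists>e'\<in>arcs tree_graph. tail tree_graph e = head tree_graph e' \<and> head tree_graph e = tail tree_graph e'"
    by (intro bexI[of _ "rv e"]) (auto simp: T_rv T_A)
qed

lemma tree_walk: "u \<in> V \<Longrightarrow> v \<in> V \<Longrightarrow> \<exists>p. tree.awalk u p v"
  using symmetric_connected_walk[OF tree_wf tree_symmetric] max_tree by (simp add: maximal_tree_def)

lemma V_nonempty: "V \<noteq> {}"
  using max_tree
  unfolding maximal_tree_def Digraph_Component.connected_def strongly_connected_def
  by auto

end

text \<open>
  A graph of right actions. Since \<open>tr e\<close> intertwines the two actions of the edge group, these data
  assemble to a right action of the fundamental group, on the set of sections over the maximal tree.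
\<close>
locale gog_action = gog_with_tree \<G> T
  for \<G> :: "('v, 'e, 'a, 'b) graph_of_groups" and T :: "'e set" +
  fixes \<Omega> :: "'v \<Rightarrow> 'x set" and act :: "'v \<Rightarrow> 'x \<Rightarrow> 'a \<Rightarrow> 'x" and tr :: "'e \<Rightarrow> 'x \<Rightarrow> 'x"
  assumes act_closed: "\<lbrakk>v \<in> V; x \<in> \<Omega> v; a \<in> carrier (vertex_gp \<G> v)\<rbrakk> \<Longrightarrow> act v x a \<in> \<Omega> v"
    and act_one: "\<lbrakk>v \<in> V; x \<in> \<Omega> v\<rbrakk> \<Longrightarrow> act v x \<one>\<^bsub>vertex_gp \<G> v\<^esub> = x"
    and act_mult: "\<lbrakk>v \<in> V; x \<in> \<Omega> v; a \<in> carrier (vertex_gp \<G> v); b \<in> carrier (vertex_gp \<G> v)\<rbrakk>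
       \<Longrightarrow> act v (act v x a) b = act v x (a \<otimes>\<^bsub>vertex_gp \<G> v\<^esub> b)"
    and tr_closed: "\<lbrakk>e \<in> A; x \<in> \<Omega> (src e)\<rbrakk> \<Longrightarrow> tr e x \<in> \<Omega> (tgt e)"
    and tr_rv: "\<lbrakk>e \<in> A; x \<in> \<Omega> (src e)\<rbrakk> \<Longrightarrow> tr (rv e) (tr e x) = x"
    and tr_act: "\<lbrakk>e \<in> A; x \<in> \<Omega> (src e); c \<in> carrier (edge_gp \<G> e)\<rbrakk> \<Longrightarrow>
        tr e (act (src e) x (edge_map \<G> (rv e) c)) = act (tgt e) (tr e x) (edge_map \<G> e c)"
begin

lemma transport_closed: "tree.awalk u p v \<Longrightarrow> x \<in> \<Omega> u \<Longrightarrow> fold tr p x \<in> \<Omega> v"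
proof (induction p arbitrary: u x)
  case Nil
  then show ?case by (simp add: tree.awalk_Nil_iff)
next
  case (Cons e p)
  then have "e \<in> T" "u = src e" "tree.awalk (tgt e) p v"
    by (auto simp: tree.awalk_Cons_iff)
  then show ?case using Cons tr_closed[of e x] T_A by auto
qed

lemma transport_inj:
  "\<lbrakk>tree.awalk u p v; x \<in> \<Omega> u; y \<in> \<Omega> u; fold tr p x = fold tr p y\<rbrakk> \<Longrightarrow> x = y"
proof (induction p arbitrary: u x y)
  case Nil
  then show ?case by simp
next
  case (Cons e p)
  then have e: "e \<in> A" "u = src e" "tree.awalk (tgt e) p v"
    by (auto simp: tree.awalk_Cons_iff T_A)
  then have "tr e x = tr e y"
    using Cons.IH[of "tgt e" "tr e x" "tr e y"] Cons.prems tr_closed by auto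
  then show ?case using tr_rv e Cons.prems by metis
qed

text \<open>
  A closed walk without repeated vertices is a cycle, hence backtracks along one edge of the tree;
  any other closed walk splits off a shorter closed walk.
\<close>
lemma transport_closed_walk:
  "tree.awalk u p u \<Longrightarrow> x \<in> \<Omega> u \<Longrightarrow> fold tr p x = x"
proof (induction p arbitrary: u x rule: length_induct)
  case (1 p)
  show ?case
  proof (cases p)
    case Nil
    then show ?thesis by simp
  next
    case (Cons e p')
    with 1 have e: "e \<in> T" "u = src e" and p': "tree.awalk (tgt e) p' u"
      by (auto simp: tree.awalk_Cons_iff)
    show ?thesis
    proof (cases "distinct (tree.awalk_verts (tgt e) p')")
      case True
      then have "pre_digraph.cycle tree_graph p"
        using 1(2) Cons e unfolding pre_digraph.cycle_def by (intro exI[of _ u]) auto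
      then obtain e' where "p = [e', rv e']" using tree_cycle by blast
      with Cons show ?thesis using tr_rv[of e x] e 1 T_A by simp
    next
      case False
      then obtain q r s w where pp: "p' = q @ r @ s" "0 < length r"
        "tree.awalk (tgt e) q w" "tree.awalk w r w" "tree.awalk w s u"
        using tree.awalk_not_distinct_decomp[OF p'] by blast
      have eq: "tree.awalk u (e # q) w"
        using pp(3) e by (auto simp: tree.awalk_Cons_iff T_A)
      have "fold tr r (fold tr (e # q) x) = fold tr (e # q) x"
        using 1(1) pp Cons transport_closed[OF eq 1(3)] by simp
      moreover have "fold tr ((e # q) @ s) x = x"
      proof -
        have "tree.awalk u ((e # q) @ s) u" using eq pp(5) by (rule tree.awalk_appendI)
        moreover have "length ((e # q) @ s) < length p" using Cons pp by simp
        ultimately show ?thesis using 1(1,3) by blast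
      qed
      ultimately show ?thesis using Cons pp by simp
    qed
  qed
qed

text \<open>
  A section is determined by its value at any one vertex, which can be prescribed. Requiring
  compatibility along \<open>T\<close> makes the letters of the arcs in \<open>T\<close> act trivially.
\<close>
definition sections :: "('v \<Rightarrow> 'x) set" where
  "sections = {\<xi> \<in> extensional V. (\<forall>v\<in>V. \<xi> v \<in> \<Omega> v) \<and> (\<forall>e\<in>T. \<xi> (tgt e) = tr e (\<xi> (src e)))}"

definition section_through :: "'v \<Rightarrow> 'x \<Rightarrow> 'v \<Rightarrow> 'x" where
  "section_through v x = (\<lambda>w\<in>V. fold tr (SOME p. tree.awalk v p w) x)"

lemma section_through_eq:
  assumes "v \<in> V" "w \<in> V" "x \<in> \<Omega> v" "tree.awalk v p w"
  shows "section_through v x w = fold tr p x"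
proof -
  define q where "q = (SOME p. tree.awalk v p w)"
  have q: "tree.awalk v q w" unfolding q_def using assms(4) by (rule someI)
  obtain r where r: "tree.awalk w r v" using tree_walk assms by blast
  have "fold tr r (fold tr q x) = x" "fold tr r (fold tr p x) = x"
    using transport_closed_walk[of v "q @ r" x] transport_closed_walk[of v "p @ r" x] q r assms
      tree.awalk_appendI by auto
  then have "fold tr q x = fold tr p x"
    using transport_inj[OF r] transport_closed q assms by metis
  then show ?thesis using assms by (simp add: section_through_def q_def)
qed

lemma section_through_at: "v \<in> V \<Longrightarrow> x \<in> \<Omega> v \<Longrightarrow> section_through v x v = x"
  using section_through_eq[of v v x "[]"] by (simp add: tree.awalk_Nil_iff)

lemma section_through_sections:
  assumes "v \<in> V" "x \<in> \<Omega> v"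
  shows "section_through v x \<in> sections"
  unfolding sections_def
proof (intro CollectI conjI ballI)
  show "section_through v x \<in> extensional V" by (simp add: section_through_def)
  show "section_through v x w \<in> \<Omega> w" if "w \<in> V" for w
    using tree_walk[OF assms(1) that] section_through_eq[OF assms(1) that assms(2)]
      transport_closed assms by metis
  show "section_through v x (tgt e) = tr e (section_through v x (src e))" if e: "e \<in> T" for e
  proof -
    obtain p where p: "tree.awalk v p (src e)" using tree_walk[OF assms(1)] src_V T_A e by blast
    have "tree.awalk v (p @ [e]) (tgt e)"
      using p e T_A[OF e]
      by (intro tree.awalk_appendI[OF p]) (simp add: tree.awalk_Cons_iff tree.awalk_Nil_iff)
    then show ?thesis
      using section_through_eq[OF assms(1) _ assms(2) p]
        section_through_eq[OF assms(1) _ assms(2), of "tgt e" "p @ [e]"] T_A[OF e] by simp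
  qed
qed

lemma section_transport:
  "\<xi> \<in> sections \<Longrightarrow> tree.awalk u p v \<Longrightarrow> \<xi> v = fold tr p (\<xi> u)"
proof (induction p arbitrary: u)
  case Nil
  then show ?case by (simp add: tree.awalk_Nil_iff)
next
  case (Cons e p)
  then show ?case by (auto simp: tree.awalk_Cons_iff sections_def)
qed

lemma sections_at: "\<xi> \<in> sections \<Longrightarrow> v \<in> V \<Longrightarrow> \<xi> v \<in> \<Omega> v"
  by (simp add: sections_def)

lemma section_through_section:
  assumes "\<xi> \<in> sections" "v \<in> V"
  shows "section_through v (\<xi> v) = \<xi>"
proof
  fix w
  show "section_through v (\<xi> v) w = \<xi> w"
  proof (cases "w \<in> V")
    case True
    obtain p where "tree.awalk v p w" using tree_walk assms True by blast
    then show ?thesis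
      using section_through_eq[OF assms(2) True] section_transport sections_at assms by metis
  next
    case False
    then show ?thesis using assms by (simp add: section_through_def sections_def extensional_def)
  qed
qed

primrec act_letter :: "('v, 'e, 'a) gog_letter \<Rightarrow> ('v \<Rightarrow> 'x) \<Rightarrow> 'v \<Rightarrow> 'x" where
  "act_letter (Vertex_elt v a) \<xi> = section_through v (act v (\<xi> v) a)"
| "act_letter (Edge_elt e) \<xi> = section_through (tgt e) (tr e (\<xi> (src e)))"

abbreviation "act_word w \<equiv> fold act_letter w"

lemma act_letter_sections: "l \<in> gens \<Longrightarrow> \<xi> \<in> sections \<Longrightarrow> act_letter l \<xi> \<in> sections"
  by (cases l) (auto simp: gog_generators_def sections_at act_closed tr_closed
      intro!: section_through_sections)

lemma act_word_sections: "w \<in> lists gens \<Longrightarrow> \<xi> \<in> sections \<Longrightarrow> act_word w \<xi> \<in> sections"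
  by (induction w arbitrary: \<xi>) (auto intro: act_letter_sections)

lemma act_word_relation:
  assumes "(u, w) \<in> rels" "\<xi> \<in> sections"
  shows "act_word u \<xi> = act_word w \<xi>"
  using assms(1) unfolding gog_relations_def
proof (elim UnE CollectE exE conjE)
  fix v a b
  assume "(u, w) = ([Vertex_elt v a, Vertex_elt v b], [Vertex_elt v (a \<otimes>\<^bsub>vertex_gp \<G> v\<^esub> b)])"
    "v \<in> V" "a \<in> carrier (vertex_gp \<G> v)" "b \<in> carrier (vertex_gp \<G> v)"
  then show ?thesis
    using assms(2) by (simp add: section_through_at act_closed sections_at act_mult)
next
  fix v assume "(u, w) = ([Vertex_elt v \<one>\<^bsub>vertex_gp \<G> v\<^esub>], [])" "v \<in> V"
  then show ?thesis
    using assms(2) by (simp add: sections_at act_one section_through_section)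
next
  fix e assume "(u, w) = ([Edge_elt e, Edge_elt (rv e)], [])" "e \<in> A"
  then show ?thesis
    using assms(2)
    by (simp add: section_through_at tr_closed sections_at tr_rv section_through_section)
next
  fix e c
  assume "(u, w) = ([Edge_elt e, Vertex_elt (tgt e) (edge_map \<G> e c)],
       [Vertex_elt (src e) (edge_map \<G> (rv e) c), Edge_elt e])"
    and e: "e \<in> A" "c \<in> carrier (edge_gp \<G> e)"
  then show ?thesis
    using assms(2) edge_map_rv_closed[OF e]
    by (simp add: section_through_at tr_closed act_closed sections_at tr_act)
next
  fix e assume "(u, w) = ([Edge_elt e], [])" "e \<in> T"
  then show ?thesis
    using assms(2) section_through_section[of \<xi> "tgt e"] T_A by (auto simp: sections_def)
qed

text \<open>
  The universal property of the fundamental group: a word acts on sections by the element that it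
  represents.
\<close>
theorem act_word_cong:
  "word_cong gens rels u w \<Longrightarrow> \<xi> \<in> sections \<Longrightarrow> act_word u \<xi> = act_word w \<xi>"
proof (induction arbitrary: \<xi> rule: word_cong.induct)
  case (rel u v p q)
  then show ?case using act_word_relation[of u v "act_word p \<xi>"] act_word_sections[of p \<xi>] by simp
qed auto

end

section \<open>Walls in a decomposed group\<close>

lemma (in group) inv_mult_mult:
  "x \<in> carrier G \<Longrightarrow> y \<in> carrier G \<Longrightarrow> z \<in> carrier G \<Longrightarrow> inv x \<otimes> y \<otimes> (inv y \<otimes> z) = inv x \<otimes> z"
proof -
  assume xyz: "x \<in> carrier G" "y \<in> carrier G" "z \<in> carrier G"
  then have "y \<otimes> (inv y \<otimes> z) = z" by (simp add: m_assoc[symmetric])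
  then show ?thesis using xyz by (simp add: m_assoc)
qed

lemma (in group) left_transversal:
  assumes "subgroup B G"
  shows "\<exists>r. (\<forall>x\<in>carrier G. r x \<in> carrier G \<and> inv x \<otimes> r x \<in> B) \<and>
     (\<forall>x\<in>carrier G. \<forall>y\<in>carrier G. inv x \<otimes> y \<in> B \<longrightarrow> r x = r y)"
proof -
  define r where "r x = (SOME y. y \<in> carrier G \<and> inv x \<otimes> y \<in> B)" for x
  have r: "r x \<in> carrier G \<and> inv x \<otimes> r x \<in> B" if "x \<in> carrier G" for x
    unfolding r_def
    by (rule someI[of _ x]) (use that subgroup.one_closed[OF assms] in simp)
  have B_trans: "inv x \<otimes> z \<in> B"
    if "inv x \<otimes> y \<in> B" "inv y \<otimes> z \<in> B" "x \<in> carrier G" "y \<in> carrier G" "z \<in> carrier G" for x y z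
    using subgroup.m_closed[OF assms that(1,2)] inv_mult_mult[OF that(3-5)] by simp
  have B_sym: "inv y \<otimes> x \<in> B" if "inv x \<otimes> y \<in> B" "x \<in> carrier G" "y \<in> carrier G" for x y
    using subgroup.m_inv_closed[OF assms that(1)] that(2,3) by (simp add: inv_mult_group)
  have r_eq: "r x = r y" if xy: "x \<in> carrier G" "y \<in> carrier G" "inv x \<otimes> y \<in> B" for x y
  proof -
    have "(\<lambda>z. z \<in> carrier G \<and> inv x \<otimes> z \<in> B) = (\<lambda>z. z \<in> carrier G \<and> inv y \<otimes> z \<in> B)"
      using B_trans B_sym xy by blast
    then show ?thesis unfolding r_def by simp
  qed
  show ?thesis using r r_eq by blast
qed

text \<open>
  As a right \<open>C\<close>-set, \<open>H \<times> \<nat>\<close> is free with one orbit for each pair of a coset and a natural number.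
  The factor \<open>\<nat>\<close> makes the number of orbits countably infinite whatever the index of \<open>C\<close>, so all
  these \<open>C\<close>-sets are isomorphic to the same model \<open>C \<times> \<nat>\<close>.
\<close>
lemma free_action_model:
  fixes C :: "('b, 'm) monoid_scheme" and H :: "('a, 'n) monoid_scheme"
  assumes "group C" "group H" "countable (carrier H)" "f \<in> mon C H"
  shows "\<exists>\<theta>. bij_betw \<theta> (carrier C \<times> (UNIV :: nat set)) (carrier H \<times> (UNIV :: nat set)) \<and>
     (\<forall>c\<in>carrier C. \<forall>c'\<in>carrier C. \<forall>n.
        \<theta> (c \<otimes>\<^bsub>C\<^esub> c', n) = (fst (\<theta> (c, n)) \<otimes>\<^bsub>H\<^esub> f c', snd (\<theta> (c, n))))"
proof -
  interpret C: group C by fact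
  interpret H: group H by fact
  have f: "f \<in> hom C H" "inj_on f (carrier C)" using assms(4) by (auto simp: mon_def)
  interpret f: group_hom C H f by (rule group_hom.intro[OF assms(1,2)]) (simp add: group_hom_axioms_def f)
  define B where "B = f ` carrier C"
  have B: "subgroup B H" unfolding B_def by (rule f.img_is_subgroup)
  obtain r where r: "\<And>x. x \<in> carrier H \<Longrightarrow> r x \<in> carrier H"
      "\<And>x. x \<in> carrier H \<Longrightarrow> inv\<^bsub>H\<^esub> x \<otimes>\<^bsub>H\<^esub> r x \<in> B"
    and r_eq: "\<And>x y. \<lbrakk>x \<in> carrier H; y \<in> carrier H; inv\<^bsub>H\<^esub> x \<otimes>\<^bsub>H\<^esub> y \<in> B\<rbrakk> \<Longrightarrow> r x = r y"
    using H.left_transversal[OF B] by blast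
  \<comment> \<open>the set of orbits, enumerated by \<open>b\<close>\<close>
  define Q where "Q = (r ` carrier H) \<times> (UNIV :: nat set)"
  have "infinite Q" unfolding Q_def by (auto simp: finite_cartesian_product_iff)
  moreover have "countable Q" unfolding Q_def using assms(3) by auto
  ultimately have b: "bij_betw (from_nat_into Q) UNIV Q" by (rule bij_betw_from_nat_into[rotated])
  define b where "b = from_nat_into Q"
  have b_inj: "b n = b m \<Longrightarrow> n = m" for n m
    using b unfolding b_def bij_betw_def inj_on_def by blast
  have b_Q: "b n \<in> Q" for n using b unfolding b_def bij_betw_def by blast
  have b_ex: "\<exists>n. b n = q" if "q \<in> Q" for q using b that unfolding b_def bij_betw_def by (metis imageE)
  have bH: "fst (b n) \<in> carrier H" for n using b_Q[of n] r by (auto simp: Q_def)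
  define \<theta> where "\<theta> = (\<lambda>(c, n). (fst (b n) \<otimes>\<^bsub>H\<^esub> f c, snd (b n)))"
  have r_inv: "inv\<^bsub>H\<^esub> (r x) \<otimes>\<^bsub>H\<^esub> x \<in> B" if "x \<in> carrier H" for x
    using subgroup.m_inv_closed[OF B r(2)[OF that]] r(1)[OF that] that by (simp add: H.inv_mult_group)
  have r_r: "r (fst (b n)) = fst (b n)" for n
  proof -
    obtain x where "x \<in> carrier H" "fst (b n) = r x" using b_Q[of n] by (auto simp: Q_def)
    then show ?thesis using r_eq[of x "r x"] r[of x] by simp
  qed
  have "inj_on \<theta> (carrier C \<times> UNIV)"
  proof (rule inj_onI, clarsimp simp: \<theta>_def)
    fix c n c' n'
    assume cc: "c \<in> carrier C" "c' \<in> carrier C" and s: "snd (b n) = snd (b n')"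
      and eq: "fst (b n) \<otimes>\<^bsub>H\<^esub> f c = fst (b n') \<otimes>\<^bsub>H\<^esub> f c'"
    have "inv\<^bsub>H\<^esub> (fst (b n)) \<otimes>\<^bsub>H\<^esub> fst (b n') = f c \<otimes>\<^bsub>H\<^esub> inv\<^bsub>H\<^esub> (f c')"
    proof -
      have "fst (b n') = fst (b n) \<otimes>\<^bsub>H\<^esub> f c \<otimes>\<^bsub>H\<^esub> inv\<^bsub>H\<^esub> (f c')"
        using eq cc bH[of n] bH[of n'] by (simp add: H.m_assoc)
      then show ?thesis using cc bH[of n] by (simp add: H.m_assoc[symmetric])
    qed
    also have "\<dots> \<in> B" 
      by (intro subgroup.m_closed[OF B] subgroup.m_inv_closed[OF B]) (simp_all add: B_def cc)
    finally have "r (fst (b n)) = r (fst (b n'))" by (rule r_eq[OF bH bH])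
    then have "b n = b n'" using r_r s by (simp add: prod_eq_iff)
    then have "n = n'" by (rule b_inj)
    then show "c = c' \<and> n = n'" using eq cc bH[of n] f(2) by (auto dest: inj_onD)
  qed
  moreover have "\<theta> ` (carrier C \<times> UNIV) = carrier H \<times> UNIV"
  proof
    show "\<theta> ` (carrier C \<times> UNIV) \<subseteq> carrier H \<times> UNIV" using bH by (auto simp: \<theta>_def)
    show "carrier H \<times> UNIV \<subseteq> \<theta> ` (carrier C \<times> UNIV)"
    proof clarify
      fix x and m :: nat assume x: "x \<in> carrier H"
      obtain n where n: "b n = (r x, m)" using b_ex[of "(r x, m)"] x by (auto simp: Q_def)
      obtain c where c: "c \<in> carrier C" "f c = inv\<^bsub>H\<^esub> (r x) \<otimes>\<^bsub>H\<^esub> x"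
        using r_inv[OF x] unfolding B_def by (metis imageE)
      have "\<theta> (c, n) = (x, m)"
        using c n x r(1)[OF x] by (simp add: \<theta>_def H.m_assoc[symmetric])
      then show "(x, m) \<in> \<theta> ` (carrier C \<times> UNIV)" using c by (metis SigmaI UNIV_I imageI)
    qed
  qed
  moreover have "\<theta> (c \<otimes>\<^bsub>C\<^esub> c', n) = (fst (\<theta> (c, n)) \<otimes>\<^bsub>H\<^esub> f c', snd (\<theta> (c, n)))"
    if "c \<in> carrier C" "c' \<in> carrier C" for c c' n
    using that bH[of n] by (simp add: \<theta>_def H.m_assoc)
  ultimately show ?thesis unfolding bij_betw_def by blast
qed

locale decomposed_group = gog_with_tree \<G> T + group G
  for \<G> :: "('v, 'e, 'a, 'b) graph_of_groups" and T :: "'e set" and G :: "'g monoid" (structure) +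
  fixes \<phi> :: "('v, 'e, 'a) gog_letter list set \<Rightarrow> 'g"
  assumes iso: "\<phi> \<in> iso (fundamental_group \<G> T) G"
    and countable_vertex: "v \<in> V \<Longrightarrow> countable (carrier (vertex_gp \<G> v))"
begin

definition ev :: "('v, 'e, 'a) gog_letter list \<Rightarrow> 'g" where
  "ev w = \<phi> (gog_class \<G> T w)"

abbreviation vx :: "'v \<Rightarrow> 'a \<Rightarrow> 'g" where "vx v a \<equiv> ev [Vertex_elt v a]"
abbreviation t :: "'e \<Rightarrow> 'g" where "t e \<equiv> ev [Edge_elt e]"
abbreviation H :: "'v \<Rightarrow> 'g set" where "H \<equiv> vertex_subgroup \<G> T \<phi>"

text \<open>
  The image of the edge group in the group of the tail of \<open>e\<close>: the stabiliser of the edge of the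
  Bass--Serre tree that joins the cosets of \<open>1\<close> and \<open>t e\<close>.
\<close>
definition K :: "'e \<Rightarrow> 'g set" where "K e = edge_subgroup \<G> T \<phi> (rv e)"

lemma class_carrier: "w \<in> lists gens \<Longrightarrow> gog_class \<G> T w \<in> carrier (fundamental_group \<G> T)"
  by (simp add: fundamental_group_def presented_monoid_def)

lemma ev_closed [simp]: "w \<in> lists gens \<Longrightarrow> ev w \<in> carrier G"
  using iso class_carrier[of w] unfolding ev_def iso_def by (auto intro: hom_in_carrier)

lemma ev_append: "u \<in> lists gens \<Longrightarrow> w \<in> lists gens \<Longrightarrow> ev (u @ w) = ev u \<otimes> ev w"
proof -
  assume uw: "u \<in> lists gens" "w \<in> lists gens"
  have "\<phi> \<in> hom (fundamental_group \<G> T) G" using iso by (simp add: iso_def)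
  from hom_mult[OF this class_carrier[OF uw(1)] class_carrier[OF uw(2)]]
  show ?thesis
    unfolding ev_def using presented_monoid_mult[OF uw, of rels] by (simp add: fundamental_group_def)
qed

lemma ev_Nil [simp]: "ev [] = \<one>"
proof -
  have "ev [] \<in> carrier G" by (rule ev_closed) simp
  moreover have "ev [] \<otimes> ev [] = ev []" using ev_append[of "[]" "[]"] by simp
  ultimately show ?thesis using l_cancel_one by blast
qed

lemma ev_eq_iff:
  assumes "u \<in> lists gens" "w \<in> lists gens"
  shows "ev u = ev w \<longleftrightarrow> word_cong gens rels u w"
proof -
  have "inj_on \<phi> (carrier (fundamental_group \<G> T))" using iso by (simp add: iso_def bij_betw_def)
  then have "ev u = ev w \<longleftrightarrow> gog_class \<G> T u = gog_class \<G> T w"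
    unfolding ev_def by (rule inj_on_eq_iff) (rule class_carrier, rule assms)+
  then show ?thesis unfolding word_class_eq_iff[OF assms(1)] .
qed

lemma ev_surj: "g \<in> carrier G \<Longrightarrow> \<exists>w\<in>lists gens. ev w = g"
proof -
  assume g: "g \<in> carrier G"
  have "\<phi> ` carrier (fundamental_group \<G> T) = carrier G" using iso by (simp add: iso_def bij_betw_def)
  moreover have "carrier (fundamental_group \<G> T) = gog_class \<G> T ` lists gens"
    by (simp add: fundamental_group_def presented_monoid_def)
  ultimately have "g \<in> \<phi> ` gog_class \<G> T ` lists gens" using g by simp
  then show ?thesis unfolding ev_def by (elim imageE) blast
qed

lemma ev_relation: "(u, w) \<in> rels \<Longrightarrow> u \<in> lists gens \<Longrightarrow> w \<in> lists gens \<Longrightarrow> ev u = ev w"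
  using word_cong.rel[of u w rels "[]" "[]" gens] ev_eq_iff by simp

lemma vertex_gens [simp]: "Vertex_elt v a \<in> gens \<longleftrightarrow> v \<in> V \<and> a \<in> carrier (vertex_gp \<G> v)"
  and edge_gens [simp]: "Edge_elt e \<in> gens \<longleftrightarrow> e \<in> A"
  by (auto simp: gog_generators_def)

lemma t_closed [simp]: "e \<in> A \<Longrightarrow> t e \<in> carrier G"
  by simp

lemma ev_Cons: "l \<in> gens \<Longrightarrow> w \<in> lists gens \<Longrightarrow> ev (l # w) = ev [l] \<otimes> ev w"
  using ev_append[of "[l]" w] by simp

lemma vx_mult:
  assumes "v \<in> V" "a \<in> carrier (vertex_gp \<G> v)" "b \<in> carrier (vertex_gp \<G> v)"
  shows "vx v (a \<otimes>\<^bsub>vertex_gp \<G> v\<^esub> b) = vx v a \<otimes> vx v b"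
proof -
  interpret V: group "vertex_gp \<G> v" using group_vertex assms by blast
  have "ev [Vertex_elt v a, Vertex_elt v b] = vx v (a \<otimes>\<^bsub>vertex_gp \<G> v\<^esub> b)"
    by (rule ev_relation) (use assms in \<open>auto simp: gog_relations_def\<close>)
  then show ?thesis using ev_Cons[of "Vertex_elt v a" "[Vertex_elt v b]"] assms by simp
qed

lemma vx_hom: "v \<in> V \<Longrightarrow> vx v \<in> hom (vertex_gp \<G> v) G"
  by (rule homI) (simp_all add: vx_mult)

lemma vx_one: "v \<in> V \<Longrightarrow> vx v \<one>\<^bsub>vertex_gp \<G> v\<^esub> = \<one>"
  using hom_one[OF vx_hom group_vertex is_group] by simp

lemma t_rv:
  assumes "e \<in> A"
  shows "t (rv e) = inv (t e)"
proof -
  have "ev [Edge_elt e, Edge_elt (rv e)] = ev []"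
    by (rule ev_relation) (use assms in \<open>auto simp: gog_relations_def\<close>)
  then have "t e \<otimes> t (rv e) = \<one>"
    using ev_Cons[of "Edge_elt e" "[Edge_elt (rv e)]"] assms by simp
  then show ?thesis using assms by (metis inv_equality inv_inv rv_A t_closed)
qed

lemma t_tree: "e \<in> T \<Longrightarrow> t e = \<one>"
  using ev_relation[of "[Edge_elt e]" "[]"] T_A by (auto simp: gog_relations_def)

lemma t_edge_map:
  assumes "e \<in> A" "c \<in> carrier (edge_gp \<G> e)"
  shows "vx (src e) (edge_map \<G> (rv e) c) \<otimes> t e = t e \<otimes> vx (tgt e) (edge_map \<G> e c)"
proof -
  note c = edge_map_closed[OF assms] edge_map_rv_closed[OF assms]
  have "ev [Edge_elt e, Vertex_elt (tgt e) (edge_map \<G> e c)] =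
    ev [Vertex_elt (src e) (edge_map \<G> (rv e) c), Edge_elt e]"
    by (rule ev_relation) (use assms c in \<open>auto simp: gog_relations_def\<close>)
  then show ?thesis
    using ev_Cons[of "Edge_elt e" "[Vertex_elt (tgt e) (edge_map \<G> e c)]"]
      ev_Cons[of "Vertex_elt (src e) (edge_map \<G> (rv e) c)" "[Edge_elt e]"] c assms by simp
qed

lemma H_eq: "H v = vx v ` carrier (vertex_gp \<G> v)"
  by (simp add: vertex_subgroup_def ev_def)

lemma H_subgroup: "v \<in> V \<Longrightarrow> subgroup (H v) G"
  unfolding H_eq using group_vertex[of v] vx_hom[of v]
  by (intro group_hom.img_is_subgroup group_hom.intro) (auto simp: group_hom_axioms_def is_group)

lemma K_eq: "e \<in> A \<Longrightarrow> K e = (\<lambda>c. vx (src e) (edge_map \<G> (rv e) c)) ` carrier (edge_gp \<G> e)"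
  by (simp add: K_def edge_subgroup_def ev_def edge_gp_rv)

lemma K_subgroup:
  assumes "e \<in> A"
  shows "subgroup (K e) G"
proof -
  have "edge_map \<G> (rv e) \<in> hom (edge_gp \<G> e) (vertex_gp \<G> (src e))"
    using edge_map_mon[of "rv e"] assms by (simp add: mon_def edge_gp_rv)
  then have "vx (src e) \<circ> edge_map \<G> (rv e) \<in> hom (edge_gp \<G> e) G"
    using vx_hom[OF src_V[OF assms]]
    by (intro homI) (simp_all add: hom_def Pi_iff)
  then show ?thesis
    unfolding K_eq[OF assms] using group_edge[OF assms]
    by (intro group_hom.img_is_subgroup[unfolded comp_def] group_hom.intro)
      (auto simp: group_hom_axioms_def is_group comp_def)
qed

lemma K_H: "e \<in> A \<Longrightarrow> K e \<subseteq> H (src e)"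
  using edge_map_rv_closed by (auto simp: K_eq H_eq)

lemma K_carrier: "e \<in> A \<Longrightarrow> k \<in> K e \<Longrightarrow> k \<in> carrier G"
  by (rule subgroup.mem_carrier[OF K_subgroup])

lemma H_carrier: "v \<in> V \<Longrightarrow> k \<in> H v \<Longrightarrow> k \<in> carrier G"
  by (rule subgroup.mem_carrier[OF H_subgroup])

lemma K_t:
  assumes "e \<in> A" "k \<in> K e"
  shows "\<exists>h\<in>K (rv e). k \<otimes> t e = t e \<otimes> h"
proof -
  obtain c where c: "c \<in> carrier (edge_gp \<G> e)" "k = vx (src e) (edge_map \<G> (rv e) c)"
    using assms by (auto simp: K_eq)
  have "vx (tgt e) (edge_map \<G> e c) \<in> K (rv e)"
    unfolding K_def edge_subgroup_def ev_def using assms c by (intro image_eqI[of _ _ c]) simp_all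
  then show ?thesis using t_edge_map[OF assms(1) c(1)] c(2) by blast
qed

text \<open>
  Let each vertex group \<open>H\<close> act on \<open>H \<times> \<nat>\<close>. The two restrictions to an edge group are isomorphic by
  \<open>free_action_model\<close>, so the fundamental group acts, and the action of the vertex groups is free.
\<close>
lemma vertex_inj:
  assumes "v \<in> V"
  shows "inj_on (vx v) (carrier (vertex_gp \<G> v))"
proof -
  define \<theta> where "\<theta> e = (SOME \<theta>. bij_betw \<theta> (carrier (edge_gp \<G> e) \<times> (UNIV :: nat set))
     (carrier (vertex_gp \<G> (tgt e)) \<times> (UNIV :: nat set)) \<and>
     (\<forall>c\<in>carrier (edge_gp \<G> e). \<forall>c'\<in>carrier (edge_gp \<G> e). \<forall>n. \<theta> (c \<otimes>\<^bsub>edge_gp \<G> e\<^esub> c', n) =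
        (fst (\<theta> (c, n)) \<otimes>\<^bsub>vertex_gp \<G> (tgt e)\<^esub> edge_map \<G> e c', snd (\<theta> (c, n)))))" for e
  define E where "E e = carrier (edge_gp \<G> e) \<times> (UNIV :: nat set)" for e
  define \<Omega> where "\<Omega> v = carrier (vertex_gp \<G> v) \<times> (UNIV :: nat set)" for v
  have \<theta>: "bij_betw (\<theta> e) (E e) (\<Omega> (tgt e))"
    "\<And>c c' n. c \<in> carrier (edge_gp \<G> e) \<Longrightarrow> c' \<in> carrier (edge_gp \<G> e) \<Longrightarrow>
      \<theta> e (c \<otimes>\<^bsub>edge_gp \<G> e\<^esub> c', n) =
        (fst (\<theta> e (c, n)) \<otimes>\<^bsub>vertex_gp \<G> (tgt e)\<^esub> edge_map \<G> e c', snd (\<theta> e (c, n)))"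
    if "e \<in> A" for e
    using someI_ex[OF free_action_model[OF group_edge[OF that] group_vertex[OF tgt_V[OF that]]
       countable_vertex[OF tgt_V[OF that]] edge_map_mon[OF that]], folded \<theta>_def]
    by (auto simp: E_def \<Omega>_def)
  define act where "act v x a = (fst x \<otimes>\<^bsub>vertex_gp \<G> v\<^esub> a, snd x)" for v and x :: "'a \<times> nat" and a
  define tr where "tr e x = \<theta> e (inv_into (E e) (\<theta> (rv e)) x)" for e x
  have E_rv: "E (rv e) = E e" if "e \<in> A" for e using that by (simp add: E_def edge_gp_rv)
  have \<theta>_rv: "bij_betw (\<theta> (rv e)) (E e) (\<Omega> (src e))" if "e \<in> A" for e
    using \<theta>(1)[of "rv e"] that by (simp add: E_rv)
  have inv_E: "inv_into (E e) (\<theta> (rv e)) x \<in> E e" "\<theta> (rv e) (inv_into (E e) (\<theta> (rv e)) x) = x"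
    if "e \<in> A" "x \<in> \<Omega> (src e)" for e x
    using \<theta>_rv[OF that(1)] that(2)
    by (auto simp: bij_betw_def inv_into_into f_inv_into_f)
  interpret act: gog_action \<G> T \<Omega> act tr
  proof
    show "act v x a \<in> \<Omega> v" if "v \<in> V" "x \<in> \<Omega> v" "a \<in> carrier (vertex_gp \<G> v)" for v x a
      using that group.is_monoid[OF group_vertex[OF that(1)]]
      by (auto simp: act_def \<Omega>_def intro: monoid.m_closed)
    show "act v x \<one>\<^bsub>vertex_gp \<G> v\<^esub> = x" if "v \<in> V" "x \<in> \<Omega> v" for v x
      using that group.is_monoid[OF group_vertex[OF that(1)]]
      by (auto simp: act_def \<Omega>_def monoid.r_one)
    show "act v (act v x a) b = act v x (a \<otimes>\<^bsub>vertex_gp \<G> v\<^esub> b)"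
      if "v \<in> V" "x \<in> \<Omega> v" "a \<in> carrier (vertex_gp \<G> v)" "b \<in> carrier (vertex_gp \<G> v)" for v x a b
      using that group.is_monoid[OF group_vertex[OF that(1)]]
      by (auto simp: act_def \<Omega>_def monoid.m_assoc)
    show "tr e x \<in> \<Omega> (tgt e)" if "e \<in> A" "x \<in> \<Omega> (src e)" for e x
      using inv_E[OF that] \<theta>(1)[OF that(1)] by (auto simp: tr_def bij_betw_def)
    show "tr (rv e) (tr e x) = x" if "e \<in> A" "x \<in> \<Omega> (src e)" for e x
    proof -
      have "inv_into (E e) (\<theta> e) (tr e x) = inv_into (E e) (\<theta> (rv e)) x"
        using inv_E(1)[OF that] \<theta>(1)[OF that(1)] by (simp add: tr_def bij_betw_def)
      then show ?thesis using that inv_E(2)[OF that] by (simp add: tr_def[of "rv e"] E_rv)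
    qed
    show "tr e (act (src e) x (edge_map \<G> (rv e) c)) = act (tgt e) (tr e x) (edge_map \<G> e c)"
      if e: "e \<in> A" "x \<in> \<Omega> (src e)" "c \<in> carrier (edge_gp \<G> e)" for e x c
    proof -
      obtain d n where dn: "inv_into (E e) (\<theta> (rv e)) x = (d, n)" "d \<in> carrier (edge_gp \<G> e)"
        using inv_E(1)[OF e(1,2)] by (auto simp: E_def)
      then have x: "x = \<theta> (rv e) (d, n)" using inv_E(2)[OF e(1,2)] by simp
      have dc: "(d \<otimes>\<^bsub>edge_gp \<G> e\<^esub> c, n) \<in> E e"
        using dn e group.is_monoid[OF group_edge[OF e(1)]] by (auto simp: E_def intro: monoid.m_closed)
      have "act (src e) x (edge_map \<G> (rv e) c) = \<theta> (rv e) (d \<otimes>\<^bsub>edge_gp \<G> e\<^esub> c, n)"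
        using \<theta>(2)[of "rv e" d c n] dn e by (simp add: act_def x edge_gp_rv)
      then have "tr e (act (src e) x (edge_map \<G> (rv e) c)) = \<theta> e (d \<otimes>\<^bsub>edge_gp \<G> e\<^esub> c, n)"
        using \<theta>_rv[OF e(1)] dc by (simp add: tr_def bij_betw_def)
      also have "\<dots> = act (tgt e) (tr e x) (edge_map \<G> e c)"
        using \<theta>(2)[OF e(1) dn(2) e(3)] dn by (simp add: act_def tr_def)
      finally show ?thesis .
    qed
  qed
  interpret V: group "vertex_gp \<G> v" by (rule group_vertex[OF assms])
  show ?thesis
  proof (rule inj_onI)
    fix a b assume ab: "a \<in> carrier (vertex_gp \<G> v)" "b \<in> carrier (vertex_gp \<G> v)" "vx v a = vx v b"
    define x where "x = (\<one>\<^bsub>vertex_gp \<G> v\<^esub>, 0 :: nat)"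
    have x: "x \<in> \<Omega> v" by (simp add: x_def \<Omega>_def)
    define \<xi> where "\<xi> = act.section_through v x"
    have \<xi>: "\<xi> \<in> act.sections" "\<xi> v = x"
      unfolding \<xi>_def using assms x act.section_through_sections act.section_through_at by auto
    have "word_cong gens rels [Vertex_elt v a] [Vertex_elt v b]"
      using ab assms ev_eq_iff[of "[Vertex_elt v a]" "[Vertex_elt v b]"] by simp
    from act.act_word_cong[OF this \<xi>(1)]
    have "act.section_through v (act v x a) v = act.section_through v (act v x b) v" using \<xi> by simp
    then have "act v x a = act v x b"
      using act.section_through_at[OF assms act.act_closed[OF assms x]] ab by simp
    then show "a = b" using ab by (simp add: act_def x_def)
  qed
qed

text \<open>
  Whether the step from the coset \<open>g H (src e)\<close> to the coset \<open>g t H (tgt e)\<close>, where \<open>t = t e\<close>,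
  traverses the edge of the Bass--Serre tree labelled by \<open>K e\<^sub>0\<close>, in one direction or the other.
\<close>
definition crosses :: "'e \<Rightarrow> 'e \<Rightarrow> 'g \<Rightarrow> bool" where
  "crosses e\<^sub>0 e g \<longleftrightarrow> (e = e\<^sub>0 \<and> g \<in> K e\<^sub>0) \<or> (e = rv e\<^sub>0 \<and> g \<otimes> t e \<in> K e\<^sub>0)"

lemma crosses_near: "crosses e\<^sub>0 e g \<Longrightarrow> g \<in> K e\<^sub>0 \<or> g \<otimes> t e \<in> K e\<^sub>0"
  by (auto simp: crosses_def)

text \<open>
  A wall assigns to each vertex coset \<open>g H v\<close> one of two sides, and the side changes across the edge
  \<open>K e\<^sub>0\<close> and across no other edge. The existence of such a function says that this edge
  disconnects the Bass--Serre tree. The last clause compares the cosets \<open>g H v\<close> and \<open>g H v'\<close>, which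
  are joined by arcs of the maximal tree, whose letters are trivial in \<open>G\<close>.
\<close>
definition is_wall :: "'e \<Rightarrow> ('v \<Rightarrow> 'g \<Rightarrow> bool) \<Rightarrow> bool" where
  "is_wall e\<^sub>0 \<sigma> \<longleftrightarrow>
     (\<forall>v\<in>V. \<forall>g\<in>carrier G. \<forall>h\<in>H v. \<sigma> v (g \<otimes> h) = \<sigma> v g) \<and>
     (\<forall>e\<in>A. \<forall>g\<in>carrier G. (\<sigma> (tgt e) (g \<otimes> t e) \<noteq> \<sigma> (src e) g) = crosses e\<^sub>0 e g) \<and>
     (\<forall>v\<in>V. \<forall>v'\<in>V. \<forall>g\<in>carrier G. \<sigma> v g \<noteq> \<sigma> v' g \<longrightarrow> g \<in> K e\<^sub>0)"

lemma K_right_mult: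
  assumes "e \<in> A" "g \<in> carrier G" "k \<in> K e"
  shows "g \<otimes> k \<in> K e \<longleftrightarrow> g \<in> K e"
proof
  note K = K_subgroup[OF assms(1)]
  have k: "k \<in> carrier G" by (rule K_carrier[OF assms(1,3)])
  assume "g \<otimes> k \<in> K e"
  then have "(g \<otimes> k) \<otimes> inv k \<in> K e"
    by (rule subgroup.m_closed[OF K _ subgroup.m_inv_closed[OF K assms(3)]])
  then show "g \<in> K e" using assms(2) k by (simp add: m_assoc)
next
  assume "g \<in> K e"
  then show "g \<otimes> k \<in> K e" by (rule subgroup.m_closed[OF K_subgroup[OF assms(1)] _ assms(3)])
qed

lemma crosses_invariant:
  assumes "e\<^sub>0 \<in> A" "e \<in> A" "g \<in> carrier G" "k \<in> K e"
  shows "crosses e\<^sub>0 e (g \<otimes> k) \<longleftrightarrow> crosses e\<^sub>0 e g"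
proof -
  have k: "k \<in> carrier G" by (rule K_carrier[OF assms(2,4)])
  have "(g \<otimes> k) \<otimes> t e \<in> K e\<^sub>0 \<longleftrightarrow> g \<otimes> t e \<in> K e\<^sub>0" if "e = rv e\<^sub>0"
  proof -
    have "rv e = e\<^sub>0" using that assms(1) by simp
    then obtain h where h: "h \<in> K e\<^sub>0" "k \<otimes> t e = t e \<otimes> h" using K_t[OF assms(2,4)] by blast
    then have "(g \<otimes> k) \<otimes> t e = (g \<otimes> t e) \<otimes> h"
      using assms(2,3) k K_carrier[OF assms(1) h(1)] by (simp add: m_assoc)
    then show ?thesis using K_right_mult[OF assms(1) _ h(1), of "g \<otimes> t e"] assms(2,3) by simp
  qed
  then show ?thesis using K_right_mult[OF assms(2-4)] unfolding crosses_def by blast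
qed

text \<open>
  Let \<open>G\<close> act on \<open>G \<times> bool\<close> so that the second coordinate is flipped by the steps that cross the
  edge \<open>K e\<^sub>0\<close>. By the universal property this is an action of \<open>G\<close>: the second coordinate reached
  from \<open>(1, False)\<close> along a word is a function of the element that the word represents.
\<close>
lemma wall_exists:
  assumes e0: "e\<^sub>0 \<in> A"
  shows "\<exists>\<sigma>. is_wall e\<^sub>0 \<sigma>"
proof -
  define \<Omega> where "\<Omega> = (\<lambda>_ :: 'v. carrier G \<times> (UNIV :: bool set))"
  define act where "act v x a = (fst x \<otimes> vx v a, snd x)" for v and x :: "'g \<times> bool" and a
  define tr where "tr e x = (fst x \<otimes> t e, snd x \<noteq> crosses e\<^sub>0 e (fst x))" for e and x :: "'g \<times> bool"
  have act_proj: "fst (act v x a) = fst x \<otimes> vx v a" "snd (act v x a) = snd x"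
    and tr_proj: "fst (tr e x) = fst x \<otimes> t e" "snd (tr e x) = (snd x \<noteq> crosses e\<^sub>0 e (fst x))"
    for v e x a
    by (simp_all add: act_def tr_def)
  interpret act: gog_action \<G> T \<Omega> act tr
  proof
    show "act v x a \<in> \<Omega> v" if "v \<in> V" "x \<in> \<Omega> v" "a \<in> carrier (vertex_gp \<G> v)" for v x a
      using that by (auto simp: act_def \<Omega>_def)
    show "act v x \<one>\<^bsub>vertex_gp \<G> v\<^esub> = x" if "v \<in> V" "x \<in> \<Omega> v" for v x
      using that vx_one by (auto simp: act_def \<Omega>_def)
    show "act v (act v x a) b = act v x (a \<otimes>\<^bsub>vertex_gp \<G> v\<^esub> b)"
      if "v \<in> V" "x \<in> \<Omega> v" "a \<in> carrier (vertex_gp \<G> v)" "b \<in> carrier (vertex_gp \<G> v)" for v x a b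
      using that by (auto simp: act_def \<Omega>_def vx_mult m_assoc)
    show "tr e x \<in> \<Omega> (tgt e)" if "e \<in> A" "x \<in> \<Omega> (src e)" for e x
      using that by (auto simp: tr_def \<Omega>_def)
    show "tr (rv e) (tr e x) = x" if "e \<in> A" "x \<in> \<Omega> (src e)" for e x
    proof -
      have x: "fst x \<in> carrier G" using that by (auto simp: \<Omega>_def)
      then have "fst x \<otimes> t e \<otimes> t (rv e) = fst x" using that by (simp add: t_rv m_assoc)
      moreover have "crosses e\<^sub>0 (rv e) (fst x \<otimes> t e) = crosses e\<^sub>0 e (fst x)"
        using that x e0 rv_rv[of e] rv_rv[of "e\<^sub>0"] \<open>fst x \<otimes> t e \<otimes> t (rv e) = fst x\<close>
        unfolding crosses_def by metis
      ultimately show ?thesis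
        by (cases "snd x"; cases "crosses e\<^sub>0 e (fst x)") (simp_all add: tr_def prod_eq_iff)
    qed
    show "tr e (act (src e) x (edge_map \<G> (rv e) c)) = act (tgt e) (tr e x) (edge_map \<G> e c)"
      if e: "e \<in> A" "x \<in> \<Omega> (src e)" "c \<in> carrier (edge_gp \<G> e)" for e x c
    proof -
      let ?k = "vx (src e) (edge_map \<G> (rv e) c)"
      have x: "fst x \<in> carrier G" using e by (auto simp: \<Omega>_def)
      have k: "?k \<in> K e" using e by (auto simp: K_eq)
      then have "crosses e\<^sub>0 e (fst x \<otimes> ?k) = crosses e\<^sub>0 e (fst x)"
        using crosses_invariant e0 e x by blast
      moreover have "fst x \<otimes> ?k \<otimes> t e = fst x \<otimes> t e \<otimes> vx (tgt e) (edge_map \<G> e c)"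
        using x e t_edge_map[OF e(1,3)] edge_map_closed[OF e(1,3)] edge_map_rv_closed[OF e(1,3)]
        by (simp add: m_assoc)
      ultimately show ?thesis by (simp add: act_def tr_def)
    qed
  qed
  have transport: "fst (fold tr p x) = fst x \<and> (fst x \<notin> K e\<^sub>0 \<longrightarrow> snd (fold tr p x) = snd x)"
    if "tree.awalk u p v" "fst x \<in> carrier G" for u p v x
    using that
  proof (induction p arbitrary: u x)
    case (Cons e p)
    then have e: "e \<in> T" "tree.awalk (tgt e) p v" by (auto simp: tree.awalk_Cons_iff)
    then have "fst (tr e x) = fst x" using Cons.prems by (simp add: tr_def t_tree)
    moreover have "snd (tr e x) = snd x" if "fst x \<notin> K e\<^sub>0"
      using that crosses_near[of e\<^sub>0 e "fst x"] t_tree[OF e(1)] Cons.prems by (auto simp: tr_def)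
    ultimately show ?case using Cons.IH[OF e(2), of "tr e x"] Cons.prems by simp
  qed simp
  have sec: "fst (\<xi> u) = fst (\<xi> v)" "fst (\<xi> v) \<notin> K e\<^sub>0 \<Longrightarrow> snd (\<xi> u) = snd (\<xi> v)"
    if uv: "\<xi> \<in> act.sections" "u \<in> V" "v \<in> V" for \<xi> u v
  proof -
    obtain p where "tree.awalk u p v" using tree_walk[OF uv(2,3)] by blast
    then show "fst (\<xi> u) = fst (\<xi> v)" "fst (\<xi> v) \<notin> K e\<^sub>0 \<Longrightarrow> snd (\<xi> u) = snd (\<xi> v)"
      using transport[of u p v "\<xi> u"] act.section_transport[OF uv(1)] act.sections_at[OF uv(1,2)]
      by (auto simp: \<Omega>_def)
  qed
  obtain v0 where v0: "v0 \<in> V" using V_nonempty by blast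
  define \<xi>0 where "\<xi>0 = act.section_through v0 (\<one>, False)"
  have \<xi>0: "\<xi>0 \<in> act.sections" "\<xi>0 v0 = (\<one>, False)"
    unfolding \<xi>0_def using v0 act.section_through_sections act.section_through_at by (auto simp: \<Omega>_def)
  have act_in: "act.act_word w \<xi>0 \<in> act.sections" if "w \<in> lists gens" for w
    using act.act_word_sections that \<xi>0 by blast
  have act_snoc: "act.act_word (w @ [Vertex_elt v a]) \<xi>0 v = act v (act.act_word w \<xi>0 v) a"
    if "w \<in> lists gens" "v \<in> V" "a \<in> carrier (vertex_gp \<G> v)" for w v a
    using act.section_through_at[OF that(2) act.act_closed[OF that(2) act.sections_at[OF act_in[OF that(1)]]]]
      that by simp
  have act_edge: "act.act_word (w @ [Edge_elt e]) \<xi>0 (tgt e) = tr e (act.act_word w \<xi>0 (src e))"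
    if "w \<in> lists gens" "e \<in> A" for w e
    using act.section_through_at[OF tgt_V[OF that(2)]
        act.tr_closed[OF that(2) act.sections_at[OF act_in[OF that(1)]]]] that by simp
  have fst_act: "fst (act.act_word w \<xi>0 v) = ev w" if "w \<in> lists gens" "v \<in> V" for w v
    using that
  proof (induction w arbitrary: v rule: rev_induct)
    case Nil
    then show ?case using sec(1)[OF \<xi>0(1) Nil(2) v0] \<xi>0 by simp
  next
    case (snoc l w)
    then have w: "w \<in> lists gens" "l \<in> gens" by auto
    show ?case
    proof (cases l)
      case (Vertex_elt u a)
      then have u: "u \<in> V" "a \<in> carrier (vertex_gp \<G> u)" using w by auto
      have "fst (act.act_word (w @ [l]) \<xi>0 v) = fst (act.act_word (w @ [l]) \<xi>0 u)"
        by (rule sec(1)[OF act_in snoc.prems(2) u(1)]) (use snoc.prems in blast)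
      also have "\<dots> = ev w \<otimes> vx u a"
        using act_snoc[OF w(1) u] snoc.IH[OF w(1) u(1)] by (simp only: Vertex_elt act_proj)
      also have "\<dots> = ev (w @ [l])"
        using Vertex_elt ev_append[OF w(1), of "[l]"] w by simp
      finally show ?thesis .
    next
      case (Edge_elt e)
      then have e: "e \<in> A" using w by auto
      have "fst (act.act_word (w @ [l]) \<xi>0 v) = fst (act.act_word (w @ [l]) \<xi>0 (tgt e))"
        by (rule sec(1)[OF act_in snoc.prems(2) tgt_V[OF e]]) (use snoc.prems in blast)
      also have "\<dots> = ev w \<otimes> t e"
        using act_edge[OF w(1) e] snoc.IH[OF w(1) src_V[OF e]] by (simp only: Edge_elt tr_proj)
      also have "\<dots> = ev (w @ [l])"
        using Edge_elt ev_append[OF w(1), of "[l]"] w by simp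
      finally show ?thesis .
    qed
  qed
  \<comment> \<open>any word for \<open>g\<close> gives the same value, by \<open>act_word_cong\<close>\<close>
  define word where "word g = (SOME w. w \<in> lists gens \<and> ev w = g)" for g
  have word: "word g \<in> lists gens" "ev (word g) = g" if "g \<in> carrier G" for g
    using someI_ex[of "\<lambda>w. w \<in> lists gens \<and> ev w = g"] ev_surj[OF that] unfolding word_def by auto
  define \<sigma> where "\<sigma> v g = snd (act.act_word (word g) \<xi>0 v)" for v g
  have \<sigma>: "\<sigma> v (ev w) = snd (act.act_word w \<xi>0 v)" if "w \<in> lists gens" for w v
  proof -
    have "word_cong gens rels (word (ev w)) w"
      using ev_eq_iff word[OF ev_closed[OF that]] that by blast
    then show ?thesis unfolding \<sigma>_def using act.act_word_cong \<xi>0 by metis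
  qed
  have "is_wall e\<^sub>0 \<sigma>"
    unfolding is_wall_def
  proof (intro conjI ballI impI)
    fix v g h assume g: "g \<in> carrier G" and v: "v \<in> V" and "h \<in> H v"
    then obtain a where a: "a \<in> carrier (vertex_gp \<G> v)" "h = vx v a" by (auto simp: H_eq)
    have wa: "word g @ [Vertex_elt v a] \<in> lists gens" using word[OF g] a v by simp
    have "\<sigma> v (g \<otimes> h) = \<sigma> v (ev (word g @ [Vertex_elt v a]))"
      using a word[OF g] v by (simp add: ev_append)
    also have "\<dots> = snd (act.act_word (word g) \<xi>0 v)"
      unfolding \<sigma>[OF wa] act_snoc[OF word(1)[OF g] v a(1)] act_proj ..
    also have "\<dots> = \<sigma> v g" by (simp only: \<sigma>_def)
    finally show "\<sigma> v (g \<otimes> h) = \<sigma> v g" .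
  next
    fix e g assume e: "e \<in> A" and g: "g \<in> carrier G"
    have we: "word g @ [Edge_elt e] \<in> lists gens" using word[OF g] e by simp
    have "\<sigma> (tgt e) (g \<otimes> t e) = \<sigma> (tgt e) (ev (word g @ [Edge_elt e]))"
      using e word[OF g] by (simp add: ev_append)
    also have "\<dots> = (\<sigma> (src e) g \<noteq> crosses e\<^sub>0 e g)"
      unfolding \<sigma>[OF we] act_edge[OF word(1)[OF g] e] tr_proj
        fst_act[OF word(1)[OF g] src_V[OF e]] word(2)[OF g]
      by (simp only: \<sigma>_def)
    finally show "(\<sigma> (tgt e) (g \<otimes> t e) \<noteq> \<sigma> (src e) g) = crosses e\<^sub>0 e g" by auto
  next
    fix v v' g assume "v \<in> V" "v' \<in> V" "g \<in> carrier G" "\<sigma> v g \<noteq> \<sigma> v' g"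
    then show "g \<in> K e\<^sub>0"
      using sec(2)[OF act_in[OF word(1)]] fst_act word unfolding \<sigma>_def by metis
  qed
  then show ?thesis by blast
qed

end

section \<open>Word metrics\<close>

locale fg_group = group G for G :: "'g monoid" (structure) +
  fixes S :: "'g set"
  assumes generating: "finite_generating_set G S"
begin

abbreviation d :: "'g \<Rightarrow> 'g \<Rightarrow> real" where "d \<equiv> word_dist G S"

definition letters :: "'g set" where "letters = S \<union> m_inv G ` S"

abbreviation product :: "'g list \<Rightarrow> 'g" where "product ws \<equiv> foldr (\<otimes>) ws \<one>"

sublocale metric: Metric_space "carrier G" d
  by (rule Metric_space_word_dist[OF is_group generating])

lemma finite_letters: "finite letters"
  using generating by (simp add: letters_def finite_generating_set_def)

lemma letters_carrier: "s \<in> letters \<Longrightarrow> s \<in> carrier G"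
  using generating by (auto simp: letters_def finite_generating_set_def)

lemma product_closed: "set ws \<subseteq> letters \<Longrightarrow> product ws \<in> carrier G"
  by (induction ws) (auto intro: letters_carrier)

lemma product_append:
  "set us \<subseteq> letters \<Longrightarrow> set ws \<subseteq> letters \<Longrightarrow> product (us @ ws) = product us \<otimes> product ws"
  by (induction us) (auto simp: product_closed letters_carrier m_assoc)

lemma product_surj: "g \<in> carrier G \<Longrightarrow> \<exists>ws. set ws \<subseteq> letters \<and> product ws = g"
proof -
  assume "g \<in> carrier G"
  then have "g \<in> generate G S" using generating by (simp add: finite_generating_set_def)
  then show ?thesis
  proof (induction rule: generate.induct)
    case one
    show ?case by (intro exI[of _ "[]"]) simp
  next
    case (incl h)
    then show ?case using letters_carrier[of h]
      by (intro exI[of _ "[h]"]) (simp add: letters_def)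
  next
    case (inv h)
    then show ?case using letters_carrier[of "inv h"]
      by (intro exI[of _ "[inv h]"]) (simp add: letters_def)
  next
    case (eng g h)
    then obtain us ws where "set us \<subseteq> letters" "product us = g" "set ws \<subseteq> letters" "product ws = h"
      by blast
    then show ?case using product_append[of us ws] by (intro exI[of _ "us @ ws"]) auto
  qed
qed

lemma length_geodesic:
  assumes "g \<in> carrier G"
  shows "\<exists>ws. set ws \<subseteq> letters \<and> product ws = g \<and> length ws = word_length G S g"
proof -
  have "\<exists>n ws. length ws = n \<and> set ws \<subseteq> S \<union> m_inv G ` S \<and> product ws = g"
    using product_surj[OF assms] by (auto simp: letters_def)
  from LeastI_ex[OF this] show ?thesis
    unfolding word_length_def letters_def by blast
qed

lemma word_length_le: "set ws \<subseteq> letters \<Longrightarrow> word_length G S (product ws) \<le> length ws"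
  unfolding word_length_def letters_def by (rule Least_le) blast

lemma dist_eq: "x \<in> carrier G \<Longrightarrow> y \<in> carrier G \<Longrightarrow> d x y = word_length G S (inv x \<otimes> y)"
  by (simp add: word_dist_def)

lemma geodesic:
  assumes "x \<in> carrier G" "y \<in> carrier G"
  shows "\<exists>ws. set ws \<subseteq> letters \<and> y = x \<otimes> product ws \<and> real (length ws) = d x y"
proof -
  obtain ws where "set ws \<subseteq> letters" "product ws = inv x \<otimes> y"
    "length ws = word_length G S (inv x \<otimes> y)"
    using length_geodesic assms by (metis inv_closed m_closed)
  then show ?thesis using assms by (intro exI[of _ ws]) (simp add: dist_eq m_assoc[symmetric])
qed

lemma dist_left_mult:
  assumes "g \<in> carrier G" "x \<in> carrier G" "y \<in> carrier G"
  shows "d (g \<otimes> x) (g \<otimes> y) = d x y"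
proof -
  have "inv g \<otimes> (g \<otimes> y) = y" using assms by (simp add: m_assoc[symmetric])
  then have "inv (g \<otimes> x) \<otimes> (g \<otimes> y) = inv x \<otimes> y" using assms by (simp add: inv_mult_group m_assoc)
  then show ?thesis using assms by (simp add: dist_eq)
qed

lemma dist_mult_right: "g \<in> carrier G \<Longrightarrow> x \<in> carrier G \<Longrightarrow> d g (g \<otimes> x) = d \<one> x"
  using dist_left_mult[of g \<one> x] by simp

lemma dist_inv_left: "g \<in> carrier G \<Longrightarrow> x \<in> carrier G \<Longrightarrow> y \<in> carrier G \<Longrightarrow>
    d (inv g \<otimes> x) y = d x (g \<otimes> y)"
  using dist_left_mult[of g "inv g \<otimes> x" y] by (simp add: m_assoc[symmetric])

lemma dist_product_le: "set ws \<subseteq> letters \<Longrightarrow> d \<one> (product ws) \<le> length ws"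
  using word_length_le[of ws] product_closed[of ws] by (simp add: dist_eq)

lemma finite_ball:
  assumes "x \<in> carrier G"
  shows "finite {y \<in> carrier G. d x y \<le> r}"
proof (rule finite_subset)
  show "{y \<in> carrier G. d x y \<le> r} \<subseteq>
    (\<lambda>ws. x \<otimes> product ws) ` {ws. set ws \<subseteq> letters \<and> length ws \<le> nat \<lfloor>r\<rfloor>}"
  proof clarify
    fix y assume y: "y \<in> carrier G" "d x y \<le> r"
    obtain ws where ws: "set ws \<subseteq> letters" "y = x \<otimes> product ws" "real (length ws) = d x y"
      using geodesic[OF assms y(1)] by blast
    then have "length ws \<le> nat \<lfloor>r\<rfloor>" using y(2) by linarith
    then show "y \<in> (\<lambda>ws. x \<otimes> product ws) ` {ws. set ws \<subseteq> letters \<and> length ws \<le> nat \<lfloor>r\<rfloor>}"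
      using ws by blast
  qed
  show "finite ((\<lambda>ws. x \<otimes> product ws) ` {ws. set ws \<subseteq> letters \<and> length ws \<le> nat \<lfloor>r\<rfloor>})"
    using finite_lists_length_le[OF finite_letters] by blast
qed

lemma dist_one_translate:
  "x \<in> carrier G \<Longrightarrow> y \<in> carrier G \<Longrightarrow> d \<one> (inv x \<otimes> y) = d x y"
  using dist_mult_right[of x "inv x \<otimes> y"] by (simp add: m_assoc[symmetric])

end

section \<open>Vertex cosets and the walls around them\<close>

context decomposed_group
begin

definition wall :: "'e \<Rightarrow> 'v \<Rightarrow> 'g \<Rightarrow> bool" where
  "wall e = (SOME \<sigma>. is_wall e \<sigma>)"

lemma is_wall: "e \<in> A \<Longrightarrow> is_wall e (wall e)"
  unfolding wall_def by (rule someI_ex[OF wall_exists])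

lemma wall_vertex: "\<lbrakk>e \<in> A; v \<in> V; g \<in> carrier G; h \<in> H v\<rbrakk> \<Longrightarrow> wall e v (g \<otimes> h) = wall e v g"
  and wall_arc: "\<lbrakk>e \<in> A; e' \<in> A; g \<in> carrier G\<rbrakk> \<Longrightarrow>
    (wall e (tgt e') (g \<otimes> t e') \<noteq> wall e (src e') g) = crosses e e' g"
  and wall_change: "\<lbrakk>e \<in> A; v \<in> V; v' \<in> V; g \<in> carrier G; wall e v g \<noteq> wall e v' g\<rbrakk> \<Longrightarrow> g \<in> K e"
  using is_wall[of e] unfolding is_wall_def by blast+

lemma wall_letter:
  assumes "e \<in> A" "l \<in> gens" "g \<in> carrier G" "v \<in> V" "g \<notin> K e" "g \<otimes> ev [l] \<notin> K e"
  shows "wall e v (g \<otimes> ev [l]) = wall e v g"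
proof (cases l)
  case (Vertex_elt u a)
  then have u: "u \<in> V" "vx u a \<in> H u" using assms by (auto simp: H_eq)
  then have "wall e u (g \<otimes> ev [l]) = wall e u g"
    using wall_vertex assms Vertex_elt by blast
  moreover have "ev [l] \<in> carrier G" using assms(2) by simp
  ultimately show ?thesis
    using wall_change[OF assms(1) u(1) assms(4)] assms by (metis m_closed)
next
  case (Edge_elt e')
  then have e': "e' \<in> A" using assms by simp
  then have "wall e (tgt e') (g \<otimes> ev [l]) = wall e (src e') g"
    using wall_arc[OF assms(1) e' assms(3)] crosses_near assms Edge_elt by blast
  moreover have "ev [l] \<in> carrier G" using assms(2) by simp
  ultimately show ?thesis
    using wall_change[OF assms(1) _ assms(4)] src_V[OF e'] tgt_V[OF e'] assms by (metis m_closed)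
qed

text \<open>
  The side can change only at a prefix that lies in \<open>K e\<close>. Applied to words for the finitely many
  generators, this bounds the distance from a change of side to the edge coset.
\<close>
lemma wall_word:
  "\<lbrakk>e \<in> A; w \<in> lists gens; g \<in> carrier G; v \<in> V; v' \<in> V; wall e v g \<noteq> wall e v' (g \<otimes> ev w)\<rbrakk> \<Longrightarrow>
    \<exists>i\<le>length w. g \<otimes> ev (take i w) \<in> K e"
proof (induction w arbitrary: g v)
  case Nil
  then show ?case using wall_change[of e v v' g] by simp
next
  case (Cons l w)
  then have l: "l \<in> gens" "w \<in> lists gens" "ev [l] \<in> carrier G" "ev w \<in> carrier G" by auto
  show ?case
  proof (cases "g \<in> K e \<or> g \<otimes> ev [l] \<in> K e")
    case True
    then show ?thesis
    proof
      assume "g \<in> K e"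
      then show ?thesis using Cons.prems by (intro exI[of _ 0]) simp
    next
      assume "g \<otimes> ev [l] \<in> K e"
      then show ?thesis by (intro exI[of _ 1]) simp
    qed
  next
    case False
    have "wall e v (g \<otimes> ev [l]) = wall e v g"
      using wall_letter False Cons.prems l by blast
    moreover have "g \<otimes> ev (l # w) = g \<otimes> ev [l] \<otimes> ev w"
      using ev_Cons[OF l(1,2)] Cons.prems l by (simp add: m_assoc)
    ultimately obtain i where i: "i \<le> length w" "g \<otimes> ev [l] \<otimes> ev (take i w) \<in> K e"
      using Cons.IH[of "g \<otimes> ev [l]" v] Cons.prems l by auto
    have ti: "take i w \<in> lists gens" using l(2) by (meson in_listsD in_listsI in_set_takeD)
    have "g \<otimes> ev (take (Suc i) (l # w)) = g \<otimes> ev [l] \<otimes> ev (take i w)"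
      using ev_Cons[OF l(1) ti] Cons.prems(3) l(3) ev_closed[OF ti] by (simp add: m_assoc)
    then show ?thesis using i by (intro exI[of _ "Suc i"]) simp
  qed
qed

text \<open>Whether \<open>g H v\<close> and \<open>g' H v'\<close> are the same vertex of the Bass--Serre tree.\<close>
definition same :: "'v \<Rightarrow> 'g \<Rightarrow> 'v \<Rightarrow> 'g \<Rightarrow> bool" where
  "same v g v' g' \<longleftrightarrow> v = v' \<and> inv g \<otimes> g' \<in> H v"

lemma same_refl: "v \<in> V \<Longrightarrow> g \<in> carrier G \<Longrightarrow> same v g v g"
  using subgroup.one_closed[OF H_subgroup] by (simp add: same_def)

lemma same_sym:
  assumes "v \<in> V" "g \<in> carrier G" "g' \<in> carrier G" "same v g v' g'"
  shows "same v' g' v g"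
  using subgroup.m_inv_closed[OF H_subgroup[OF assms(1)], of "inv g \<otimes> g'"] assms
  by (auto simp: same_def inv_mult_group)

lemma same_trans:
  assumes "v \<in> V" "g \<in> carrier G" "g' \<in> carrier G" "g'' \<in> carrier G"
    "same v g v' g'" "same v' g' v'' g''"
  shows "same v g v'' g''"
proof -
  have "v' = v" "v'' = v" "inv g \<otimes> g' \<in> H v" "inv g' \<otimes> g'' \<in> H v"
    using assms by (auto simp: same_def)
  then have "inv g \<otimes> g' \<otimes> (inv g' \<otimes> g'') \<in> H v"
    using subgroup.m_closed[OF H_subgroup[OF assms(1)]] by blast
  then show ?thesis using inv_mult_mult assms \<open>v'' = v\<close> by (simp add: same_def)
qed

lemma inv_mult_cancel: "x \<in> carrier G \<Longrightarrow> y \<in> carrier G \<Longrightarrow> x \<otimes> (inv x \<otimes> y) = y"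
  by (simp add: m_assoc[symmetric])

lemma same_mult: "v \<in> V \<Longrightarrow> g \<in> carrier G \<Longrightarrow> h \<in> H v \<Longrightarrow> same v g v (g \<otimes> h)"
  using H_carrier by (simp add: same_def m_assoc[symmetric])

text \<open>
  Connectedness of the Bass--Serre tree. Passing from \<open>g H v\<close> to \<open>g H v'\<close> is possible because the
  letters of the maximal tree are trivial in \<open>G\<close>.
\<close>
lemma vertex_coset_induct:
  assumes base: "u \<in> V" "k \<in> carrier G" "P u k"
    and vertex: "\<And>v g h. \<lbrakk>v \<in> V; g \<in> carrier G; P v g; h \<in> H v\<rbrakk> \<Longrightarrow> P v (g \<otimes> h)"
    and arc: "\<And>e g. \<lbrakk>e \<in> A; g \<in> carrier G; P (src e) g\<rbrakk> \<Longrightarrow> P (tgt e) (g \<otimes> t e)"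
    and "v \<in> V" "g \<in> carrier G"
  shows "P v g"
proof -
  have walk: "P v' g" if "tree.awalk v p v'" "P v g" "g \<in> carrier G" for v p v' g
    using that
  proof (induction p arbitrary: v)
    case Nil
    then show ?case by (simp add: tree.awalk_Nil_iff)
  next
    case (Cons e p)
    then have e: "e \<in> T" "src e = v" "tree.awalk (tgt e) p v'" by (auto simp: tree.awalk_Cons_iff)
    then have "P (tgt e) g" using arc[of e g] Cons.prems T_A[of e] t_tree[of e] by simp
    then show ?case using Cons.IH e Cons.prems by blast
  qed
  have move: "P v' g" if "v \<in> V" "v' \<in> V" "P v g" "g \<in> carrier G" for v v' g
    using tree_walk[OF that(1,2)] walk that by blast
  have word: "P v (g \<otimes> ev w)" if vV: "v \<in> V" and "w \<in> lists gens" "P v g" "g \<in> carrier G" for v g w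
    using that(2-)
  proof (induction w arbitrary: g)
    case Nil
    then show ?case by simp
  next
    case (Cons l w)
    then have l: "l \<in> gens" "w \<in> lists gens" "ev [l] \<in> carrier G" "ev w \<in> carrier G" by auto
    have "P v (g \<otimes> ev [l])"
    proof (cases l)
      case (Vertex_elt u a)
      then have u: "u \<in> V" "vx u a \<in> H u" using l by (auto simp: H_eq)
      then have "P u (g \<otimes> ev [l])"
        using vertex[OF u(1) _ _ u(2), of g] move[OF vV u(1)] Cons.prems Vertex_elt by blast
      then show ?thesis using move[OF u(1) vV] Cons.prems l by simp
    next
      case (Edge_elt e)
      then have e: "e \<in> A" using l by simp
      then have "P (tgt e) (g \<otimes> ev [l])"
        using arc[OF e, of g] move[OF vV src_V[OF e]] Cons.prems Edge_elt by blast
      then show ?thesis using move[OF tgt_V[OF e] vV] Cons.prems l by simp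
    qed
    then have "P v (g \<otimes> ev [l] \<otimes> ev w)" using Cons.IH Cons.prems l by simp
    then show ?case using ev_Cons[OF l(1,2)] Cons.prems l by (simp add: m_assoc)
  qed
  obtain w where w: "w \<in> lists gens" "ev w = inv k \<otimes> g"
    using ev_surj[of "inv k \<otimes> g"] base assms by auto
  have "P u (k \<otimes> ev w)" using word[OF base(1) w(1)] base by blast
  then have "P u g" using w inv_mult_cancel base assms by simp
  then show ?thesis using move[OF base(1)] assms by blast
qed

text \<open>One arc from each pair, so that every edge of the Bass--Serre tree is counted once.\<close>
definition positive_arcs :: "'e set" where
  "positive_arcs = {e \<in> A. (SOME x. x \<in> {e, rv e}) = e}"

lemma positive_arcs_rv: "e \<in> A \<Longrightarrow> rv e \<in> positive_arcs \<longleftrightarrow> e \<notin> positive_arcs"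
proof -
  assume e: "e \<in> A"
  define c where "c = (SOME x. x \<in> {e, rv e})"
  have c: "c \<in> {e, rv e}" unfolding c_def by (rule someI[of _ e]) simp
  have "{rv e, rv (rv e)} = {e, rv e}" using e by auto
  then have "rv e \<in> positive_arcs \<longleftrightarrow> c = rv e" "e \<in> positive_arcs \<longleftrightarrow> c = e"
    unfolding positive_arcs_def mem_Collect_eq c_def using e rv_A by presburger+
  then show ?thesis using c rv_neq[OF e] by auto
qed

lemma positive_arcs_A: "e \<in> positive_arcs \<Longrightarrow> e \<in> A"
  by (simp add: positive_arcs_def)

definition rep :: "'e \<Rightarrow> 'g \<Rightarrow> 'g" where
  "rep e = (SOME r. (\<forall>x\<in>carrier G. r x \<in> carrier G \<and> inv x \<otimes> r x \<in> K e) \<and>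
     (\<forall>x\<in>carrier G. \<forall>y\<in>carrier G. inv x \<otimes> y \<in> K e \<longrightarrow> r x = r y))"

lemma rep:
  assumes "e \<in> A"
  shows "x \<in> carrier G \<Longrightarrow> rep e x \<in> carrier G" "x \<in> carrier G \<Longrightarrow> inv x \<otimes> rep e x \<in> K e"
    "\<lbrakk>x \<in> carrier G; y \<in> carrier G; inv x \<otimes> y \<in> K e\<rbrakk> \<Longrightarrow> rep e x = rep e y"
  using someI_ex[OF left_transversal[OF K_subgroup[OF assms]], folded rep_def] by blast+

lemma rep_inv: "e \<in> A \<Longrightarrow> x \<in> carrier G \<Longrightarrow> inv (rep e x) \<otimes> x \<in> K e"
  using subgroup.m_inv_closed[OF K_subgroup rep(2)] rep(1) by (simp add: inv_mult_group)

lemma rep_rep: "e \<in> A \<Longrightarrow> x \<in> carrier G \<Longrightarrow> rep e (rep e x) = rep e x"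
  using rep(3)[of e x "rep e x"] rep(1,2) by simp

text \<open>
  The edges of the Bass--Serre tree, without repetitions: the coset \<open>h K e\<close> enters only through its
  representative.
\<close>
definition walls :: "('e \<times> 'g) set" where
  "walls = {(e, rep e x) | e x. e \<in> positive_arcs \<and> x \<in> carrier G}"

lemma walls_A: "(e, h) \<in> walls \<Longrightarrow> e \<in> A"
  and walls_positive: "(e, h) \<in> walls \<Longrightarrow> e \<in> positive_arcs"
  and walls_carrier: "(e, h) \<in> walls \<Longrightarrow> h \<in> carrier G"
  and walls_rep: "(e, h) \<in> walls \<Longrightarrow> rep e h = h"
  using positive_arcs_A rep(1) rep_rep by (auto simp: walls_def)

definition side :: "'e \<times> 'g \<Rightarrow> 'v \<Rightarrow> 'g \<Rightarrow> bool" where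
  "side w v g = wall (fst w) v (inv (snd w) \<otimes> g)"

text \<open>
  The two ends of the edge \<open>(e, h)\<close> are \<open>h H (src e)\<close> and \<open>h t H (tgt e)\<close>, where \<open>t = t e\<close>.
\<close>
definition incident :: "'e \<times> 'g \<Rightarrow> 'v \<Rightarrow> 'g \<Rightarrow> bool" where
  "incident w v g \<longleftrightarrow>
     same (src (fst w)) (snd w) v g \<or> same (tgt (fst w)) (snd w \<otimes> t (fst w)) v g"

lemma side_same:
  assumes "(e, h) \<in> walls" "v \<in> V" "g \<in> carrier G" "g' \<in> carrier G" "same v g v' g'"
  shows "side (e, h) v g = side (e, h) v' g'"
proof -
  have "v' = v" "inv g \<otimes> g' \<in> H v" using assms by (auto simp: same_def)
  then have "wall e v (inv h \<otimes> g \<otimes> (inv g \<otimes> g')) = wall e v (inv h \<otimes> g)"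
    using wall_vertex walls_A walls_carrier assms by simp
  then show ?thesis
    using inv_mult_mult walls_carrier[OF assms(1)] assms \<open>v' = v\<close> by (simp add: side_def)
qed

lemma incident_same:
  assumes "(e, h) \<in> walls" "v \<in> V" "g \<in> carrier G" "g' \<in> carrier G" "same v g v' g'"
    "incident (e, h) v g"
  shows "incident (e, h) v' g'"
  using assms same_trans[of "src e" h g g' v v'] same_trans[of "tgt e" "h \<otimes> t e" g g' v v']
    walls_A[OF assms(1)] walls_carrier[OF assms(1)]
  by (auto simp: incident_def)

lemma inv_translate_mult: "h \<in> carrier G \<Longrightarrow> g \<in> carrier G \<Longrightarrow> e \<in> A \<Longrightarrow>
    inv h \<otimes> (g \<otimes> t e) = inv h \<otimes> g \<otimes> t e"
  by (simp add: m_assoc)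

text \<open>
  A step along an arc \<open>e\<close> flips the side of the edge that it traverses and of no other edge. This
  edge is labelled by \<open>e\<close> or by its reverse, whichever is positive.
\<close>
lemma arc_wall:
  assumes e: "e \<in> A" and k: "k \<in> carrier G"
  obtains w where "w \<in> walls" "incident w (src e) k" "incident w (tgt e) (k \<otimes> t e)"
    "\<And>w'. w' \<in> walls \<Longrightarrow> (side w' (tgt e) (k \<otimes> t e) \<noteq> side w' (src e) k) = (w' = w)"
proof (cases "e \<in> positive_arcs")
  case True
  define w where "w = (e, rep e k)"
  have w: "w \<in> walls" using True k by (auto simp: w_def walls_def)
  have rk: "rep e k \<in> carrier G" "inv (rep e k) \<otimes> k \<in> K e" using rep rep_inv e k by auto
  have 1: "incident w (src e) k" using rk K_H[OF e] by (auto simp: incident_def w_def same_def)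
  obtain b where b: "b \<in> K (rv e)" "inv (rep e k) \<otimes> k \<otimes> t e = t e \<otimes> b" using K_t[OF e rk(2)] by blast
  have bc: "b \<in> carrier G" "b \<in> H (tgt e)" using b K_carrier[of "rv e"] K_H[of "rv e"] e by auto
  have "inv (rep e k \<otimes> t e) \<otimes> (k \<otimes> t e) = inv (t e) \<otimes> (inv (rep e k) \<otimes> k \<otimes> t e)"
    using rk(1) k e by (simp add: inv_mult_group m_assoc)
  also have "\<dots> = b" using b bc e by (simp add: m_assoc[symmetric])
  finally have 2: "incident w (tgt e) (k \<otimes> t e)" using bc by (auto simp: incident_def w_def same_def)
  have 3: "(side w' (tgt e) (k \<otimes> t e) \<noteq> side w' (src e) k) = (w' = w)" if w': "w' \<in> walls" for w'
  proof -
    obtain e' h where eh: "w' = (e', h)" by (cases w')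
    have h: "h \<in> carrier G" "e' \<in> A" "e' \<in> positive_arcs" "rep e' h = h"
      using w' eh walls_carrier walls_A walls_positive walls_rep by auto
    have "e \<noteq> rv e'" using h True positive_arcs_rv by blast
    then have "(side w' (tgt e) (k \<otimes> t e) \<noteq> side w' (src e) k) = (e = e' \<and> inv h \<otimes> k \<in> K e')"
      using wall_arc[OF h(2) e, of "inv h \<otimes> k"] h k e
      by (simp add: side_def eh inv_translate_mult crosses_def)
    also have "\<dots> = (w' = w)"
      using h rep(3)[OF h(2,1) k] rk(2) by (auto simp: eh w_def)
    finally show ?thesis .
  qed
  show ?thesis by (rule that[OF w 1 2 3])
next
  case False
  define w where "w = (rv e, rep (rv e) (k \<otimes> t e))"
  have pos: "rv e \<in> positive_arcs" and re: "rv e \<in> A" using False positive_arcs_rv e by auto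
  have kt: "k \<otimes> t e \<in> carrier G" using k e by simp
  have w: "w \<in> walls" using pos kt by (auto simp: w_def walls_def)
  let ?r = "rep (rv e) (k \<otimes> t e)"
  have rk: "?r \<in> carrier G" "inv ?r \<otimes> (k \<otimes> t e) \<in> K (rv e)" using rep rep_inv re kt by auto
  have 2: "incident w (tgt e) (k \<otimes> t e)" using rk K_H[OF re] e by (auto simp: incident_def w_def same_def)
  obtain b where b: "b \<in> K e" "inv ?r \<otimes> (k \<otimes> t e) \<otimes> t (rv e) = t (rv e) \<otimes> b"
    using K_t[OF re rk(2)] e by auto
  have bc: "b \<in> carrier G" "b \<in> H (src e)" using b K_carrier[of e] K_H[of e] e by auto
  have "inv (?r \<otimes> t (rv e)) \<otimes> k = inv (t (rv e)) \<otimes> (inv ?r \<otimes> (k \<otimes> t e) \<otimes> t (rv e))"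
    using rk(1) k e by (simp add: inv_mult_group m_assoc t_rv)
  also have "\<dots> = b" using b bc re by (simp add: m_assoc[symmetric])
  finally have 1: "incident w (src e) k" using bc e by (auto simp: incident_def w_def same_def)
  have 3: "(side w' (tgt e) (k \<otimes> t e) \<noteq> side w' (src e) k) = (w' = w)" if w': "w' \<in> walls" for w'
  proof -
    obtain e' h where eh: "w' = (e', h)" by (cases w')
    have h: "h \<in> carrier G" "e' \<in> A" "e' \<in> positive_arcs" "rep e' h = h"
      using w' eh walls_carrier walls_A walls_positive walls_rep by auto
    have "e \<noteq> e'" using h False by blast
    moreover have "e = rv e' \<longleftrightarrow> e' = rv e" using e h by auto
    ultimately have "(side w' (tgt e) (k \<otimes> t e) \<noteq> side w' (src e) k) =
        (e' = rv e \<and> inv h \<otimes> (k \<otimes> t e) \<in> K e')"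
      using wall_arc[OF h(2) e, of "inv h \<otimes> k"] h k e
      by (simp add: side_def eh inv_translate_mult crosses_def)
    also have "\<dots> = (w' = w)"
      using h rep(3)[OF h(2,1) kt] rk(2) by (auto simp: eh w_def)
    finally show ?thesis .
  qed
  show ?thesis by (rule that[OF w 1 2 3])
qed

lemma wall_ends:
  assumes "(e, h) \<in> walls"
  shows "side (e, h) (src e) h \<noteq> side (e, h) (tgt e) (h \<otimes> t e)"
proof -
  have e: "e \<in> A" and h: "h \<in> carrier G" using assms walls_A walls_carrier by auto
  have "\<one> \<in> K e" using subgroup.one_closed[OF K_subgroup[OF e]] .
  then have "crosses e e (inv h \<otimes> h)" using h by (simp add: crosses_def)
  then show ?thesis
    using wall_arc[OF e e, of "inv h \<otimes> h"] h e by (simp only: side_def fst_conv snd_conv inv_translate_mult) auto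
qed

text \<open>
  The two ends of an edge lie on different sides, so the side tells them apart.
\<close>
lemma incident_same_side:
  assumes w: "(e, h) \<in> walls" and u: "u \<in> V" "k \<in> carrier G" "u' \<in> V" "k' \<in> carrier G"
    and inc: "incident (e, h) u k" "incident (e, h) u' k'"
    and eq: "side (e, h) u k = side (e, h) u' k'"
  shows "same u k u' k'"
proof -
  have e: "e \<in> A" and h: "h \<in> carrier G" using w walls_A walls_carrier by auto
  note S = side_same[OF w src_V[OF e] h u(2)] side_same[OF w src_V[OF e] h u(4)]
    side_same[OF w tgt_V[OF e] _ u(2), of "h \<otimes> t e"] side_same[OF w tgt_V[OF e] _ u(4), of "h \<otimes> t e"]
  have ht: "h \<otimes> t e \<in> carrier G" using h e by simp
  have "(same (src e) h u k \<and> same (src e) h u' k') \<or>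
    (same (tgt e) (h \<otimes> t e) u k \<and> same (tgt e) (h \<otimes> t e) u' k')"
    using inc eq S ht wall_ends[OF w] unfolding incident_def by auto
  then show ?thesis
    using same_trans[OF u(1,2) h u(4)] same_trans[OF u(1,2) ht u(4)]
      same_sym[OF src_V[OF e] h u(2)] same_sym[OF tgt_V[OF e] ht u(2)] by blast
qed

lemma other_end:
  assumes w: "w \<in> walls" and v: "v \<in> V" "g \<in> carrier G" and inc: "incident w v g"
  obtains v' g' where "v' \<in> V" "g' \<in> carrier G"
    "\<And>w'. w' \<in> walls \<Longrightarrow> (side w' v' g' \<noteq> side w' v g) = (w' = w)"
proof -
  obtain e h where eh: "w = (e, h)" by (cases w)
  have e: "e \<in> A" and h: "h \<in> carrier G" "h \<otimes> t e \<in> carrier G"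
    using w eh walls_A walls_carrier by auto
  obtain w0 where w0: "w0 \<in> walls"
    "\<And>w'. w' \<in> walls \<Longrightarrow> (side w' (tgt e) (h \<otimes> t e) \<noteq> side w' (src e) h) = (w' = w0)"
    using arc_wall[OF e h(1)] by metis
  have w0_w: "w0 = w" using w0(2)[OF w] wall_ends w eh by blast
  consider "same (src e) h v g" | "same (tgt e) (h \<otimes> t e) v g" using inc by (auto simp: incident_def eh)
  then show ?thesis
  proof cases
    case 1
    have "side w' v g = side w' (src e) h" if "w' \<in> walls" for w'
      using side_same[OF _ src_V[OF e] h(1) v(2) 1] that by (cases w') auto
    then show ?thesis using that[OF tgt_V[OF e] h(2)] w0 w0_w by simp
  next
    case 2
    have "side w' v g = side w' (tgt e) (h \<otimes> t e)" if "w' \<in> walls" for w'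
      using side_same[OF _ tgt_V[OF e] h(2) v(2) 2] that by (cases w') auto
    then show ?thesis using that[OF src_V[OF e] h(1)] w0 w0_w by metis
  qed
qed

text \<open>
  The first edge of the path between two vertices separates them. Instead of choosing paths, the
  statement is propagated from one vertex to its neighbours: it could only be lost by traversing
  the separating edge itself, which leads back to the initial vertex.
\<close>
lemma incident_wall_separates:
  assumes v: "v \<in> V" "g \<in> carrier G" and "v' \<in> V" "g' \<in> carrier G"
  shows "same v g v' g' \<or> (\<exists>w\<in>walls. incident w v g \<and> side w v g \<noteq> side w v' g')"
    (is "?P v' g'")
proof (rule vertex_coset_induct[of v g ?P])
  show "?P v g" using same_refl v by blast
next
  fix u k h assume u: "u \<in> V" "k \<in> carrier G" "?P u k" "h \<in> H u"
  have "same u k u (k \<otimes> h)" using same_mult u by blast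
  moreover have kh: "k \<otimes> h \<in> carrier G" using u H_carrier by simp
  moreover have "side w u k = side w u (k \<otimes> h)" if "w \<in> walls" for w
    using side_same[OF _ u(1,2) kh \<open>same u k u (k \<otimes> h)\<close>] that by (cases w) auto
  ultimately show "?P u (k \<otimes> h)" using u(3) same_trans[OF v u(2) kh] by metis
next
  fix e k assume e: "e \<in> A" and k: "k \<in> carrier G" and P: "?P (src e) k"
  have kt: "k \<otimes> t e \<in> carrier G" using k e by simp
  obtain w0 where w0: "w0 \<in> walls" "incident w0 (src e) k" "incident w0 (tgt e) (k \<otimes> t e)"
    "\<And>w'. w' \<in> walls \<Longrightarrow> (side w' (tgt e) (k \<otimes> t e) \<noteq> side w' (src e) k) = (w' = w0)"
    using arc_wall[OF e k] by metis
  show "?P (tgt e) (k \<otimes> t e)"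
  proof (cases "same v g (src e) k")
    case True
    then have T': "same (src e) k v g" using same_sym v k by blast
    have "incident w0 v g"
      using incident_same[OF _ src_V[OF e] k v(2) T'] w0(1,2) by (cases w0) auto
    moreover have "side w0 v g = side w0 (src e) k"
      using side_same[OF _ v k True] w0(1) by (cases w0) auto
    ultimately show ?thesis using w0(1) w0(4)[OF w0(1)] by metis
  next
    case False
    then obtain w where w: "w \<in> walls" "incident w v g" "side w v g \<noteq> side w (src e) k" using P by blast
    show ?thesis
    proof (cases "w = w0")
      case True
      then have "side w v g = side w (tgt e) (k \<otimes> t e)" using w w0(4)[OF w0(1)] by metis
      then have "same v g (tgt e) (k \<otimes> t e)"
        using incident_same_side[OF _ v tgt_V[OF e] kt] w w0(3) True by (cases w) auto
      then show ?thesis by blast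
    next
      case False
      then show ?thesis using w w0(4)[OF w(1)] by metis
    qed
  qed
qed (use assms in auto)

text \<open>
  Here \<open>\<omega>\<close> orients the edges by choosing a side of each. Crossing an incident edge that points away
  corrects this edge and leaves all others unchanged, so the number of wrong edges drops.
\<close>
lemma sink_exists:
  assumes "v \<in> V" "g \<in> carrier G" "finite {w \<in> walls. side w v g \<noteq> \<omega> w}"
  shows "\<exists>v'\<in>V. \<exists>g'\<in>carrier G. \<forall>w\<in>walls. incident w v' g' \<longrightarrow> side w v' g' = \<omega> w"
  using assms
proof (induction "card {w \<in> walls. side w v g \<noteq> \<omega> w}" arbitrary: v g rule: less_induct)
  case less
  show ?case
  proof (cases "\<forall>w\<in>walls. incident w v g \<longrightarrow> side w v g = \<omega> w")
    case True
    then show ?thesis using less.prems by blast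
  next
    case False
    then obtain w where w: "w \<in> walls" "incident w v g" "side w v g \<noteq> \<omega> w" by blast
    obtain v' g' where v': "v' \<in> V" "g' \<in> carrier G"
      "\<And>w'. w' \<in> walls \<Longrightarrow> (side w' v' g' \<noteq> side w' v g) = (w' = w)"
      using other_end[OF w(1) less.prems(1,2) w(2)] by metis
    have "side w v' g' = \<omega> w" using v'(3)[OF w(1)] w(3) by auto
    moreover have "side w' v' g' = side w' v g" if "w' \<in> walls" "w' \<noteq> w" for w' using v'(3) that by blast
    ultimately have sub: "{w \<in> walls. side w v' g' \<noteq> \<omega> w} \<subset> {w \<in> walls. side w v g \<noteq> \<omega> w}"
      using w(1,3) by blast
    show ?thesis
      by (rule less.hyps[OF psubset_card_mono[OF less.prems(3) sub] v'(1,2)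
            finite_subset[OF psubset_imp_subset[OF sub] less.prems(3)]])
  qed
qed

end

locale decomposed_fg_group = decomposed_group \<G> T G \<phi> + fg_group G S
  for \<G> :: "('v, 'e, 'a, 'b) graph_of_groups" and T :: "'e set" and G :: "'g monoid" (structure)
    and \<phi> :: "('v, 'e, 'a) gog_letter list set \<Rightarrow> 'g" and S :: "'g set"
begin

text \<open>
  Read off along a geodesic: by \<open>wall_word\<close> a single generator changes sides only near the coset.
\<close>
lemma wall_crossing:
  obtains C where "C \<ge> 0"
    "\<And>w v v' g g'. \<lbrakk>w \<in> walls; v \<in> V; v' \<in> V; g \<in> carrier G; g' \<in> carrier G;
       side w v g \<noteq> side w v' g'\<rbrakk> \<Longrightarrow> \<exists>k\<in>K (fst w). d g (snd w \<otimes> k) \<le> d g g' + C"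
proof -
  define word where "word s = (SOME u. u \<in> lists gens \<and> ev u = s)" for s
  have word: "word s \<in> lists gens" "ev (word s) = s" if "s \<in> letters" for s
    using someI_ex[of "\<lambda>u. u \<in> lists gens \<and> ev u = s"] ev_surj[OF letters_carrier[OF that]]
    unfolding word_def by auto
  define F where "F = insert 0 ((\<lambda>(s, i). d \<one> (ev (take i (word s)))) ` (SIGMA s:letters. {..length (word s)}))"
  have F: "finite F" unfolding F_def using finite_letters by auto
  define C where "C = Max F"
  have C0: "C \<ge> 0" unfolding C_def by (rule Max_ge[OF F]) (simp add: F_def)
  have C: "d \<one> (ev (take i (word s))) \<le> C" if "s \<in> letters" "i \<le> length (word s)" for s i
    unfolding C_def by (rule Max_ge[OF F]) (use that in \<open>force simp: F_def\<close>)
  have step: "\<exists>k\<in>K e. d g k \<le> C"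
    if st: "e \<in> A" "v \<in> V" "v' \<in> V" "g \<in> carrier G" "s \<in> letters" "wall e v g \<noteq> wall e v' (g \<otimes> s)" for e v v' g s
  proof -
    obtain i where i: "i \<le> length (word s)" "g \<otimes> ev (take i (word s)) \<in> K e"
      using wall_word[OF st(1) word(1)[OF st(5)] st(4,2,3)] word(2)[OF st(5)] st(6) by auto
    have "take i (word s) \<in> lists gens"
      using word(1)[OF st(5)] by (meson in_listsD in_listsI in_set_takeD)
    then show ?thesis using i C[OF st(5) i(1)] dist_mult_right[OF st(4)] by (intro bexI[OF _ i(2)]) simp
  qed
  have path: "\<exists>k\<in>K e. d g k \<le> length ws + C"
    if "e \<in> A" "v \<in> V" "v' \<in> V" "g \<in> carrier G" "set ws \<subseteq> letters" "wall e v g \<noteq> wall e v' (g \<otimes> product ws)"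
    for e v v' g ws
    using that(2,4-6)
  proof (induction ws arbitrary: g)
    case Nil
    then have "g \<in> K e" using wall_change[OF that(1) _ that(3), of v g] by simp
    then show ?case using C0 Nil by (intro bexI[of _ g]) simp_all
  next
    case (Cons s ws)
    then have s: "s \<in> letters" "s \<in> carrier G" "set ws \<subseteq> letters" "product ws \<in> carrier G"
      using letters_carrier product_closed by auto
    show ?case
    proof (cases "wall e v g = wall e v (g \<otimes> s)")
      case False
      then show ?thesis using step[OF that(1) Cons.prems(1) Cons.prems(1,2) s(1)] by force
    next
      case True
      then have "wall e v (g \<otimes> s) \<noteq> wall e v' (g \<otimes> s \<otimes> product ws)"
        using Cons.prems s by (simp add: m_assoc)
      then obtain k where k: "k \<in> K e" "d (g \<otimes> s) k \<le> length ws + C"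
        using Cons.IH[of "g \<otimes> s"] Cons.prems s by auto
      have "d g k \<le> d g (g \<otimes> s) + d (g \<otimes> s) k"
        using Cons.prems s k K_carrier[OF that(1)] by (intro metric.triangle) auto
      moreover have "d g (g \<otimes> s) \<le> 1"
        using dist_product_le[of "[s]"] s dist_mult_right[of g s] Cons.prems by simp
      ultimately show ?thesis using k by (intro bexI[OF _ k(1)]) simp
    qed
  qed
  show ?thesis
  proof (rule that[OF C0])
    fix w v v' g g'
    assume w: "w \<in> walls" and v: "v \<in> V" "v' \<in> V" and g: "g \<in> carrier G" "g' \<in> carrier G"
      and ne: "side w v g \<noteq> side w v' g'"
    obtain e h where eh: "w = (e, h)" by (cases w)
    have e: "e \<in> A" and h: "h \<in> carrier G" using w eh walls_A walls_carrier by auto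
    obtain ws where ws: "set ws \<subseteq> letters" "g' = g \<otimes> product ws" "real (length ws) = d g g'"
      using geodesic[OF g] by blast
    have hg: "inv h \<otimes> g \<in> carrier G" using h g by simp
    have ne': "wall e v (inv h \<otimes> g) \<noteq> wall e v' (inv h \<otimes> g \<otimes> product ws)"
      using ne ws h g product_closed[OF ws(1)] by (simp add: side_def eh m_assoc)
    obtain k where "k \<in> K e" "d (inv h \<otimes> g) k \<le> length ws + C"
      using path[OF e v hg ws(1) ne'] by blast
    then show "\<exists>k\<in>K (fst w). d g (snd w \<otimes> k) \<le> d g g' + C"
      using dist_inv_left[OF h g(1)] K_carrier[OF e] ws(3) by (auto simp: eh)
  qed
qed

lemma incident_near:
  obtains C where "C \<ge> 0"
    "\<And>w v g k. \<lbrakk>w \<in> walls; v \<in> V; g \<in> carrier G; incident w v g; k \<in> K (fst w)\<rbrakk> \<Longrightarrow>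
       \<exists>b\<in>H v. d (snd w \<otimes> k) (g \<otimes> b) \<le> C"
proof -
  define F where "F = insert 0 ((\<lambda>e. d \<one> (t e)) ` A)"
  have F: "finite F" unfolding F_def using finite_A by auto
  define C where "C = Max F"
  have C0: "C \<ge> 0" unfolding C_def by (rule Max_ge[OF F]) (simp add: F_def)
  have C: "d \<one> (t e) \<le> C" if "e \<in> A" for e
    unfolding C_def by (rule Max_ge[OF F]) (use that in \<open>simp add: F_def\<close>)
  show ?thesis
  proof (rule that[OF C0])
    fix w v g k
    assume w: "w \<in> walls" and v: "v \<in> V" and g: "g \<in> carrier G" and inc: "incident w v g"
      and k: "k \<in> K (fst w)"
    obtain e h where eh: "w = (e, h)" by (cases w)
    have e: "e \<in> A" and h: "h \<in> carrier G" "h \<otimes> t e \<in> carrier G" using w eh walls_A walls_carrier by auto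
    have kc: "k \<in> carrier G" "k \<in> K e" using K_carrier[OF e] k eh by auto
    consider "same (src e) h v g" | "same (tgt e) (h \<otimes> t e) v g" using inc by (auto simp: incident_def eh)
    then show "\<exists>b\<in>H v. d (snd w \<otimes> k) (g \<otimes> b) \<le> C"
    proof cases
      case 1
      then have "inv g \<otimes> h \<in> H v" "v = src e"
        using same_sym[OF src_V[OF e] h(1) g] by (auto simp: same_def)
      then have "inv g \<otimes> h \<otimes> k \<in> H v"
        using K_H[OF e] kc subgroup.m_closed[OF H_subgroup[OF v]] by blast
      moreover have "g \<otimes> (inv g \<otimes> h \<otimes> k) = h \<otimes> k"
        using g h kc inv_mult_cancel[of g "h \<otimes> k"] by (simp add: m_assoc)
      ultimately show ?thesis using h kc C0 by (intro bexI[of _ "inv g \<otimes> h \<otimes> k"]) (simp_all add: eh)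
    next
      case 2
      then have a: "inv g \<otimes> (h \<otimes> t e) \<in> H v" "v = tgt e"
        using same_sym[OF tgt_V[OF e] h(2) g] by (auto simp: same_def)
      obtain b where b: "b \<in> K (rv e)" "k \<otimes> t e = t e \<otimes> b" using K_t[OF e kc(2)] by blast
      have bc: "b \<in> H v" "b \<in> carrier G" using b K_H[of "rv e"] K_carrier[of "rv e"] e a by auto
      then have "inv g \<otimes> (h \<otimes> t e) \<otimes> b \<in> H v"
        using a subgroup.m_closed[OF H_subgroup[OF v]] by blast
      moreover have "g \<otimes> (inv g \<otimes> (h \<otimes> t e) \<otimes> b) = h \<otimes> k \<otimes> t e"
        using g h kc bc b e inv_mult_cancel[of g "h \<otimes> t e \<otimes> b"] by (simp add: m_assoc)
      moreover have "d (h \<otimes> k) (h \<otimes> k \<otimes> t e) \<le> C"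
        using C[OF e] dist_mult_right[of "h \<otimes> k" "t e"] h kc e by simp
      ultimately show ?thesis by (intro bexI[of _ "inv g \<otimes> (h \<otimes> t e) \<otimes> b"]) (simp_all add: eh)
    qed
  qed
qed

text \<open>
  If the points of \<open>Y\<close> that are far from an edge coset all lie on one side of the edge, they orient
  the edge. For a point of \<open>Y\<close> the wrongly oriented edges have cosets near this point, so they are
  finite in number and there is a vertex towards which all its edges point. A point of \<open>Y\<close> elsewhere
  is separated from this vertex by one of these edges, hence is not far from its coset.
\<close>
theorem trapped_in_vertex_coset:
  assumes Y: "Y \<subseteq> carrier G" "Y \<noteq> {}" and v0: "v\<^sub>0 \<in> V"
    and one_sided: "\<And>w y y'. \<lbrakk>w \<in> walls; y \<in> Y; y' \<in> Y; \<forall>k\<in>K (fst w). d y (snd w \<otimes> k) > D;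
       \<forall>k\<in>K (fst w). d y' (snd w \<otimes> k) > D\<rbrakk> \<Longrightarrow> side w v\<^sub>0 y = side w v\<^sub>0 y'"
  shows "\<exists>v\<in>V. \<exists>g\<in>carrier G. \<exists>R. \<forall>y\<in>Y. \<exists>b\<in>H v. d y (g \<otimes> b) \<le> R"
proof -
  define deep where "deep w y \<longleftrightarrow> (\<forall>k\<in>K (fst w). d y (snd w \<otimes> k) > D)" for w y
  show ?thesis
  \<comment> \<open>if no point of \<open>Y\<close> is far from some edge, this edge already traps \<open>Y\<close>\<close>
  proof (cases "\<exists>w\<in>walls. \<forall>y\<in>Y. \<not> deep w y")
    case True
    then obtain w where w: "w \<in> walls" "\<forall>y\<in>Y. \<not> deep w y" by blast
    obtain e h where eh: "w = (e, h)" by (cases w)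
    have e: "e \<in> A" and h: "h \<in> carrier G" using w eh walls_A walls_carrier by auto
    have "\<forall>y\<in>Y. \<exists>b\<in>H (src e). d y (h \<otimes> b) \<le> D"
      using w(2) K_H[OF e] by (fastforce simp: deep_def eh not_less)
    then show ?thesis using h e by (intro bexI[of _ "src e"] bexI[of _ h] exI[of _ D]) auto
  next
    case False
    define far where "far w = (SOME y. y \<in> Y \<and> deep w y)" for w
    have far: "far w \<in> Y" "deep w (far w)" if "w \<in> walls" for w
      using someI_ex[of "\<lambda>y. y \<in> Y \<and> deep w y"] False that unfolding far_def by blast+
    define \<omega> where "\<omega> w = side w v\<^sub>0 (far w)" for w
    have shallow: "\<not> deep w y" if "w \<in> walls" "y \<in> Y" "side w v\<^sub>0 y \<noteq> \<omega> w" for w y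
      using one_sided[OF that(1,2) far(1)[OF that(1)]] far(2)[OF that(1)] that(3)
      unfolding deep_def \<omega>_def by blast
    obtain y0 where y0: "y0 \<in> Y" "y0 \<in> carrier G" using Y by blast
    have "{w \<in> walls. side w v\<^sub>0 y0 \<noteq> \<omega> w} \<subseteq> (\<lambda>(e, x). (e, rep e x)) ` (A \<times> {x \<in> carrier G. d y0 x \<le> D})"
    proof clarify
      fix e h assume eh: "(e, h) \<in> walls" "side (e, h) v\<^sub>0 y0 \<noteq> \<omega> (e, h)"
      have e: "e \<in> A" and h: "h \<in> carrier G" "rep e h = h" using eh walls_A walls_carrier walls_rep by auto
      obtain k where k: "k \<in> K e" "d y0 (h \<otimes> k) \<le> D"
        using shallow[OF eh(1) y0(1) eh(2)] by (auto simp: deep_def not_less)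
      have kc: "k \<in> carrier G" using k K_carrier[OF e] by blast
      then have "rep e h = rep e (h \<otimes> k)" using k h by (intro rep(3)[OF e]) (simp_all add: m_assoc[symmetric])
      then show "(e, h) \<in> (\<lambda>(e, x). (e, rep e x)) ` (A \<times> {x \<in> carrier G. d y0 x \<le> D})"
        using e h k kc by (intro image_eqI[of _ _ "(e, h \<otimes> k)"]) auto
    qed
    then have "finite {w \<in> walls. side w v\<^sub>0 y0 \<noteq> \<omega> w}"
      by (rule finite_subset) (intro finite_imageI finite_cartesian_product finite_A finite_ball y0)
    then obtain v g where v: "v \<in> V" "g \<in> carrier G"
      and sink: "\<And>w. w \<in> walls \<Longrightarrow> incident w v g \<Longrightarrow> side w v g = \<omega> w"
      using sink_exists[OF v0 y0(2)] by blast
    obtain C where C: "C \<ge> 0" "\<And>w v g k. \<lbrakk>w \<in> walls; v \<in> V; g \<in> carrier G; incident w v g; k \<in> K (fst w)\<rbrakk> \<Longrightarrow>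
       \<exists>b\<in>H v. d (snd w \<otimes> k) (g \<otimes> b) \<le> C" using incident_near by blast
    \<comment> \<open>the maximum with 0 covers the points of the coset itself\<close>
    have "\<exists>b\<in>H v. d y (g \<otimes> b) \<le> max 0 (D + C)" if y: "y \<in> Y" for y
    proof -
      have yc: "y \<in> carrier G" using y Y by blast
      consider "same v g v\<^sub>0 y" | w where "w \<in> walls" "incident w v g" "side w v g \<noteq> side w v\<^sub>0 y"
        using incident_wall_separates[OF v v0 yc] by blast
      then show ?thesis
      proof cases
        case 1
        then have "inv g \<otimes> y \<in> H v" by (auto simp: same_def)
        moreover have "g \<otimes> (inv g \<otimes> y) = y" using v yc inv_mult_cancel by simp
        ultimately show ?thesis using yc by (intro bexI[of _ "inv g \<otimes> y"]) simp_all
      next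
        case 2
        then have "\<not> deep w y" using shallow y sink by metis
        then obtain k where k: "k \<in> K (fst w)" "d y (snd w \<otimes> k) \<le> D" by (auto simp: deep_def not_less)
        obtain b where b: "b \<in> H v" "d (snd w \<otimes> k) (g \<otimes> b) \<le> C" using C(2)[OF 2(1) v 2(2) k(1)] by blast
        have "snd w \<otimes> k \<in> carrier G"
          using 2(1) k(1) walls_A[of "fst w" "snd w"] walls_carrier[of "fst w" "snd w"]
            K_carrier[of "fst w" k] by simp
        then have "d y (g \<otimes> b) \<le> d y (snd w \<otimes> k) + d (snd w \<otimes> k) (g \<otimes> b)"
          using yc v H_carrier[OF v(1) b(1)] by (intro metric.triangle) auto
        then show ?thesis using k b by (intro bexI[OF _ b(1)]) simp
      qed
    qed
    then show ?thesis using v by blast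
  qed
qed

text \<open>
  The edge at \<open>g H v\<close> that separates it from \<open>g' H v'\<close> has to be crossed within distance \<open>R\<close> of every
  point of \<open>g H v\<close>.
\<close>
theorem close_vertex_cosets:
  assumes v: "v \<in> V" "g \<in> carrier G" "v' \<in> V" "g' \<in> carrier G" and ne: "\<not> same v g v' g'"
    and close: "\<And>p. p \<in> H v \<Longrightarrow> \<exists>p'\<in>H v'. d (g \<otimes> p) (g' \<otimes> p') \<le> R"
  shows "\<exists>e\<in>A. \<exists>h\<in>carrier G. \<exists>R'. \<forall>p\<in>H v. \<exists>k\<in>K e. d (g \<otimes> p) (h \<otimes> k) \<le> R'"
proof -
  obtain w where w: "w \<in> walls" "side w v g \<noteq> side w v' g'"
    using incident_wall_separates[OF v] ne by blast
  obtain C where C: "C \<ge> 0"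
    "\<And>w v v' g g'. \<lbrakk>w \<in> walls; v \<in> V; v' \<in> V; g \<in> carrier G; g' \<in> carrier G;
       side w v g \<noteq> side w v' g'\<rbrakk> \<Longrightarrow> \<exists>k\<in>K (fst w). d g (snd w \<otimes> k) \<le> d g g' + C"
    using wall_crossing by blast
  have side: "side w v (g \<otimes> p) = side w v g" if "v \<in> V" "g \<in> carrier G" "p \<in> H v" for v g p
  proof -
    have "g \<otimes> p \<in> carrier G" using that H_carrier by simp
    then show ?thesis using side_same[OF _ that(1,2) _ same_mult[OF that]] w(1) by (cases w) auto
  qed
  have "\<exists>k\<in>K (fst w). d (g \<otimes> p) (snd w \<otimes> k) \<le> R + C" if p: "p \<in> H v" for p
  proof -
    obtain p' where p': "p' \<in> H v'" "d (g \<otimes> p) (g' \<otimes> p') \<le> R" using close[OF p] by blast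
    have "side w v (g \<otimes> p) \<noteq> side w v' (g' \<otimes> p')" using side v p p' w by metis
    then obtain k where "k \<in> K (fst w)" "d (g \<otimes> p) (snd w \<otimes> k) \<le> d (g \<otimes> p) (g' \<otimes> p') + C"
      using C(2)[OF w(1) v(1,3), of "g \<otimes> p" "g' \<otimes> p'"] v p p' H_carrier by auto
    then show ?thesis using p' by (intro bexI[of _ k]) auto
  qed
  then show ?thesis
    using w(1) walls_A[of "fst w" "snd w"] walls_carrier[of "fst w" "snd w"] by force
qed

end

section \<open>Coarse components\<close>

definition coarse_step :: "'a metric \<Rightarrow> real \<Rightarrow> 'a set \<Rightarrow> 'a \<Rightarrow> 'a \<Rightarrow> bool" where
  "coarse_step m k A x y \<longleftrightarrow> x \<in> A \<and> y \<in> A \<and> mdist m x y \<le> k"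

lemma coarse_path_Cons2:
  "coarse_path m k (x # y # xs) \<longleftrightarrow> mdist m x y \<le> k \<and> coarse_path m k (y # xs)"
proof
  assume "coarse_path m k (x # y # xs)"
  then show "mdist m x y \<le> k \<and> coarse_path m k (y # xs)"
    unfolding coarse_path_def by (auto dest: spec[of _ 0] spec[of _ "Suc _"])
next
  assume "mdist m x y \<le> k \<and> coarse_path m k (y # xs)"
  then show "coarse_path m k (x # y # xs)"
    unfolding coarse_path_def by (auto simp: nth_Cons split: nat.split)
qed

text \<open>
  Chains of single steps replace coarse paths in all that follows, which turns arguments about
  paths into inductions over the reflexive transitive closure.
\<close>
lemma coarse_path_iff:
  "(\<exists>xs. xs \<noteq> [] \<and> set xs \<subseteq> A \<and> hd xs = x \<and> last xs = y \<and> coarse_path m k xs) \<longleftrightarrow>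
     x \<in> A \<and> (coarse_step m k A)\<^sup>*\<^sup>* x y" (is "?L \<longleftrightarrow> ?R")
proof
  assume ?L
  then obtain xs where "xs \<noteq> []" "set xs \<subseteq> A" "hd xs = x" "last xs = y" "coarse_path m k xs" by blast
  then show ?R
  proof (induction xs arbitrary: x rule: induct_list012)
    case (3 a b xs)
    have "(coarse_step m k A)\<^sup>*\<^sup>* b y"
      using "3.IH"(2)[of b] "3.prems" by (simp add: coarse_path_Cons2)
    moreover have "coarse_step m k A x b"
      using "3.prems" by (auto simp: coarse_path_Cons2 coarse_step_def)
    ultimately show ?case using "3.prems" by (auto intro: converse_rtranclp_into_rtranclp)
  qed auto
next
  assume ?R
  then have "(coarse_step m k A)\<^sup>*\<^sup>* x y" "x \<in> A" by auto
  then show ?L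
  proof (induction rule: converse_rtranclp_induct)
    case base
    then show ?case by (intro exI[of _ "[y]"]) (auto simp: coarse_path_def)
  next
    case (step x z)
    then obtain xs where xs: "xs \<noteq> []" "set xs \<subseteq> A" "hd xs = z" "last xs = y" "coarse_path m k xs"
      by (auto simp: coarse_step_def)
    then obtain xs' where "xs = z # xs'" by (cases xs) auto
    then show ?case
      using xs step by (intro exI[of _ "x # xs"]) (auto simp: coarse_path_Cons2 coarse_step_def)
  qed
qed

lemma coarsely_connected_iff:
  "coarsely_connected m k A \<longleftrightarrow> (\<forall>x\<in>A. \<forall>y\<in>A. (coarse_step m k A)\<^sup>*\<^sup>* x y)"
  unfolding coarsely_connected_def coarse_path_iff by blast

lemma coarse_step_mono: "A \<subseteq> B \<Longrightarrow> (coarse_step m k A)\<^sup>*\<^sup>* x y \<Longrightarrow> (coarse_step m k B)\<^sup>*\<^sup>* x y"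
  by (erule rtranclp_mono[THEN predicate2D, rotated]) (auto simp: coarse_step_def)

lemma coarse_step_sym: "(coarse_step m k A)\<^sup>*\<^sup>* x y \<Longrightarrow> (coarse_step m k A)\<^sup>*\<^sup>* y x"
proof (induction rule: rtranclp_induct)
  case (step y z)
  then have "coarse_step m k A z y" by (auto simp: coarse_step_def mdist_commute)
  then show ?case using step.IH by (rule converse_rtranclp_into_rtranclp)
qed auto

definition coarse_component :: "'a metric \<Rightarrow> real \<Rightarrow> 'a set \<Rightarrow> 'a \<Rightarrow> 'a set" where
  "coarse_component m k A x = {y. (coarse_step m k A)\<^sup>*\<^sup>* x y}"

lemma coarse_component_in:
  assumes "x \<in> A"
  shows "coarse_component m k A x \<in> coarse_components m k A"
proof -
  let ?C = "coarse_component m k A x"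
  have sub: "?C \<subseteq> A"
  proof
    fix y assume "y \<in> ?C"
    then have "(coarse_step m k A)\<^sup>*\<^sup>* x y" by (simp add: coarse_component_def)
    then show "y \<in> A" using assms by (induction rule: rtranclp_induct) (auto simp: coarse_step_def)
  qed
  have within: "(coarse_step m k ?C)\<^sup>*\<^sup>* x y" if "y \<in> ?C" for y
  proof -
    have "(coarse_step m k A)\<^sup>*\<^sup>* x y" using that by (simp add: coarse_component_def)
    then show ?thesis
    proof (induction rule: rtranclp_induct)
      case (step y z)
      then have "y \<in> ?C" "z \<in> ?C" by (auto simp: coarse_component_def intro: rtranclp.rtrancl_into_rtrancl)
      then have "coarse_step m k ?C y z" using step by (simp add: coarse_step_def)
      then show ?case using step.IH by (rule rtranclp.rtrancl_into_rtrancl[rotated])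
    qed auto
  qed
  have "coarsely_connected m k ?C"
    unfolding coarsely_connected_iff using within coarse_step_sym by (meson rtranclp_trans)
  moreover have "C' \<subseteq> ?C" if "?C \<subseteq> C'" "C' \<subseteq> A" "coarsely_connected m k C'" for C'
  proof
    fix z assume "z \<in> C'"
    moreover have "x \<in> C'" using that(1) by (auto simp: coarse_component_def)
    ultimately have "(coarse_step m k C')\<^sup>*\<^sup>* x z" using that(3) by (simp add: coarsely_connected_iff)
    then show "z \<in> ?C" using coarse_step_mono[OF that(2)] by (simp add: coarse_component_def)
  qed
  ultimately show ?thesis using sub unfolding coarse_components_def by blast
qed

lemma le_dist_to_set: "ereal D \<le> dist_to_set m x Z \<longleftrightarrow> (\<forall>z\<in>Z. D \<le> mdist m x z)"
  by (simp add: dist_to_set_def le_INF_iff)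

lemma in_thickening: "z \<in> Z \<Longrightarrow> z \<in> mspace m \<Longrightarrow> L \<ge> 0 \<Longrightarrow> z \<in> thickening m L Z"
proof -
  assume z: "z \<in> Z" "z \<in> mspace m" "L \<ge> 0"
  have "dist_to_set m z Z \<le> ereal (mdist m z z)" unfolding dist_to_set_def by (rule INF_lower[OF z(1)])
  also have "\<dots> = 0" using z(2) by (simp add: zero_ereal_def)
  also have "0 \<le> ereal L" using z(3) by simp
  finally show ?thesis using z(2) by (simp add: thickening_def)
qed

lemma not_in_thickening: "L < D \<Longrightarrow> ereal D \<le> dist_to_set m x Z \<Longrightarrow> x \<notin> thickening m L Z"
  unfolding thickening_def by (auto dest: order_trans)

text \<open>
  Failure of coarse separation, read off at scale 1 and with thickness 0: points far from \<open>Z\<close> are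
  joined by paths in the complement of \<open>Z\<close>.
\<close>
lemma not_coarsely_separates:
  assumes conn: "coarsely_connected m 1 (mspace m)" and ns: "\<not> coarsely_separates m \<Z>"
    and sub: "\<Z> \<subseteq> Pow (mspace m)"
  obtains D where "\<And>Z x y. \<lbrakk>Z \<in> \<Z>; x \<in> mspace m; y \<in> mspace m;
      \<forall>z\<in>Z. D \<le> mdist m x z; \<forall>z\<in>Z. D \<le> mdist m y z\<rbrakk> \<Longrightarrow> (coarse_step m 1 (mspace m - Z))\<^sup>*\<^sup>* x y"
proof -
  obtain D0 where D0: "D0 \<ge> 0" and same:
    "\<And>Z C C'. \<lbrakk>Z \<in> \<Z>; C \<in> coarse_components m 1 (mspace m - thickening m 0 Z);
      C' \<in> coarse_components m 1 (mspace m - thickening m 0 Z);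
      \<exists>x\<in>C. ereal D0 \<le> dist_to_set m x Z; \<exists>x\<in>C'. ereal D0 \<le> dist_to_set m x Z\<rbrakk> \<Longrightarrow> C = C'"
    using ns conn unfolding coarsely_separates_def
    by (metis zero_le_one order.refl)
  \<comment> \<open>a positive distance keeps points out of the thickening of radius 0\<close>
  define D where "D = max D0 1"
  show ?thesis
  proof (rule that[of D])
    fix Z x y
    assume Z: "Z \<in> \<Z>" and xy: "x \<in> mspace m" "y \<in> mspace m"
      and deep: "\<forall>z\<in>Z. D \<le> mdist m x z" "\<forall>z\<in>Z. D \<le> mdist m y z"
    let ?A = "mspace m - thickening m 0 Z"
    have dx: "ereal D \<le> dist_to_set m x Z" and dy: "ereal D \<le> dist_to_set m y Z"
      using deep by (simp_all add: le_dist_to_set)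
    have "ereal D0 \<le> ereal D" by (simp add: D_def)
    then have dx0: "ereal D0 \<le> dist_to_set m x Z" and dy0: "ereal D0 \<le> dist_to_set m y Z"
      using dx dy by (blast intro: order.trans)+
    have xA: "x \<in> ?A" "y \<in> ?A"
      using xy not_in_thickening[OF _ dx, of 0] not_in_thickening[OF _ dy, of 0] by (auto simp: D_def)
    have self: "z \<in> coarse_component m 1 ?A z" for z by (simp add: coarse_component_def)
    have "coarse_component m 1 ?A x = coarse_component m 1 ?A y"
      by (rule same[OF Z coarse_component_in[OF xA(1)] coarse_component_in[OF xA(2)]])
        (use dx0 dy0 self in blast)+
    then have "y \<in> coarse_component m 1 ?A x" using self[of y] by simp
    then have "(coarse_step m 1 ?A)\<^sup>*\<^sup>* x y" by (simp add: coarse_component_def)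
    moreover have "?A \<subseteq> mspace m - Z" using in_thickening[of _ Z m 0] sub Z by auto
    ultimately show "(coarse_step m 1 (mspace m - Z))\<^sup>*\<^sup>* x y" by (rule coarse_step_mono[rotated])
  qed
qed

lemma coarsely_separates_nonempty:
  assumes "coarsely_separates m \<Z>"
  shows "\<exists>Z\<in>\<Z>. Z \<noteq> {}"
proof (rule ccontr)
  assume empty: "\<not> (\<exists>Z\<in>\<Z>. Z \<noteq> {})"
  obtain k L where conn: "coarsely_connected m k (mspace m)" and
    sep: "\<forall>D\<ge>(0::real). \<exists>Z\<in>\<Z>. \<exists>C\<in>coarse_components m k (mspace m - thickening m L Z).
           \<exists>C'\<in>coarse_components m k (mspace m - thickening m L Z). C \<noteq> C'"
    using assms unfolding coarsely_separates_def by blast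
  obtain Z C C' where Z: "Z \<in> \<Z>" "C \<in> coarse_components m k (mspace m - thickening m L Z)"
      "C' \<in> coarse_components m k (mspace m - thickening m L Z)" "C \<noteq> C'"
    using sep[rule_format, OF order.refl] by blast
  have "Z = {}" using Z(1) empty by blast
  then have "thickening m L Z = {}" by (auto simp: thickening_def dist_to_set_def top_ereal_def)
  then have all: "B = mspace m" if "B \<in> coarse_components m k (mspace m - thickening m L Z)" for B
    using that conn unfolding coarse_components_def by blast
  have "C = mspace m" "C' = mspace m" by (rule all[OF Z(2)], rule all[OF Z(3)])
  then show False using Z(4) by simp
qed

section \<open>Bounded degree graphs\<close>

locale bd_graph =
  fixes X :: "'w pair_pre_digraph"
  assumes bd: "bounded_degree_graph X"
begin

abbreviation "VX \<equiv> pverts X"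
abbreviation dX :: "'w \<Rightarrow> 'w \<Rightarrow> real" where "dX \<equiv> path_dist (with_proj X)"
abbreviation mX :: "'w metric" where "mX \<equiv> path_metric (with_proj X)"

lemmas mspace_mX [simp] = mspace_path_metric(1)[OF bd]
lemmas mdist_mX [simp] = mspace_path_metric(2)[OF bd]

sublocale X: pair_bidirected_digraph X
  using bd by (simp add: bounded_degree_graph_def)

sublocale mX: Metric_space VX dX
proof -
  have "Metric_space (verts (with_proj X)) (path_dist (with_proj X))"
    using bd X.wf_digraph X.pair_sym_arcs
    by (intro Metric_space_path_dist) (auto simp: bounded_degree_graph_def)
  then show "Metric_space VX dX" by simp
qed

lemma dist_walk:
  assumes "u \<in> VX" "v \<in> VX"
  shows "\<exists>p. X.awalk u p v \<and> real (length p) = dX u v"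
proof -
  have "\<exists>p. X.awalk u p v"
    using symmetric_connected_walk[of "with_proj X" u v] X.wf_digraph X.pair_sym_arcs bd assms
    by (simp add: bounded_degree_graph_def)
  then have "\<exists>n p. X.awalk u p v \<and> length p = n" by blast
  from LeastI_ex[OF this] show ?thesis unfolding path_dist_def by auto
qed

lemma dist_le_walk: "X.awalk u p v \<Longrightarrow> dX u v \<le> length p"
  unfolding path_dist_def by (auto intro: Least_le)

lemma dist_nat: "\<exists>n. dX u v = real n"
  by (simp add: path_dist_def)

lemma connected_mX: "coarsely_connected mX 1 VX"
  unfolding coarsely_connected_iff
proof (intro ballI)
  have "(coarse_step mX 1 VX)\<^sup>*\<^sup>* u v" if "X.awalk u p v" for u p v
    using that
  proof (induction p arbitrary: u)
    case Nil
    then show ?case by (simp add: X.awalk_Nil_iff)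
  next
    case (Cons e p)
    then have e: "X.awalk u [e] (snd e)" "X.awalk (snd e) p v"
      by (auto simp: X.awalk_Cons_iff X.awalk_Nil_iff)
    then have "coarse_step mX 1 VX u (snd e)"
      using dist_le_walk[OF e(1)] X.awalk_hd_in_verts X.awalk_last_in_verts by (auto simp: coarse_step_def)
    then show ?case using Cons.IH[OF e(2)] by (rule converse_rtranclp_into_rtranclp)
  qed
  then show "(coarse_step mX 1 VX)\<^sup>*\<^sup>* u v" if "u \<in> VX" "v \<in> VX" for u v
    using dist_walk[OF that] by blast
qed

lemma ball_bound: "\<exists>M. \<forall>x\<in>VX. finite {y \<in> VX. dX x y \<le> real n} \<and> card {y \<in> VX. dX x y \<le> real n} \<le> M"
proof (induction n)
  case 0
  have "{y \<in> VX. dX x y \<le> real 0} \<subseteq> {x}" if "x \<in> VX" for x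
    using that mX.mdist_pos_less[of x] by fastforce
  then have "finite {y \<in> VX. dX x y \<le> real 0} \<and> card {y \<in> VX. dX x y \<le> real 0} \<le> 1" if "x \<in> VX" for x
    using that card_mono[of "{x}"] finite_subset[of _ "{x}"] by fastforce
  then show ?case by blast
next
  case (Suc n)
  obtain M where M: "\<And>x. x \<in> VX \<Longrightarrow> finite {y \<in> VX. dX x y \<le> real n}"
    "\<And>x. x \<in> VX \<Longrightarrow> card {y \<in> VX. dX x y \<le> real n} \<le> M" using Suc by blast
  obtain N where N: "\<And>v. v \<in> VX \<Longrightarrow> finite (out_arcs (with_proj X) v)"
    "\<And>v. v \<in> VX \<Longrightarrow> card (out_arcs (with_proj X) v) \<le> N"
    using bd by (auto simp: bounded_degree_graph_def out_degree_def)
  have "finite {y \<in> VX. dX x y \<le> real (Suc n)} \<and> card {y \<in> VX. dX x y \<le> real (Suc n)} \<le> 1 + N * M"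
    if x: "x \<in> VX" for x
  proof -
    let ?B = "\<lambda>e. {y \<in> VX. dX (snd e) y \<le> real n}"
    let ?U = "insert x (\<Union>e\<in>out_arcs (with_proj X) x. ?B e)"
    have snd_V: "snd e \<in> VX" if "e \<in> out_arcs (with_proj X) x" for e
      using that X.head_in_verts by auto
    have sub: "{y \<in> VX. dX x y \<le> real (Suc n)} \<subseteq> ?U"
    proof clarify
      fix y assume y: "y \<in> VX" "dX x y \<le> real (Suc n)" "y \<notin> (\<Union>e\<in>out_arcs (with_proj X) x. ?B e)"
      obtain p where p: "X.awalk x p y" "real (length p) = dX x y" using dist_walk[OF x y(1)] by blast
      show "y = x"
      proof (cases p)
        case Nil
        then show ?thesis using p by (simp add: X.awalk_Nil_iff)
      next
        case (Cons e p')
        then have e: "e \<in> out_arcs (with_proj X) x" "X.awalk (snd e) p' y"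
          using p by (auto simp: X.awalk_Cons_iff)
        have "dX (snd e) y \<le> real n" using dist_le_walk[OF e(2)] p(2) y(2) Cons by simp
        then show ?thesis using e y by blast
      qed
    qed
    have fin: "finite ?U" using N(1)[OF x] M(1) snd_V by auto
    have "card ?U \<le> 1 + card (\<Union>e\<in>out_arcs (with_proj X) x. ?B e)"
      using fin unfolding finite_insert by (simp only: card_insert_if split: if_split) simp
    also have "card (\<Union>e\<in>out_arcs (with_proj X) x. ?B e) \<le> (\<Sum>e\<in>out_arcs (with_proj X) x. card (?B e))"
      by (rule card_UN_le[OF N(1)[OF x]])
    also have "\<dots> \<le> (\<Sum>e\<in>out_arcs (with_proj X) x. M)" using M(2) snd_V by (intro sum_mono) auto
    also have "\<dots> \<le> N * M" using N(2)[OF x] by simp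
    finally have "card ?U \<le> 1 + N * M" by simp
    then show ?thesis using card_mono[OF fin sub] finite_subset[OF sub fin] by simp
  qed
  then show ?case by blast
qed

text \<open>
  A large sphere has its centre far inside and, in an unbounded graph, points far outside; distances
  are integers, so a path of steps of length at most 1 cannot jump over the sphere.
\<close>
lemma spheres_separate:
  assumes x: "x \<in> VX" and unbounded: "\<And>r. \<exists>y\<in>VX. dX x y > r"
  shows "coarsely_separates mX (range (\<lambda>n. {y \<in> VX. dX x y = real n}))"
  unfolding coarsely_separates_def
proof (rule exI[of _ 1], intro conjI zero_le_one, rule exI[of _ 0], intro conjI allI impI)
  fix D :: real assume D: "D \<ge> 0"
  define n where "n = nat \<lceil>D\<rceil> + 1"
  define Z where "Z = {y \<in> VX. dX x y = real n}"
  have n: "real n > D" "n > 0" unfolding n_def using D by linarith+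
  obtain y where y: "y \<in> VX" "dX x y > 2 * real n" using unbounded by blast
  let ?A = "VX - thickening mX 0 Z"
  have dx: "ereal (real n) \<le> dist_to_set mX x Z" by (simp add: le_dist_to_set Z_def)
  have dy: "ereal (real n) \<le> dist_to_set mX y Z"
    unfolding le_dist_to_set
  proof
    fix z assume "z \<in> Z"
    then have "dX x z = real n" "z \<in> VX" by (auto simp: Z_def)
    then show "real n \<le> mdist mX y z" using mX.triangle[of x z y] x y mX.commute[of z y] by simp
  qed
  have xA: "x \<in> ?A" "y \<in> ?A"
    using x y n not_in_thickening[OF _ dx, of 0] not_in_thickening[OF _ dy, of 0] by auto
  have inside: "dX x z < real n" if "(coarse_step mX 1 ?A)\<^sup>*\<^sup>* x z" for z
    using that
  proof (induction rule: rtranclp_induct)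
    case base
    then show ?case using x n by simp
  next
    case (step u z)
    have uz: "u \<in> VX" "z \<in> VX" "dX u z \<le> 1" and z: "z \<notin> thickening mX 0 Z"
      using step(2) by (auto simp: coarse_step_def)
    have "z \<notin> Z" using z in_thickening[of z Z mX 0] uz by auto
    then have "dX x z \<noteq> real n" using uz by (simp add: Z_def)
    moreover have "dX x z < real n + 1" using mX.triangle[of x u z] x uz step.IH by simp
    moreover obtain k where "dX x z = real k" using dist_nat by blast
    ultimately show ?case by simp
  qed
  have "y \<notin> coarse_component mX 1 ?A x"
    using inside[of y] y by (auto simp: coarse_component_def)
  moreover have self: "z \<in> coarse_component mX 1 ?A z" for z by (simp add: coarse_component_def)
  ultimately have ne: "coarse_component mX 1 ?A x \<noteq> coarse_component mX 1 ?A y" by blast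
  have "ereal D \<le> ereal (real n)" using n by simp
  then have "ereal D \<le> dist_to_set mX x Z" "ereal D \<le> dist_to_set mX y Z"
    using dx dy by (blast intro: order.trans)+
  then show "\<exists>Z\<in>range (\<lambda>n. {y \<in> VX. dX x y = real n}).
      \<exists>C\<in>coarse_components mX 1 (mspace mX - thickening mX 0 Z).
        \<exists>C'\<in>coarse_components mX 1 (mspace mX - thickening mX 0 Z).
          C \<noteq> C' \<and> (\<exists>x\<in>C. ereal D \<le> dist_to_set mX x Z) \<and> (\<exists>x\<in>C'. ereal D \<le> dist_to_set mX x Z)"
    using coarse_component_in[OF xA(1), of mX 1] coarse_component_in[OF xA(2), of mX 1] ne self
    by (intro bexI[of _ Z] bexI[of _ "coarse_component mX 1 ?A x"] bexI[of _ "coarse_component mX 1 ?A y"])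
      (auto simp: Z_def)
qed (simp_all add: connected_mX)

text \<open>
  A nonempty member is required because the growth of the family is otherwise the supremum of the
  empty set of reals.
\<close>
lemma slow_family_not_dominating:
  assumes ne: "\<exists>Z\<in>\<S>. Z \<noteq> {}" and sub: "\<S> \<subseteq> Pow VX"
    and bound: "\<And>S s r. \<lbrakk>S \<in> \<S>; s \<in> S; r \<ge> 0\<rbrakk> \<Longrightarrow> real (card {y \<in> S. dX s y \<le> r}) \<le> \<beta> r"
    and small: "\<And>C. C > 0 \<Longrightarrow> \<exists>r\<ge>0. \<beta> r < C * \<gamma> (C * r + C) + C"
  shows "\<not> family_growth mX \<S> \<greatersim> \<gamma>"
proof
  assume "family_growth mX \<S> \<greatersim> \<gamma>"
  then obtain C where C: "C > 0" "\<And>r. r \<ge> 0 \<Longrightarrow> family_growth mX \<S> r \<ge> C * \<gamma> (C * r + C) + C"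
    by (auto simp: dominates_growth_def)
  obtain r where r: "r \<ge> 0" "\<beta> r < C * \<gamma> (C * r + C) + C" using small[OF C(1)] by blast
  have "family_growth mX \<S> r \<le> \<beta> r"
    unfolding family_growth_def
  proof (rule cSup_least)
    show "{real (card (mcball_of mX s r \<inter> S)) |s S. S \<in> \<S> \<and> s \<in> S} \<noteq> {}" using ne by auto
    fix a assume "a \<in> {real (card (mcball_of mX s r \<inter> S)) |s S. S \<in> \<S> \<and> s \<in> S}"
    then obtain s S where s: "a = real (card (mcball_of mX s r \<inter> S))" "S \<in> \<S>" "s \<in> S" by blast
    have "S \<subseteq> VX" using s(2) sub by blast
    then have "mcball_of mX s r \<inter> S = {y \<in> S. dX s y \<le> r}" using s(3) by auto
    then show "a \<le> \<beta> r" using bound[OF s(2,3) r(1)] s(1) by simp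
  qed
  then show False using C(2)[OF r(1)] r(2) by simp
qed

end

text \<open>
  Counting points of a coarse preimage costs an affine change of the radius and a factor; domination
  allows a second affine change and factor. Negligible growth is robust under both.
\<close>
definition negligible_growth :: "(real \<Rightarrow> real) \<Rightarrow> (real \<Rightarrow> nat) \<Rightarrow> bool" where
  "negligible_growth \<gamma> \<beta> \<longleftrightarrow> (\<forall>M>0. \<forall>L>0. \<forall>C>0.
     eventually (\<lambda>r. L * real (\<beta> (M * r + M)) \<le> C * \<gamma> (C * r + C)) at_top)"

section \<open>Coarse maps into decomposed groups\<close>

locale coarse_map = decomposed_fg_group \<G> T G \<phi> S + bd_graph X
  for \<G> :: "('v, 'e, 'a, 'b) graph_of_groups" and T :: "'e set" and G :: "'g monoid" (structure)
    and \<phi> :: "('v, 'e, 'a) gog_letter list set \<Rightarrow> 'g" and S :: "'g set"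
    and X :: "'w pair_pre_digraph" +
  fixes \<gamma> :: "real \<Rightarrow> real" and q :: "'w \<Rightarrow> 'g" and \<Lambda> :: real and N :: nat
  assumes hard_to_separate:
      "\<And>\<S>. \<S> \<subseteq> Pow VX \<Longrightarrow> coarsely_separates mX \<S> \<Longrightarrow> family_growth mX \<S> \<greatersim> \<gamma>"
    and \<gamma>_nonneg: "\<And>r. r \<ge> 0 \<Longrightarrow> \<gamma> r \<ge> 0"
    and negligible: "\<And>e. e \<in> A \<Longrightarrow> negligible_growth \<gamma> (relative_growth G S (K e))"
    and q_closed: "\<And>x. x \<in> VX \<Longrightarrow> q x \<in> carrier G"
    and \<Lambda>_nonneg: "\<Lambda> \<ge> 0"
    and q_Lipschitz: "\<And>x y. x \<in> VX \<Longrightarrow> y \<in> VX \<Longrightarrow> d (q x) (q y) \<le> \<Lambda> * dX x y + \<Lambda>"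
    and q_fibres: "\<And>g. finite {x \<in> VX. q x = g} \<and> card {x \<in> VX. q x = g} \<le> N"
begin

lemma finite_coset_ball: "e \<in> A \<Longrightarrow> finite {k \<in> K e. d \<one> k \<le> r}"
  by (rule finite_subset[OF _ finite_ball[of \<one> r]]) (auto intro: K_carrier)

lemma relative_growth_eq: "relative_growth G S (K e) r = card {k \<in> K e. d \<one> k \<le> r}"
  by (simp add: relative_growth_def mspace_word_metric[OF is_group generating])

text \<open>
  A point of \<open>q ` Z\<close> near \<open>q s\<close> is determined by a point of the edge group in a ball of comparable
  radius, relative to a point of the coset near \<open>q s\<close>, and by a displacement of length at most \<open>R\<close>.
\<close>
lemma count_near_coset:
  assumes e: "e \<in> A" and h: "h \<in> carrier G" and R: "R \<ge> 0" and Z: "Z \<subseteq> VX"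
    and near: "\<And>x. x \<in> Z \<Longrightarrow> \<exists>k\<in>K e. d (q x) (h \<otimes> k) \<le> R" and s: "s \<in> Z"
  shows "card {y \<in> Z. dX s y \<le> r} \<le>
    N * (relative_growth G S (K e) (\<Lambda> * r + \<Lambda> + 2 * R) * card {u \<in> carrier G. d \<one> u \<le> R})"
proof -
  define F where "F = {y \<in> Z. dX s y \<le> r}"
  define Q where "Q = {k \<in> K e. d \<one> k \<le> \<Lambda> * r + \<Lambda> + 2 * R}"
  define B where "B = {u \<in> carrier G. d \<one> u \<le> R}"
  have fin: "finite Q" "finite B" unfolding Q_def B_def using finite_coset_ball e finite_ball by auto
  obtain k0 where k0: "k0 \<in> K e" "d (q s) (h \<otimes> k0) \<le> R" using near[OF s] by blast
  have k0c: "k0 \<in> carrier G" using K_carrier e k0 by blast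
  have sV: "s \<in> VX" "q s \<in> carrier G" using s Z q_closed by auto
  have image: "q ` F \<subseteq> (\<lambda>(k, u). h \<otimes> k0 \<otimes> k \<otimes> u) ` (Q \<times> B)"
  proof clarify
    fix y assume "y \<in> F"
    then have y: "y \<in> Z" "dX s y \<le> r" "y \<in> VX" "q y \<in> carrier G" using Z q_closed by (auto simp: F_def)
    obtain k where k: "k \<in> K e" "d (q y) (h \<otimes> k) \<le> R" using near[OF y(1)] by blast
    have kc: "k \<in> carrier G" using K_carrier e k by blast
    have "d (q s) (q y) \<le> \<Lambda> * r + \<Lambda>"
      using q_Lipschitz[OF sV(1) y(3)] mult_left_mono[OF y(2) \<Lambda>_nonneg] by linarith
    moreover have "d (h \<otimes> k0) (h \<otimes> k) \<le> d (h \<otimes> k0) (q s) + (d (q s) (q y) + d (q y) (h \<otimes> k))"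
      using metric.triangle[of "h \<otimes> k0" "q s" "h \<otimes> k"] metric.triangle[of "q s" "q y" "h \<otimes> k"]
        sV y k0c kc h by simp
    ultimately have "d k0 k \<le> \<Lambda> * r + \<Lambda> + 2 * R"
      using k0 k dist_left_mult[OF h k0c kc] metric.commute[of "h \<otimes> k0" "q s"] by linarith
    then have "inv k0 \<otimes> k \<in> Q"
      using dist_one_translate[OF k0c kc] subgroup.m_closed[OF K_subgroup[OF e]
          subgroup.m_inv_closed[OF K_subgroup[OF e] k0(1)] k(1)] by (simp add: Q_def)
    moreover have "inv (h \<otimes> k) \<otimes> q y \<in> B"
      using k(2) dist_one_translate[of "h \<otimes> k" "q y"] h kc y metric.commute by (simp add: B_def)
    moreover have "q y = h \<otimes> k0 \<otimes> (inv k0 \<otimes> k) \<otimes> (inv (h \<otimes> k) \<otimes> q y)"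
    proof -
      have "h \<otimes> k0 \<otimes> (inv k0 \<otimes> k) = h \<otimes> k"
        using inv_mult_cancel[OF k0c kc] h k0c kc by (simp add: m_assoc)
      then show ?thesis using inv_mult_cancel[of "h \<otimes> k" "q y"] h kc y by simp
    qed
    ultimately show "q y \<in> (\<lambda>(k, u). h \<otimes> k0 \<otimes> k \<otimes> u) ` (Q \<times> B)" by force
  qed
  have finF: "finite (q ` F)" by (rule finite_subset[OF image]) (use fin in auto)
  have "card (q ` F) \<le> card Q * card B"
  proof -
    have "card (q ` F) \<le> card ((\<lambda>(k, u). h \<otimes> k0 \<otimes> k \<otimes> u) ` (Q \<times> B))"
      by (rule card_mono[OF _ image]) (use fin in auto)
    also have "\<dots> \<le> card (Q \<times> B)" by (rule card_image_le) (use fin in auto)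
    finally show ?thesis by (simp add: card_cartesian_product)
  qed
  moreover have "card F \<le> N * card (q ` F)"
  proof -
    have "F \<subseteq> (\<Union>g\<in>q ` F. {x \<in> VX. q x = g})" using Z by (auto simp: F_def)
    then have "card F \<le> card (\<Union>g\<in>q ` F. {x \<in> VX. q x = g})"
      using finF q_fibres by (intro card_mono finite_UN_I) auto
    also have "\<dots> \<le> (\<Sum>g\<in>q ` F. card {x \<in> VX. q x = g})" by (rule card_UN_le[OF finF])
    also have "\<dots> \<le> (\<Sum>g\<in>q ` F. N)" using q_fibres by (intro sum_mono) auto
    finally show ?thesis by (simp add: mult.commute)
  qed
  ultimately have "card F \<le> N * (card Q * card B)" by (meson le_trans mult_le_mono2)
  then show ?thesis by (simp add: F_def Q_def B_def relative_growth_eq)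
qed

lemma relative_growth_mono: "e \<in> A \<Longrightarrow> r \<le> r' \<Longrightarrow> relative_growth G S (K e) r \<le> relative_growth G S (K e) r'"
  unfolding relative_growth_eq by (rule card_mono[OF finite_coset_ball]) auto

text \<open>
  The edge groups grow more slowly than \<open>\<gamma>\<close>, and by \<open>count_near_coset\<close> so does the family.
\<close>
proposition near_cosets_not_separating:
  assumes sub: "\<S> \<subseteq> Pow VX" and R: "R \<ge> 0"
    and near: "\<And>Z. Z \<in> \<S> \<Longrightarrow> \<exists>e\<in>A. \<exists>h\<in>carrier G. \<forall>x\<in>Z. \<exists>k\<in>K e. d (q x) (h \<otimes> k) \<le> R"
  shows "\<not> coarsely_separates mX \<S>"
proof
  assume sep: "coarsely_separates mX \<S>"
  define b where "b = card {u \<in> carrier G. d \<one> u \<le> R}"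
  define M where "M = \<Lambda> + 2 * R + 1"
  have M: "M > 0" using \<Lambda>_nonneg R by (simp add: M_def)
  define \<beta> where "\<beta> r = real (N * b) * (\<Sum>e\<in>A. real (relative_growth G S (K e) (M * r + M)))" for r
  have "\<not> family_growth mX \<S> \<greatersim> \<gamma>"
  proof (rule slow_family_not_dominating[OF coarsely_separates_nonempty[OF sep] sub])
    fix Z s r assume Z: "Z \<in> \<S>" "s \<in> Z" and r: "(r::real) \<ge> 0"
    obtain e h where e: "e \<in> A" and h: "h \<in> carrier G"
      and Zn: "\<And>x. x \<in> Z \<Longrightarrow> \<exists>k\<in>K e. d (q x) (h \<otimes> k) \<le> R" using near[OF Z(1)] by blast
    have ZX: "Z \<subseteq> VX" using Z sub by auto
    have "\<Lambda> * r \<le> M * r" using r R by (intro mult_right_mono) (simp_all add: M_def)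
    then have "\<Lambda> * r + \<Lambda> + 2 * R \<le> M * r + M" by (simp add: M_def)
    then have "relative_growth G S (K e) (\<Lambda> * r + \<Lambda> + 2 * R) \<le> relative_growth G S (K e) (M * r + M)"
      by (rule relative_growth_mono[OF e])
    then have "card {y \<in> Z. dX s y \<le> r} \<le> N * (relative_growth G S (K e) (M * r + M) * b)"
      using count_near_coset[OF e h R ZX Zn Z(2), of r] unfolding b_def
      by (meson le_trans mult_le_mono1 mult_le_mono2)
    then have "real (card {y \<in> Z. dX s y \<le> r}) \<le> real (N * (relative_growth G S (K e) (M * r + M) * b))"
      by (rule of_nat_mono)
    also have "\<dots> = real (N * b) * real (relative_growth G S (K e) (M * r + M))" by simp
    also have "\<dots> \<le> \<beta> r"
      unfolding \<beta>_def by (intro mult_left_mono member_le_sum e finite_A) auto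
    finally show "real (card {y \<in> Z. dX s y \<le> r}) \<le> \<beta> r" .
  next
    fix C :: real assume C: "C > 0"
    \<comment> \<open>large enough that the sum over the finitely many arcs is still at most \<open>C * \<gamma> (C * r + C)\<close>\<close>
    define L where "L = real (N * b) * real (card A) + 1"
    have L: "L > 0" by (simp add: L_def add_nonneg_pos)
    have "eventually (\<lambda>r. \<forall>e\<in>A. L * real (relative_growth G S (K e) (M * r + M)) \<le> C * \<gamma> (C * r + C)) at_top"
      using negligible M L C finite_A by (intro eventually_ball_finite) (auto simp: negligible_growth_def)
    then have "eventually (\<lambda>r. r \<ge> 0 \<and> (\<forall>e\<in>A. L * real (relative_growth G S (K e) (M * r + M)) \<le> C * \<gamma> (C * r + C))) at_top"
      using eventually_ge_at_top[of "0::real"] by eventually_elim simp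
    then obtain r where r: "r \<ge> 0"
      "\<And>e. e \<in> A \<Longrightarrow> L * real (relative_growth G S (K e) (M * r + M)) \<le> C * \<gamma> (C * r + C)"
      by (auto simp: eventually_at_top_linorder)
    define c where "c = C * \<gamma> (C * r + C)"
    have c: "c \<ge> 0" using C r \<gamma>_nonneg by (simp add: c_def)
    have "(\<Sum>e\<in>A. real (relative_growth G S (K e) (M * r + M))) \<le> (\<Sum>e\<in>A. c / L)"
      using r(2) L by (intro sum_mono) (simp add: c_def field_simps)
    then have "\<beta> r \<le> real (N * b) * (real (card A) * (c / L))"
      unfolding \<beta>_def by (intro mult_left_mono) simp_all
    also have "\<dots> = c * ((L - 1) / L)" by (simp add: L_def)
    also have "\<dots> \<le> c" using c L by (intro mult_left_le) (simp_all add: field_simps)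
    finally show "\<exists>r\<ge>0. \<beta> r < C * \<gamma> (C * r + C) + C"
      using r(1) C by (intro exI[of _ r]) (simp add: c_def)
  qed
  then show False using hard_to_separate[OF sub sep] by blast
qed

text \<open>
  With \<open>R\<close> at least the distance at which sides can change along an edge of \<open>X\<close>, paths that avoid the
  preimage of the \<open>R\<close>-neighbourhood of an edge coset stay on one side. As these preimages do not
  coarsely separate \<open>X\<close>, its points far from them are on one side.
\<close>
theorem trapped:
  assumes "VX \<noteq> {}"
  shows "\<exists>v\<in>V. \<exists>g\<in>carrier G. \<exists>R. \<forall>x\<in>VX. \<exists>b\<in>H v. d (q x) (g \<otimes> b) \<le> R"
proof -
  obtain C where C0: "C \<ge> 0" and C:
    "\<And>w v v' g g'. \<lbrakk>w \<in> walls; v \<in> V; v' \<in> V; g \<in> carrier G; g' \<in> carrier G;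
       side w v g \<noteq> side w v' g'\<rbrakk> \<Longrightarrow> \<exists>k\<in>K (fst w). d g (snd w \<otimes> k) \<le> d g g' + C"
    using wall_crossing by blast
  define R where "R = 2 * \<Lambda> + C"
  have R: "R \<ge> 0" using C0 \<Lambda>_nonneg by (simp add: R_def)
  define Z where "Z w = {x \<in> VX. \<exists>k\<in>K (fst w). d (q x) (snd w \<otimes> k) \<le> R}" for w
  obtain v0 where v0: "v0 \<in> V" using V_nonempty by blast
  have ns: "\<not> coarsely_separates mX (Z ` walls)"
  proof (rule near_cosets_not_separating[OF _ R])
    show "Z ` walls \<subseteq> Pow VX" by (auto simp: Z_def)
    fix Y assume "Y \<in> Z ` walls"
    then obtain w where w: "w \<in> walls" "Y = Z w" by blast
    then show "\<exists>e\<in>A. \<exists>h\<in>carrier G. \<forall>x\<in>Y. \<exists>k\<in>K e. d (q x) (h \<otimes> k) \<le> R"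
      using walls_A[of "fst w" "snd w"] walls_carrier[of "fst w" "snd w"]
      by (intro bexI[of _ "fst w"] bexI[of _ "snd w"]) (auto simp: Z_def)
  qed
  have ZX: "Z ` walls \<subseteq> Pow VX" by (auto simp: Z_def)
  obtain D where D: "\<And>Y x y. \<lbrakk>Y \<in> Z ` walls; x \<in> VX; y \<in> VX; \<forall>z\<in>Y. D \<le> dX x z; \<forall>z\<in>Y. D \<le> dX y z\<rbrakk>
      \<Longrightarrow> (coarse_step mX 1 (VX - Y))\<^sup>*\<^sup>* x y"
    using not_coarsely_separates[OF _ ns, unfolded mspace_mX mdist_mX, OF connected_mX ZX] by blast
  define D' where "D' = \<Lambda> * D + \<Lambda> + R"
  have deep: "D \<le> dX x z"
    if w: "w \<in> walls" and x: "x \<in> VX" "\<forall>k\<in>K (fst w). d (q x) (snd w \<otimes> k) > D'" and z: "z \<in> Z w" for w x z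
  proof (rule ccontr)
    assume "\<not> D \<le> dX x z"
    obtain k where k: "k \<in> K (fst w)" "d (q z) (snd w \<otimes> k) \<le> R" and zV: "z \<in> VX" using z by (auto simp: Z_def)
    have "snd w \<otimes> k \<in> carrier G"
      using w k walls_A[of "fst w" "snd w"] walls_carrier[of "fst w" "snd w"] K_carrier[of "fst w" k] by simp
    then have "d (q x) (snd w \<otimes> k) \<le> d (q x) (q z) + d (q z) (snd w \<otimes> k)"
      using x zV q_closed by (intro metric.triangle) auto
    moreover have "d (q x) (q z) \<le> \<Lambda> * D + \<Lambda>"
      using q_Lipschitz[OF x(1) zV] mult_left_mono[of "dX x z" D \<Lambda>] \<Lambda>_nonneg \<open>\<not> D \<le> dX x z\<close> by linarith
    ultimately show False using k x(2) by (force simp: D'_def)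
  qed
  have "\<exists>v\<in>V. \<exists>g\<in>carrier G. \<exists>R. \<forall>y\<in>q ` VX. \<exists>b\<in>H v. d y (g \<otimes> b) \<le> R"
  proof (rule trapped_in_vertex_coset[where D = D', OF _ _ v0])
    show "q ` VX \<subseteq> carrier G" "q ` VX \<noteq> {}" using q_closed assms by auto
    fix w y y'
    assume w: "w \<in> walls" and y: "y \<in> q ` VX" "y' \<in> q ` VX"
      and far: "\<forall>k\<in>K (fst w). d y (snd w \<otimes> k) > D'" "\<forall>k\<in>K (fst w). d y' (snd w \<otimes> k) > D'"
    obtain x x' where x: "x \<in> VX" "y = q x" "x' \<in> VX" "y' = q x'" using y by blast
    have "(coarse_step mX 1 (VX - Z w))\<^sup>*\<^sup>* x x'"
      by (rule D) (use w x far deep in auto)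
    then show "side w v0 y = side w v0 y'"
      unfolding x(2,4)
    proof (induction rule: rtranclp_induct)
      case (step a b)
      then have ab: "a \<in> VX" "b \<in> VX" "a \<notin> Z w" "dX a b \<le> 1" by (auto simp: coarse_step_def)
      have "d (q a) (q b) \<le> 2 * \<Lambda>"
        using q_Lipschitz[OF ab(1,2)] mult_left_mono[OF ab(4) \<Lambda>_nonneg] by linarith
      then have "side w v0 (q a) = side w v0 (q b)"
        using C[OF w v0 v0, of "q a" "q b"] ab q_closed by (force simp: Z_def R_def)
      then show ?case using step.IH by simp
    qed simp
  qed
  then show ?thesis by auto
qed

text \<open>
  The spheres around a point would all be near the same edge coset, and yet separate \<open>X\<close> if it were
  unbounded.
\<close>
theorem bounded_if_near_edge_coset:
  assumes "e \<in> A" "h \<in> carrier G" and near: "\<And>x. x \<in> VX \<Longrightarrow> \<exists>k\<in>K e. d (q x) (h \<otimes> k) \<le> R"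
  shows "\<exists>r. \<forall>x\<in>VX. \<forall>y\<in>VX. dX x y \<le> r"
proof (cases "VX = {}")
  case False
  then obtain x where x: "x \<in> VX" by blast
  have "\<not> coarsely_separates mX (range (\<lambda>n. {y \<in> VX. dX x y = real n}))"
  proof (rule near_cosets_not_separating[where R = "max 0 R"])
    fix Z assume "Z \<in> range (\<lambda>n. {y \<in> VX. dX x y = real n})"
    then have "\<forall>y\<in>Z. \<exists>k\<in>K e. d (q y) (h \<otimes> k) \<le> max 0 R"
      using near by (auto simp: le_max_iff_disj)
    then show "\<exists>e\<in>A. \<exists>h\<in>carrier G. \<forall>y\<in>Z. \<exists>k\<in>K e. d (q y) (h \<otimes> k) \<le> max 0 R" using assms by blast
  qed auto
  then obtain r where r: "\<And>y. y \<in> VX \<Longrightarrow> dX x y \<le> r" using spheres_separate[OF x] by (meson not_less)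
  have "dX y z \<le> 2 * r" if "y \<in> VX" "z \<in> VX" for y z
    using mX.triangle[of y x z] r[of y] r[of z] that x mX.commute[of y x] by simp
  then show ?thesis by blast
qed auto

end

section \<open>Growth of the edge groups\<close>

text \<open>
  Up to constants the claim compares \<open>(r + 1) ^ (d - 1)\<close> with \<open>(r + 1) ^ d\<close>.
\<close>
lemma negligible_growth_polynomial:
  assumes d: "d \<ge> 1" and small: "(\<lambda>r. real (\<beta> r)) \<in> o(\<lambda>r. r ^ (d - 1))"
  shows "negligible_growth (\<lambda>r. r ^ d) \<beta>"
  unfolding negligible_growth_def
proof (intro allI impI)
  fix M L C :: real assume pos: "M > 0" "L > 0" "C > 0"
  obtain k where k: "d = Suc k" using d by (cases d) auto
  have "eventually (\<lambda>r. norm (real (\<beta> r)) \<le> 1 * norm (r ^ k)) at_top"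
    by (rule landau_o.smallD) (use small k in simp_all)
  moreover have "filterlim (\<lambda>r. M * r + M) at_top at_top"
    using pos by real_asymp
  ultimately have "eventually (\<lambda>r. norm (real (\<beta> (M * r + M))) \<le> 1 * norm ((M * r + M) ^ k)) at_top"
    by (rule eventually_compose_filterlim)
  moreover have "eventually (\<lambda>r. r \<ge> L * M ^ k / C ^ (k + 2)) at_top" by (rule eventually_ge_at_top)
  moreover have "eventually (\<lambda>r::real. r \<ge> 0) at_top" by (rule eventually_ge_at_top)
  ultimately show "eventually (\<lambda>r. L * real (\<beta> (M * r + M)) \<le> C * (C * r + C) ^ d) at_top"
  proof eventually_elim
    case (elim r)
    have "M * r + M = M * (r + 1)" "C * r + C = C * (r + 1)" by (simp_all add: algebra_simps)
    then have "real (\<beta> (M * r + M)) \<le> M ^ k * (r + 1) ^ k"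
      using elim(1,3) pos by (simp add: power_mult_distrib)
    then have "L * real (\<beta> (M * r + M)) \<le> L * (M ^ k * (r + 1) ^ k)"
      using pos by (intro mult_left_mono) auto
    also have "\<dots> = (L * M ^ k) * (r + 1) ^ k" by simp
    also have "\<dots> \<le> (C ^ (k + 2) * (r + 1)) * (r + 1) ^ k"
    proof (rule mult_right_mono)
      have "L * M ^ k \<le> C ^ (k + 2) * r" using elim(2) pos by (simp add: field_simps)
      also have "\<dots> \<le> C ^ (k + 2) * (r + 1)" using pos by (intro mult_left_mono) auto
      finally show "L * M ^ k \<le> C ^ (k + 2) * (r + 1)" .
    qed (use elim(3) in simp)
    also have "\<dots> = C * (C * r + C) ^ d"
      unfolding k \<open>C * r + C = C * (r + 1)\<close> by (simp add: power_mult_distrib)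
    finally show ?case .
  qed
qed

lemma negligible_growth_exponential:
  assumes "subexponential \<beta>"
  shows "negligible_growth exp \<beta>"
  unfolding negligible_growth_def
proof (intro allI impI)
  fix M L C :: real assume pos: "M > 0" "L > 0" "C > 0"
  \<comment> \<open>then \<open>exp (\<delta> * (M * r + M))\<close> is the square root of \<open>exp (C * r + C)\<close>\<close>
  define \<delta> where "\<delta> = C / (2 * M)"
  have \<delta>: "\<delta> > 0" using pos by (simp add: \<delta>_def)
  have "Limsup at_top (\<lambda>r. ereal (1 / r * ln (real (\<beta> r)))) < ereal \<delta>"
    using assms \<delta> by (simp add: subexponential_def)
  then have "eventually (\<lambda>r. ereal (1 / r * ln (real (\<beta> r))) < ereal \<delta>) at_top"
    by (rule Limsup_lessD)
  moreover have "eventually (\<lambda>r::real. r > 0) at_top" by (rule eventually_gt_at_top)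
  ultimately have "eventually (\<lambda>r. real (\<beta> r) \<le> exp (\<delta> * r)) at_top"
  proof eventually_elim
    case (elim r)
    show ?case
    proof (cases "\<beta> r = 0")
      case False
      have "ln (real (\<beta> r)) \<le> \<delta> * r" using elim by (simp add: field_simps)
      then have "exp (ln (real (\<beta> r))) \<le> exp (\<delta> * r)" by simp
      then show ?thesis using False by simp
    qed simp
  qed
  moreover have "filterlim (\<lambda>r. M * r + M) at_top at_top" using pos by real_asymp
  ultimately have "eventually (\<lambda>r. real (\<beta> (M * r + M)) \<le> exp (\<delta> * (M * r + M))) at_top"
    by (rule eventually_compose_filterlim)
  moreover have "eventually (\<lambda>r. r \<ge> 2 * L / C ^ 2) at_top" by (rule eventually_ge_at_top)
  ultimately show "eventually (\<lambda>r. L * real (\<beta> (M * r + M)) \<le> C * exp (C * r + C)) at_top"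
  proof eventually_elim
    case (elim r)
    define E where "E = exp ((C * r + C) / 2)"
    have "\<delta> * (M * r + M) = (C * r + C) / 2" using pos by (simp add: \<delta>_def field_simps)
    then have "real (\<beta> (M * r + M)) \<le> E" using elim(1) by (simp only: E_def)
    then have "L * real (\<beta> (M * r + M)) \<le> L * E" using pos by simp
    also have "L \<le> C * E"
    proof -
      have "L \<le> C * (C * r / 2)" using elim(2) pos by (simp add: field_simps power2_eq_square)
      also have "C * r / 2 \<le> E"
        using exp_ge_add_one_self[of "(C * r + C) / 2"] pos unfolding E_def by (simp add: field_simps)
      finally show ?thesis using pos by simp
    qed
    then have "L * E \<le> C * E * E" by (intro mult_right_mono) (auto simp: E_def)
    also have "\<dots> = C * exp (C * r + C)" by (simp add: E_def mult.assoc exp_add[symmetric])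
    finally show ?case .
  qed
qed

section \<open>Quasi-isometries\<close>

lemma quasi_inverse_exists:
  assumes "quasi_isometry m1 m2 f"
  shows "\<exists>g. quasi_inverse m1 m2 f g"
proof -
  obtain A B where f: "f ` mspace m1 \<subseteq> mspace m2" and AB: "A \<ge> 1" "B \<ge> 0"
    and lower: "\<And>x y. x \<in> mspace m1 \<Longrightarrow> y \<in> mspace m1 \<Longrightarrow> mdist m1 x y / A - B \<le> mdist m2 (f x) (f y)"
    and upper: "\<And>x y. x \<in> mspace m1 \<Longrightarrow> y \<in> mspace m1 \<Longrightarrow> mdist m2 (f x) (f y) \<le> A * mdist m1 x y + B"
    and onto: "\<And>y. y \<in> mspace m2 \<Longrightarrow> \<exists>x\<in>mspace m1. mdist m2 (f x) y \<le> B"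
    using assms unfolding quasi_isometry_def by auto
  define g where "g y = (SOME x. x \<in> mspace m1 \<and> mdist m2 (f x) y \<le> B)" for y
  have g: "g y \<in> mspace m1" "mdist m2 (f (g y)) y \<le> B" if "y \<in> mspace m2" for y
    using someI_ex[of "\<lambda>x. x \<in> mspace m1 \<and> mdist m2 (f x) y \<le> B"] onto[OF that] unfolding g_def by auto
  have fm: "f x \<in> mspace m2" if "x \<in> mspace m1" for x using f that by blast
  define B' where "B' = A * (3 * B)"
  have B': "B' \<ge> 3 * B" "B' \<ge> 0"
    using AB mult_right_mono[of 1 A "3 * B"] by (simp_all add: B'_def)
  have lower': "mdist m1 x y \<le> A * (mdist m2 (f x) (f y) + B)" if "x \<in> mspace m1" "y \<in> mspace m1" for x y
    using lower[OF that] AB by (simp add: field_simps)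
  have gf: "mdist m1 (g (f x)) x \<le> B'" if x: "x \<in> mspace m1" for x
  proof -
    have "mdist m1 (g (f x)) x \<le> A * (mdist m2 (f (g (f x))) (f x) + B)"
      by (rule lower'[OF g(1)[OF fm[OF x]] x])
    also have "\<dots> \<le> B'"
      unfolding B'_def using g(2)[OF fm[OF x]] AB by (intro mult_left_mono) auto
    finally show ?thesis .
  qed
  have g_upper: "mdist m1 (g y) (g y') \<le> A * mdist m2 y y' + B'"
    and g_lower: "mdist m2 y y' / A - B' \<le> mdist m1 (g y) (g y')"
    if y: "y \<in> mspace m2" "y' \<in> mspace m2" for y y'
  proof -
    note gy = g[OF y(1)] g[OF y(2)]
    have "mdist m2 (f (g y)) (f (g y')) \<le> mdist m2 (f (g y)) y + mdist m2 y (f (g y'))"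
      using gy y fm by (intro mdist_triangle) auto
    moreover have "mdist m2 y (f (g y')) \<le> mdist m2 y y' + mdist m2 y' (f (g y'))"
      using gy y fm by (intro mdist_triangle) auto
    ultimately have "mdist m2 (f (g y)) (f (g y')) + B \<le> mdist m2 y y' + 3 * B"
      using gy(2,4) mdist_commute[of m2 y' "f (g y')"] by linarith
    then have "A * (mdist m2 (f (g y)) (f (g y')) + B) \<le> A * (mdist m2 y y' + 3 * B)"
      using AB by (intro mult_left_mono) auto
    then show "mdist m1 (g y) (g y') \<le> A * mdist m2 y y' + B'"
      using lower'[OF gy(1,3)] by (simp add: B'_def algebra_simps)
    have "mdist m2 y y' \<le> mdist m2 y (f (g y)) + mdist m2 (f (g y)) y'"
      using gy y fm by (intro mdist_triangle) auto
    moreover have "mdist m2 (f (g y)) y' \<le> mdist m2 (f (g y)) (f (g y')) + mdist m2 (f (g y')) y'"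
      using gy y fm by (intro mdist_triangle) auto
    ultimately have "mdist m2 y y' \<le> A * mdist m1 (g y) (g y') + 3 * B"
      using gy(2,4) upper[OF gy(1,3)] mdist_commute[of m2 y "f (g y)"] by linarith
    also have "\<dots> \<le> A * (mdist m1 (g y) (g y') + B')"
      using AB B' mult_right_mono[of 1 A B'] by (simp add: algebra_simps)
    finally show "mdist m2 y y' / A - B' \<le> mdist m1 (g y) (g y')"
      using AB by (simp add: field_simps)
  qed
  have "quasi_isometry m2 m1 g"
    unfolding quasi_isometry_def
  proof (intro conjI)
    show "g ` mspace m2 \<subseteq> mspace m1" using g(1) by blast
    have onto': "\<exists>y\<in>mspace m2. mdist m1 (g y) x \<le> B'" if "x \<in> mspace m1" for x
      using gf[OF that] fm[OF that] by blast
    show "\<exists>A\<ge>1. \<exists>B\<ge>0. (\<forall>x\<in>mspace m2. \<forall>y\<in>mspace m2. mdist m2 x y / A - B \<le> mdist m1 (g x) (g y) \<and>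
        mdist m1 (g x) (g y) \<le> A * mdist m2 x y + B) \<and> (\<forall>y\<in>mspace m1. \<exists>x\<in>mspace m2. mdist m1 (g x) y \<le> B)"
      by (rule exI[of _ A], intro conjI AB(1), rule exI[of _ B'], intro conjI ballI B'(2))
        (simp_all add: g_upper g_lower onto')
  qed
  then show ?thesis unfolding quasi_inverse_def using gf g(2) by blast
qed

lemma hausdorff_distance_finite:
  assumes "\<And>a. a \<in> A \<Longrightarrow> \<exists>b\<in>B. mdist m a b \<le> R" "\<And>b. b \<in> B \<Longrightarrow> \<exists>a\<in>A. mdist m b a \<le> R"
  shows "hausdorff_distance m A B < \<infinity>"
proof -
  have "dist_to_set m x C \<le> ereal R" if "\<exists>c\<in>C. mdist m x c \<le> R" for x C
    using that unfolding dist_to_set_def by (auto intro: INF_lower2)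
  then have "hausdorff_distance m A B \<le> ereal R"
    using assms unfolding hausdorff_distance_def by (auto intro!: SUP_least)
  then show ?thesis by (rule le_less_trans) simp
qed

lemma quasi_isometry_id: "quasi_isometry m m (\<lambda>x. x)"
proof -
  have self: "mdist m y y = 0" if "y \<in> mspace m" for y using that by simp
  have onto: "\<exists>x\<in>mspace m. mdist m x y \<le> 0" if "y \<in> mspace m" for y
    by (rule bexI[OF _ that]) (simp only: self[OF that] order.refl)
  show ?thesis
    unfolding quasi_isometry_def
  proof (intro conjI)
    show "\<exists>A\<ge>1. \<exists>B\<ge>0. (\<forall>x\<in>mspace m. \<forall>y\<in>mspace m. mdist m x y / A - B \<le> mdist m x y \<and>
        mdist m x y \<le> A * mdist m x y + B) \<and> (\<forall>y\<in>mspace m. \<exists>x\<in>mspace m. mdist m x y \<le> B)"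
      by (rule exI[of _ 1], rule conjI, simp, rule exI[of _ 0]) (simp add: onto)
  qed simp
qed

lemma (in fg_group) countable_carrier: "countable (carrier G)"
proof (rule countable_subset)
  show "carrier G \<subseteq> product ` lists letters" using product_surj by (auto simp: lists_eq_set)
  show "countable (product ` lists letters)"
    using finite_letters by (intro countable_image countable_lists countable_finite)
qed

lemma decomposed_fg_groupI:
  assumes "group G" "finite_generating_set G S" "finite_gog_decomposition G \<G> T \<phi>" "vertex_groups_in \<G> \<M>"
  shows "decomposed_fg_group \<G> T G \<phi> S"
proof -
  interpret gog_with_tree \<G> T
    using assms(3) by (simp add: gog_with_tree_def finite_gog_decomposition_def)
  interpret group G by fact
  interpret decomposed_group \<G> T G \<phi>
  proof
    show "\<phi> \<in> iso (fundamental_group \<G> T) G" using assms(3) by (simp add: finite_gog_decomposition_def)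
    fix v assume v: "v \<in> V"
    then obtain S where "finite_generating_set (vertex_gp \<G> v) S"
      using assms(4) by (auto simp: vertex_groups_in_def group_in_class_def)
    then have "fg_group (vertex_gp \<G> v) S"
      using group_vertex[OF v] by (simp add: fg_group_def fg_group_axioms_def)
    then show "countable (carrier (vertex_gp \<G> v))" by (rule fg_group.countable_carrier)
  qed
  show ?thesis by unfold_locales (rule assms(2))
qed

section \<open>Images of vertex cosets under quasi-isometries\<close>

text \<open>
  The hypotheses on \<open>f\<close> that are used in each direction. The locale is also applied to the identity
  map of a single group.
\<close>
locale decomposition_pair =
  D1: decomposed_fg_group \<G>1 T1 G1 \<phi>1 S1 + D2: decomposed_fg_group \<G>2 T2 G2 \<phi>2 S2
  for \<G>1 :: "('v1, 'e1, 'a1, 'b1) graph_of_groups" and T1 :: "'e1 set" and G1 :: "'g1 monoid"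
    and \<phi>1 :: "('v1, 'e1, 'a1) gog_letter list set \<Rightarrow> 'g1" and S1 :: "'g1 set"
    and \<G>2 :: "('v2, 'e2, 'a2, 'b2) graph_of_groups" and T2 :: "'e2 set" and G2 :: "'g2 monoid"
    and \<phi>2 :: "('v2, 'e2, 'a2) gog_letter list set \<Rightarrow> 'g2" and S2 :: "'g2 set" +
  fixes \<gamma> :: "real \<Rightarrow> real" and f :: "'g1 \<Rightarrow> 'g2"
  assumes \<gamma>_nonneg: "\<And>r. r \<ge> 0 \<Longrightarrow> \<gamma> r \<ge> 0"
    and vertex_class: "vertex_groups_in \<G>1 (separation_class \<gamma>)"
    and edge_growth: "\<And>e. e \<in> D2.A \<Longrightarrow> negligible_growth \<gamma> (relative_growth G2 S2 (D2.K e))"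
    and qi: "quasi_isometry (word_metric G1 S1) (word_metric G2 S2) f"
begin

lemmas f_qi = qi[unfolded quasi_isometry_def mspace_word_metric[OF D1.is_group D1.generating]
    mspace_word_metric[OF D2.is_group D2.generating]]

lemma f_closed: "x \<in> carrier G1 \<Longrightarrow> f x \<in> carrier G2"
  by (rule subsetD[OF conjunct1[OF f_qi] imageI])

lemma f_bounds:
  obtains a b where "a \<ge> 1" "b \<ge> 0"
    "\<And>x y. x \<in> carrier G1 \<Longrightarrow> y \<in> carrier G1 \<Longrightarrow> D1.d x y \<le> a * (D2.d (f x) (f y) + b)"
    "\<And>x y. x \<in> carrier G1 \<Longrightarrow> y \<in> carrier G1 \<Longrightarrow> D2.d (f x) (f y) \<le> a * D1.d x y + b"
proof -
  obtain a b where ab: "a \<ge> 1" "b \<ge> 0"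
    "\<And>x y. x \<in> carrier G1 \<Longrightarrow> y \<in> carrier G1 \<Longrightarrow> D1.d x y / a - b \<le> D2.d (f x) (f y)"
    "\<And>x y. x \<in> carrier G1 \<Longrightarrow> y \<in> carrier G1 \<Longrightarrow> D2.d (f x) (f y) \<le> a * D1.d x y + b"
    using conjunct2[OF f_qi] by blast
  have "D1.d x y \<le> a * (D2.d (f x) (f y) + b)" if "x \<in> carrier G1" "y \<in> carrier G1" for x y
    using ab(3)[OF that] ab(1) by (simp add: field_simps)
  then show ?thesis using that ab by blast
qed

text \<open>
  A vertex coset is replaced by the graph \<open>X\<close> that witnesses membership of the vertex group in the
  separation class: \<open>q\<close> sends a point of \<open>X\<close> to a nearby element of the vertex group and then into
  the image of the coset under \<open>f\<close>. Fibres of \<open>q\<close> are bounded because the vertex group injects into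
  the locally finite \<open>G1\<close>; the vertex group may well be distorted in \<open>G1\<close>.
\<close>
lemma vertex_coset_map:
  assumes v: "v \<in> D1.V" and g: "g \<in> carrier G1"
  obtains X :: "nat pair_pre_digraph" and q \<Lambda> N R where "coarse_map \<G>2 T2 G2 \<phi>2 S2 X \<gamma> q \<Lambda> N"
    "pverts X \<noteq> {}"
    "\<And>p. p \<in> D1.H v \<Longrightarrow> \<exists>x\<in>pverts X. D2.d (f (g \<otimes>\<^bsub>G1\<^esub> p)) (q x) \<le> R"
    "\<And>x. x \<in> pverts X \<Longrightarrow> \<exists>p\<in>D1.H v. q x = f (g \<otimes>\<^bsub>G1\<^esub> p)"
    "(\<exists>r. \<forall>x\<in>pverts X. \<forall>y\<in>pverts X. path_dist (with_proj X) x y \<le> r) \<Longrightarrow>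
       finite (carrier (vertex_gp \<G>1 v))"
proof -
  let ?Gv = "vertex_gp \<G>1 v"
  obtain Sv where Sv: "finite_generating_set ?Gv Sv" "word_metric ?Gv Sv \<in> separation_class \<gamma>"
    using vertex_class v by (auto simp: vertex_groups_in_def group_in_class_def)
  interpret Gv: fg_group ?Gv Sv
    using D1.group_vertex[OF v] Sv(1) by (simp add: fg_group_def fg_group_axioms_def)
  from Sv(2)[unfolded separation_class_def mem_Collect_eq] obtain X :: "nat pair_pre_digraph"
    where X_all: "bounded_degree_graph X \<and> (\<exists>f. quasi_isometry (word_metric ?Gv Sv) (path_metric (with_proj X)) f) \<and>
      (\<forall>\<S>. \<S> \<subseteq> Pow (pverts X) \<and> coarsely_separates (path_metric (with_proj X)) \<S> \<longrightarrow>
              family_growth (path_metric (with_proj X)) \<S> \<greatersim> \<gamma>)" ..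
  note X = conjunct1[OF X_all]
  from conjunct1[OF conjunct2[OF X_all]] obtain \<iota>
    where \<iota>: "quasi_isometry (word_metric ?Gv Sv) (path_metric (with_proj X)) \<iota>" ..
  have hard: "family_growth (path_metric (with_proj X)) \<S> \<greatersim> \<gamma>"
    if "\<S> \<subseteq> Pow (pverts X)" "coarsely_separates (path_metric (with_proj X)) \<S>" for \<S>
    using conjunct2[OF conjunct2[OF X_all]] that by simp
  interpret X: bd_graph X by (rule bd_graph.intro[OF X])
  note \<iota>_qi = \<iota>[unfolded quasi_isometry_def mspace_word_metric[OF Gv.is_group Gv.generating]
      X.mspace_mX X.mdist_mX]
  have \<iota>X: "\<iota> x \<in> X.VX" if "x \<in> carrier ?Gv" for x
    using conjunct1[OF \<iota>_qi] that by (rule subsetD[OF _ imageI])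
  obtain A B where AB: "A \<ge> 1" "B \<ge> 0"
    and low: "\<And>x y. x \<in> carrier ?Gv \<Longrightarrow> y \<in> carrier ?Gv \<Longrightarrow> Gv.d x y / A - B \<le> X.dX (\<iota> x) (\<iota> y)"
    and onto: "\<And>y. y \<in> X.VX \<Longrightarrow> \<exists>x\<in>carrier ?Gv. X.dX (\<iota> x) y \<le> B"
    using conjunct2[OF \<iota>_qi] by blast
  have lower: "Gv.d x y \<le> A * (X.dX (\<iota> x) (\<iota> y) + B)" if "x \<in> carrier ?Gv" "y \<in> carrier ?Gv" for x y
    using low[OF that] AB by (simp add: field_simps)
  obtain a b where ab: "a \<ge> 1" "b \<ge> 0"
    and f_low: "\<And>x y. x \<in> carrier G1 \<Longrightarrow> y \<in> carrier G1 \<Longrightarrow> D1.d x y \<le> a * (D2.d (f x) (f y) + b)"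
    and f_up: "\<And>x y. x \<in> carrier G1 \<Longrightarrow> y \<in> carrier G1 \<Longrightarrow> D2.d (f x) (f y) \<le> a * D1.d x y + b"
    using f_bounds by blast
  define F where "F = insert 0 ((\<lambda>s. D1.d \<one>\<^bsub>G1\<^esub> (D1.vx v s)) ` Gv.letters)"
  have finF: "finite F" unfolding F_def using Gv.finite_letters by auto
  define c where "c = Max F"
  have c0: "c \<ge> 0" unfolding c_def by (rule Max_ge[OF finF]) (simp add: F_def)
  have c_letter: "D1.d \<one>\<^bsub>G1\<^esub> (D1.vx v s) \<le> c" if "s \<in> Gv.letters" for s
    unfolding c_def by (rule Max_ge[OF finF]) (use that in \<open>simp add: F_def\<close>)
  have vxc: "D1.vx v x \<in> carrier G1" if "x \<in> carrier ?Gv" for x using that v by simp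
  have c_word: "D1.d \<one>\<^bsub>G1\<^esub> (D1.vx v (Gv.product ws)) \<le> c * length ws" if "set ws \<subseteq> Gv.letters" for ws
    using that
  proof (induction ws)
    case Nil
    then show ?case using D1.vx_one[OF v] by simp
  next
    case (Cons s ws)
    then have s: "s \<in> Gv.letters" "s \<in> carrier ?Gv" "Gv.product ws \<in> carrier ?Gv"
      using Gv.letters_carrier Gv.product_closed by auto
    have "D1.d \<one>\<^bsub>G1\<^esub> (D1.vx v (Gv.product (s # ws))) \<le>
      D1.d \<one>\<^bsub>G1\<^esub> (D1.vx v s) + D1.d (D1.vx v s) (D1.vx v s \<otimes>\<^bsub>G1\<^esub> D1.vx v (Gv.product ws))"
      using D1.vx_mult[OF v s(2,3)] D1.metric.triangle vxc[OF s(2)] vxc[OF s(3)] by simp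
    also have "\<dots> \<le> c + c * length ws"
      using c_letter[OF s(1)] D1.dist_mult_right[OF vxc[OF s(2)] vxc[OF s(3)]] Cons by simp
    finally show ?case by (simp add: algebra_simps)
  qed
  have gp: "g \<otimes>\<^bsub>G1\<^esub> D1.vx v x \<in> carrier G1" if "x \<in> carrier ?Gv" for x using g vxc[OF that] by simp
  have d_vx: "D1.d (g \<otimes>\<^bsub>G1\<^esub> D1.vx v x) (g \<otimes>\<^bsub>G1\<^esub> D1.vx v y) = D1.d \<one>\<^bsub>G1\<^esub> (D1.vx v (inv\<^bsub>?Gv\<^esub> x \<otimes>\<^bsub>?Gv\<^esub> y))"
    if xy: "x \<in> carrier ?Gv" "y \<in> carrier ?Gv" for x y
  proof -
    let ?z = "inv\<^bsub>?Gv\<^esub> x \<otimes>\<^bsub>?Gv\<^esub> y"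
    have z: "?z \<in> carrier ?Gv" "x \<otimes>\<^bsub>?Gv\<^esub> ?z = y" using xy by (simp_all add: Gv.m_assoc[symmetric])
    have "D1.vx v y = D1.vx v x \<otimes>\<^bsub>G1\<^esub> D1.vx v ?z" using D1.vx_mult[OF v xy(1) z(1)] z(2) by simp
    then show ?thesis
      using D1.dist_left_mult[OF g vxc[OF xy(1)] vxc[OF xy(2)]]
        D1.dist_mult_right[OF vxc[OF xy(1)] vxc[OF z(1)]] by simp
  qed
  have vx_Lipschitz: "D1.d (g \<otimes>\<^bsub>G1\<^esub> D1.vx v x) (g \<otimes>\<^bsub>G1\<^esub> D1.vx v y) \<le> c * Gv.d x y"
    if xy: "x \<in> carrier ?Gv" "y \<in> carrier ?Gv" for x y
  proof -
    let ?z = "inv\<^bsub>?Gv\<^esub> x \<otimes>\<^bsub>?Gv\<^esub> y"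
    obtain ws where ws: "set ws \<subseteq> Gv.letters" "Gv.product ws = ?z" "length ws = word_length ?Gv Sv ?z"
      using Gv.length_geodesic[of ?z] xy by auto
    show ?thesis using c_word[OF ws(1)] ws(2,3) d_vx[OF xy] Gv.dist_eq[OF xy] by simp
  qed
  have f_Lipschitz: "D2.d (f (g \<otimes>\<^bsub>G1\<^esub> D1.vx v x)) (f (g \<otimes>\<^bsub>G1\<^esub> D1.vx v y)) \<le> a * c * Gv.d x y + b"
    if xy: "x \<in> carrier ?Gv" "y \<in> carrier ?Gv" for x y
  proof -
    have "a * D1.d (g \<otimes>\<^bsub>G1\<^esub> D1.vx v x) (g \<otimes>\<^bsub>G1\<^esub> D1.vx v y) \<le> a * (c * Gv.d x y)"
      using ab by (intro mult_left_mono vx_Lipschitz[OF xy]) auto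
    then show ?thesis
      using f_up[OF gp[OF xy(1)] gp[OF xy(2)]] unfolding mult.assoc by linarith
  qed
  define \<alpha> where "\<alpha> x = (SOME y. y \<in> carrier ?Gv \<and> X.dX (\<iota> y) x \<le> B)" for x
  have \<alpha>: "\<alpha> x \<in> carrier ?Gv" "X.dX (\<iota> (\<alpha> x)) x \<le> B" if "x \<in> X.VX" for x
    using someI_ex[of "\<lambda>y. y \<in> carrier ?Gv \<and> X.dX (\<iota> y) x \<le> B"] onto[OF that] unfolding \<alpha>_def by auto
  define q where "q x = f (g \<otimes>\<^bsub>G1\<^esub> D1.vx v (\<alpha> x))" for x
  have q_closed: "q x \<in> carrier G2" if "x \<in> X.VX" for x
    unfolding q_def by (rule f_closed[OF gp[OF \<alpha>(1)[OF that]]])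
  define \<Lambda> where "\<Lambda> = a * c * A + a * c * A * (3 * B) + b"
  have acA: "a * c * A \<ge> 0" "a * c \<ge> 0" using ab c0 AB by simp_all
  have \<alpha>_dist: "Gv.d (\<alpha> x) (\<alpha> y) \<le> A * (X.dX x y + 3 * B)" if xy: "x \<in> X.VX" "y \<in> X.VX" for x y
  proof -
    note axy = \<alpha>[OF xy(1)] \<alpha>[OF xy(2)]
    have "X.dX (\<iota> (\<alpha> x)) (\<iota> (\<alpha> y)) \<le> X.dX (\<iota> (\<alpha> x)) x + (X.dX x y + X.dX y (\<iota> (\<alpha> y)))"
      using X.mX.triangle[of "\<iota> (\<alpha> x)" x "\<iota> (\<alpha> y)"] X.mX.triangle[of x y "\<iota> (\<alpha> y)"] axy \<iota>X xy by simp
    then have "X.dX (\<iota> (\<alpha> x)) (\<iota> (\<alpha> y)) + B \<le> X.dX x y + 3 * B"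
      using axy X.mX.commute[of y "\<iota> (\<alpha> y)"] by linarith
    then have "A * (X.dX (\<iota> (\<alpha> x)) (\<iota> (\<alpha> y)) + B) \<le> A * (X.dX x y + 3 * B)"
      using AB by (intro mult_left_mono) auto
    then show ?thesis using lower[OF axy(1,3)] by linarith
  qed
  \<comment> \<open>contains the difference of any two elements that are mapped to the same point of \<open>G2\<close>\<close>
  define \<Phi> where "\<Phi> = {z \<in> carrier ?Gv. D1.d \<one>\<^bsub>G1\<^esub> (D1.vx v z) \<le> a * b}"
  have \<Phi>: "finite \<Phi>"
  proof (rule inj_on_finite)
    show "inj_on (D1.vx v) \<Phi>" by (rule inj_on_subset[OF D1.vertex_inj[OF v]]) (auto simp: \<Phi>_def)
    show "D1.vx v ` \<Phi> \<subseteq> {y \<in> carrier G1. D1.d \<one>\<^bsub>G1\<^esub> y \<le> a * b}" using vxc by (auto simp: \<Phi>_def)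
    show "finite {y \<in> carrier G1. D1.d \<one>\<^bsub>G1\<^esub> y \<le> a * b}" by (rule D1.finite_ball) simp
  qed
  obtain M where M: "\<And>x. x \<in> X.VX \<Longrightarrow> finite {y \<in> X.VX. X.dX x y \<le> real (nat \<lceil>B\<rceil>)}"
    "\<And>x. x \<in> X.VX \<Longrightarrow> card {y \<in> X.VX. X.dX x y \<le> real (nat \<lceil>B\<rceil>)} \<le> M"
    using X.ball_bound by blast
  have fibre: "finite {x \<in> X.VX. q x = y} \<and> card {x \<in> X.VX. q x = y} \<le> card \<Phi> * M" for y
  proof (cases "{x \<in> X.VX. q x = y} = {}")
    case False
    then obtain x0 where x0: "x0 \<in> X.VX" "q x0 = y" by blast
    let ?ball = "\<lambda>z. {y \<in> X.VX. X.dX (\<iota> (\<alpha> x0 \<otimes>\<^bsub>?Gv\<^esub> z)) y \<le> real (nat \<lceil>B\<rceil>)}"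
    have centre: "\<iota> (\<alpha> x0 \<otimes>\<^bsub>?Gv\<^esub> z) \<in> X.VX" if "z \<in> \<Phi>" for z
      using \<iota>X \<alpha>(1)[OF x0(1)] that by (simp add: \<Phi>_def)
    have sub: "{x \<in> X.VX. q x = y} \<subseteq> (\<Union>z\<in>\<Phi>. ?ball z)"
    proof clarify
      fix x assume x: "x \<in> X.VX" "y = q x"
      note ax = \<alpha>[OF x0(1)] \<alpha>[OF x(1)]
      let ?z = "inv\<^bsub>?Gv\<^esub> (\<alpha> x0) \<otimes>\<^bsub>?Gv\<^esub> \<alpha> x"
      have "D1.d (g \<otimes>\<^bsub>G1\<^esub> D1.vx v (\<alpha> x0)) (g \<otimes>\<^bsub>G1\<^esub> D1.vx v (\<alpha> x)) \<le> a * (D2.d (q x0) (q x) + b)"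
        unfolding q_def by (rule f_low[OF gp[OF ax(1)] gp[OF ax(3)]])
      also have "D2.d (q x0) (q x) = 0" using x x0 q_closed by simp
      finally have "?z \<in> \<Phi>" using d_vx[OF ax(1,3)] ax by (simp add: \<Phi>_def)
      moreover have "\<alpha> x0 \<otimes>\<^bsub>?Gv\<^esub> ?z = \<alpha> x" using ax by (simp add: Gv.m_assoc[symmetric])
      moreover have "X.dX (\<iota> (\<alpha> x)) x \<le> real (nat \<lceil>B\<rceil>)" using ax(4) AB(2) by linarith
      ultimately show "x \<in> (\<Union>z\<in>\<Phi>. ?ball z)" using x(1) by (intro UN_I[of ?z]) simp_all
    qed
    have fin: "finite (\<Union>z\<in>\<Phi>. ?ball z)" using \<Phi> M(1) centre by auto
    have "card (\<Union>z\<in>\<Phi>. ?ball z) \<le> (\<Sum>z\<in>\<Phi>. card (?ball z))" by (rule card_UN_le[OF \<Phi>])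
    also have "\<dots> \<le> (\<Sum>z\<in>\<Phi>. M)" using M(2) centre by (intro sum_mono) auto
    finally have "card (\<Union>z\<in>\<Phi>. ?ball z) \<le> card \<Phi> * M" by simp
    then show ?thesis using card_mono[OF fin sub] finite_subset[OF sub fin] by simp
  next
    case True
    show ?thesis unfolding True by simp
  qed
  have q_Lipschitz: "D2.d (q x) (q y) \<le> \<Lambda> * X.dX x y + \<Lambda>" if xy: "x \<in> X.VX" "y \<in> X.VX" for x y
  proof -
    have "D2.d (q x) (q y) \<le> a * c * Gv.d (\<alpha> x) (\<alpha> y) + b"
      unfolding q_def by (rule f_Lipschitz[OF \<alpha>(1)[OF xy(1)] \<alpha>(1)[OF xy(2)]])
    also have "\<dots> \<le> a * c * (A * (X.dX x y + 3 * B)) + b"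
      using mult_left_mono[OF \<alpha>_dist[OF xy] acA(2)] by simp
    also have "\<dots> = a * c * A * X.dX x y + (a * c * A * (3 * B) + b)" by (simp add: algebra_simps)
    also have "\<dots> \<le> \<Lambda> * X.dX x y + \<Lambda>"
      using acA AB ab by (intro add_mono mult_right_mono) (simp_all add: \<Lambda>_def)
    finally show ?thesis .
  qed
  have "\<Lambda> \<ge> 0" using acA AB ab by (simp add: \<Lambda>_def)
  then have cm: "coarse_map \<G>2 T2 G2 \<phi>2 S2 X \<gamma> q \<Lambda> (card \<Phi> * M)"
    using hard \<gamma>_nonneg edge_growth q_closed q_Lipschitz fibre by unfold_locales auto
  show ?thesis
  proof (rule that[OF cm])
    show "X.VX \<noteq> {}" using \<iota>X[OF Gv.one_closed] by blast
    show "\<exists>x\<in>X.VX. D2.d (f (g \<otimes>\<^bsub>G1\<^esub> p)) (q x) \<le> a * c * (A * (2 * B)) + b" if p: "p \<in> D1.H v" for p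
    proof -
      obtain y where y: "y \<in> carrier ?Gv" "p = D1.vx v y" using p by (auto simp: D1.H_eq)
      let ?x = "\<iota> y"
      have x: "?x \<in> X.VX" by (rule \<iota>X[OF y(1)])
      have "Gv.d y (\<alpha> ?x) \<le> A * (X.dX (\<iota> y) (\<iota> (\<alpha> ?x)) + B)" by (rule lower[OF y(1) \<alpha>(1)[OF x]])
      also have "\<dots> \<le> A * (2 * B)"
        using \<alpha>(2)[OF x] AB X.mX.commute[of "\<iota> y" "\<iota> (\<alpha> ?x)"] by (intro mult_left_mono) auto
      finally have "a * c * Gv.d y (\<alpha> ?x) \<le> a * c * (A * (2 * B))" using acA by (intro mult_left_mono) auto
      then show ?thesis
        using f_Lipschitz[OF y(1) \<alpha>(1)[OF x]] y(2) by (intro bexI[OF _ x]) (simp add: q_def)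
    qed
    show "\<exists>p\<in>D1.H v. q x = f (g \<otimes>\<^bsub>G1\<^esub> p)" if "x \<in> X.VX" for x
      using \<alpha>(1)[OF that] by (auto simp: q_def D1.H_eq)
    assume "\<exists>r. \<forall>x\<in>X.VX. \<forall>y\<in>X.VX. X.dX x y \<le> r"
    then obtain r where r: "\<And>x y. x \<in> X.VX \<Longrightarrow> y \<in> X.VX \<Longrightarrow> X.dX x y \<le> r" by blast
    have "carrier ?Gv \<subseteq> {y \<in> carrier ?Gv. Gv.d \<one>\<^bsub>?Gv\<^esub> y \<le> A * (r + B)}"
    proof clarify
      fix y assume y: "y \<in> carrier ?Gv"
      have "Gv.d \<one>\<^bsub>?Gv\<^esub> y \<le> A * (X.dX (\<iota> \<one>\<^bsub>?Gv\<^esub>) (\<iota> y) + B)" using lower y by simp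
      also have "\<dots> \<le> A * (r + B)" using r \<iota>X y AB by (intro mult_left_mono) auto
      finally show "Gv.d \<one>\<^bsub>?Gv\<^esub> y \<le> A * (r + B)" .
    qed
    then show "finite (carrier ?Gv)" using Gv.finite_ball[OF Gv.one_closed] finite_subset by blast
  qed
qed

proposition image_in_vertex_coset:
  assumes v: "v \<in> D1.V" and g: "g \<in> carrier G1"
  shows "\<exists>w\<in>D2.V. \<exists>h\<in>carrier G2. \<exists>R. \<forall>p\<in>D1.H v. \<exists>b\<in>D2.H w. D2.d (f (g \<otimes>\<^bsub>G1\<^esub> p)) (h \<otimes>\<^bsub>G2\<^esub> b) \<le> R"
proof -
  obtain X :: "nat pair_pre_digraph" and q \<Lambda> N R where cm: "coarse_map \<G>2 T2 G2 \<phi>2 S2 X \<gamma> q \<Lambda> N"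
    "pverts X \<noteq> {}"
    and near: "\<And>p. p \<in> D1.H v \<Longrightarrow> \<exists>x\<in>pverts X. D2.d (f (g \<otimes>\<^bsub>G1\<^esub> p)) (q x) \<le> R"
    using vertex_coset_map[OF v g] by metis
  obtain w h R' where w: "w \<in> D2.V" "h \<in> carrier G2"
    and R': "\<And>x. x \<in> pverts X \<Longrightarrow> \<exists>b\<in>D2.H w. D2.d (q x) (h \<otimes>\<^bsub>G2\<^esub> b) \<le> R'"
    using coarse_map.trapped[OF cm] by blast
  have "\<exists>b\<in>D2.H w. D2.d (f (g \<otimes>\<^bsub>G1\<^esub> p)) (h \<otimes>\<^bsub>G2\<^esub> b) \<le> R + R'" if p: "p \<in> D1.H v" for p
  proof -
    obtain x where x: "x \<in> pverts X" "D2.d (f (g \<otimes>\<^bsub>G1\<^esub> p)) (q x) \<le> R" using near[OF p] by blast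
    obtain b where b: "b \<in> D2.H w" "D2.d (q x) (h \<otimes>\<^bsub>G2\<^esub> b) \<le> R'" using R'[OF x(1)] by blast
    have "D2.d (f (g \<otimes>\<^bsub>G1\<^esub> p)) (h \<otimes>\<^bsub>G2\<^esub> b) \<le> D2.d (f (g \<otimes>\<^bsub>G1\<^esub> p)) (q x) + D2.d (q x) (h \<otimes>\<^bsub>G2\<^esub> b)"
      using f_closed g D1.H_carrier[OF v p] coarse_map.q_closed[OF cm(1) x(1)] w D2.H_carrier[OF w(1) b(1)]
      by (intro D2.metric.triangle) auto
    then show ?thesis using x b by (intro bexI[OF _ b(1)]) simp
  qed
  then show ?thesis using w by blast
qed

proposition finite_if_near_edge_coset:
  assumes v: "v \<in> D1.V" and g: "g \<in> carrier G1" and e: "e \<in> D2.A" and h: "h \<in> carrier G2"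
    and near: "\<And>p. p \<in> D1.H v \<Longrightarrow> \<exists>k\<in>D2.K e. D2.d (f (g \<otimes>\<^bsub>G1\<^esub> p)) (h \<otimes>\<^bsub>G2\<^esub> k) \<le> R"
  shows "finite (carrier (vertex_gp \<G>1 v))"
proof -
  obtain X :: "nat pair_pre_digraph" and q \<Lambda> N where cm: "coarse_map \<G>2 T2 G2 \<phi>2 S2 X \<gamma> q \<Lambda> N"
    and q: "\<And>x. x \<in> pverts X \<Longrightarrow> \<exists>p\<in>D1.H v. q x = f (g \<otimes>\<^bsub>G1\<^esub> p)"
    and fin: "(\<exists>r. \<forall>x\<in>pverts X. \<forall>y\<in>pverts X. path_dist (with_proj X) x y \<le> r) \<Longrightarrow>
       finite (carrier (vertex_gp \<G>1 v))"
    using vertex_coset_map[OF v g] by metis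
  have "\<exists>k\<in>D2.K e. D2.d (q x) (h \<otimes>\<^bsub>G2\<^esub> k) \<le> R" if "x \<in> pverts X" for x
    using q[OF that] near by metis
  then show ?thesis by (intro fin coarse_map.bounded_if_near_edge_coset[OF cm e h])
qed

end

text \<open>
  For an infinite vertex group, \<open>g\<close> carries the coset found by \<open>f\<close> back to the initial coset: otherwise
  the initial coset would be close to another vertex coset, hence to an edge coset, and would be
  finite. For a finite vertex group every coset of a finite vertex group will do.
\<close>
lemma quasi_isometry_vertex_cosets:
  assumes f: "decomposition_pair \<G>1 T1 G1 \<phi>1 S1 \<G>2 T2 G2 \<phi>2 S2 \<gamma> f"
    and g: "decomposition_pair \<G>2 T2 G2 \<phi>2 S2 \<G>1 T1 G1 \<phi>1 S1 \<gamma> g"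
    and gf: "\<And>x. x \<in> carrier G1 \<Longrightarrow> word_dist G1 S1 (g (f x)) x \<le> B"
    and fg: "\<And>y. y \<in> carrier G2 \<Longrightarrow> word_dist G2 S2 (f (g y)) y \<le> B"
    and fin: "has_finite_vertex_group \<G>1 \<Longrightarrow> has_finite_vertex_group \<G>2"
    and P: "P \<in> vertex_cosets G1 \<G>1 T1 \<phi>1"
  shows "\<exists>Q\<in>vertex_cosets G2 \<G>2 T2 \<phi>2. hausdorff_distance (word_metric G2 S2) (f ` P) Q < \<infinity>"
proof -
  interpret f: decomposition_pair \<G>1 T1 G1 \<phi>1 S1 \<G>2 T2 G2 \<phi>2 S2 \<gamma> f by (rule f)
  interpret g: decomposition_pair \<G>2 T2 G2 \<phi>2 S2 \<G>1 T1 G1 \<phi>1 S1 \<gamma> g by (rule g)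
  interpret id: decomposition_pair \<G>1 T1 G1 \<phi>1 S1 \<G>1 T1 G1 \<phi>1 S1 \<gamma> "\<lambda>x. x"
    by unfold_locales (use f.\<gamma>_nonneg f.vertex_class g.edge_growth quasi_isometry_id in auto)
  obtain x v where x: "x \<in> carrier G1" and v: "v \<in> f.D1.V" and P_eq: "P = x <#\<^bsub>G1\<^esub> f.D1.H v"
    using P by (auto simp: vertex_cosets_def)
  have P: "P = (\<lambda>p. x \<otimes>\<^bsub>G1\<^esub> p) ` f.D1.H v" by (auto simp: P_eq l_coset_def)
  have mdist2: "mdist (word_metric G2 S2) = f.D2.d"
    by (rule mspace_word_metric(2)[OF f.D2.is_group f.D2.generating])
  have Hv: "p \<in> carrier G1" if "p \<in> f.D1.H v" for p using f.D1.H_carrier[OF v that] .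
  show ?thesis
  proof (cases "finite (carrier (vertex_gp \<G>1 v))")
    case True
    then obtain w where w: "w \<in> f.D2.V" "finite (carrier (vertex_gp \<G>2 w))"
      using fin v unfolding has_finite_vertex_group_def by blast
    define Q where "Q = \<one>\<^bsub>G2\<^esub> <#\<^bsub>G2\<^esub> f.D2.H w"
    have Q: "Q \<in> vertex_cosets G2 \<G>2 T2 \<phi>2" unfolding Q_def vertex_cosets_def using w by blast
    have finite: "finite (f ` P)" "finite Q"
      using True w by (auto simp: P Q_def l_coset_def f.D1.H_eq f.D2.H_eq)
    have ne: "f ` P \<noteq> {}" "Q \<noteq> {}"
      using subgroup.one_closed[OF f.D1.H_subgroup[OF v]] subgroup.one_closed[OF f.D2.H_subgroup[OF w(1)]]
      by (auto simp: P Q_def l_coset_def)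
    define R where "R = Max ((\<lambda>(a, b). f.D2.d a b) ` ((f ` P \<times> Q) \<union> (Q \<times> f ` P)))"
    have R: "f.D2.d a b \<le> R" if "(a, b) \<in> (f ` P \<times> Q) \<union> (Q \<times> f ` P)" for a b
      unfolding R_def by (rule Max_ge) (use that finite in \<open>auto intro!: rev_image_eqI[OF that]\<close>)
    have "hausdorff_distance (word_metric G2 S2) (f ` P) Q < \<infinity>"
      by (rule hausdorff_distance_finite[where R = R]; unfold mdist2) (use R ne in blast)+
    then show ?thesis using Q by blast
  next
    case False
    obtain w h R where w: "w \<in> f.D2.V" and h: "h \<in> carrier G2"
      and R: "\<And>p. p \<in> f.D1.H v \<Longrightarrow> \<exists>b\<in>f.D2.H w. f.D2.d (f (x \<otimes>\<^bsub>G1\<^esub> p)) (h \<otimes>\<^bsub>G2\<^esub> b) \<le> R"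
      using f.image_in_vertex_coset[OF v x] by blast
    obtain v' x' R' where v': "v' \<in> f.D1.V" and x': "x' \<in> carrier G1"
      and R': "\<And>b. b \<in> f.D2.H w \<Longrightarrow> \<exists>p\<in>f.D1.H v'. f.D1.d (g (h \<otimes>\<^bsub>G2\<^esub> b)) (x' \<otimes>\<^bsub>G1\<^esub> p) \<le> R'"
      using g.image_in_vertex_coset[OF w h] by blast
    obtain a b where g_up: "a \<ge> 1" "b \<ge> 0"
      "\<And>y z. y \<in> carrier G2 \<Longrightarrow> z \<in> carrier G2 \<Longrightarrow> f.D1.d (g y) (g z) \<le> a * f.D2.d y z + b"
      using g.f_bounds by metis
    obtain a' b' where f_up: "a' \<ge> 1" "b' \<ge> 0"
      "\<And>y z. y \<in> carrier G1 \<Longrightarrow> z \<in> carrier G1 \<Longrightarrow> f.D2.d (f y) (f z) \<le> a' * f.D1.d y z + b'"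
      using f.f_bounds by metis
    have a0: "a \<ge> 0" and a0': "a' \<ge> 0" using g_up(1) f_up(1) by auto
    have Hw: "c \<in> carrier G2" if "c \<in> f.D2.H w" for c using f.D2.H_carrier[OF w that] .
    have Hv': "p \<in> carrier G1" if "p \<in> f.D1.H v'" for p using f.D1.H_carrier[OF v' that] .
    have close: "\<exists>p'\<in>f.D1.H v'. f.D1.d (x \<otimes>\<^bsub>G1\<^esub> p) (x' \<otimes>\<^bsub>G1\<^esub> p') \<le> B + (a * R + b) + R'" if p: "p \<in> f.D1.H v" for p
    proof -
      obtain c where c: "c \<in> f.D2.H w" "f.D2.d (f (x \<otimes>\<^bsub>G1\<^esub> p)) (h \<otimes>\<^bsub>G2\<^esub> c) \<le> R" using R[OF p] by blast
      obtain p' where p': "p' \<in> f.D1.H v'" "f.D1.d (g (h \<otimes>\<^bsub>G2\<^esub> c)) (x' \<otimes>\<^bsub>G1\<^esub> p') \<le> R'" using R'[OF c(1)] by blast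
      let ?x = "x \<otimes>\<^bsub>G1\<^esub> p" and ?y = "h \<otimes>\<^bsub>G2\<^esub> c" and ?z = "x' \<otimes>\<^bsub>G1\<^esub> p'"
      have carr: "?x \<in> carrier G1" "?y \<in> carrier G2" "?z \<in> carrier G1" "f ?x \<in> carrier G2"
        "g (f ?x) \<in> carrier G1" "g ?y \<in> carrier G1"
        using x h x' Hv[OF p] Hw[OF c(1)] Hv'[OF p'(1)] f.f_closed g.f_closed by auto
      have "f.D1.d (g (f ?x)) (g ?y) \<le> a * R + b"
        using g_up(3)[OF carr(4,2)] mult_left_mono[OF c(2) a0] by linarith
      moreover have "f.D1.d ?x ?z \<le> f.D1.d ?x (g (f ?x)) + (f.D1.d (g (f ?x)) (g ?y) + f.D1.d (g ?y) ?z)"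
        using f.D1.metric.triangle[of ?x "g (f ?x)" ?z] f.D1.metric.triangle[of "g (f ?x)" "g ?y" ?z] carr by simp
      moreover have "f.D1.d ?x (g (f ?x)) \<le> B" using gf[OF carr(1)] f.D1.metric.commute by metis
      ultimately show ?thesis using p' by (intro bexI[OF _ p'(1)]) linarith
    qed
    have same: "f.D1.same v x v' x'"
    proof (rule ccontr)
      assume "\<not> f.D1.same v x v' x'"
      then obtain e k R'' where e: "e \<in> f.D1.A" "k \<in> carrier G1"
        "\<And>p. p \<in> f.D1.H v \<Longrightarrow> \<exists>c\<in>f.D1.K e. f.D1.d (x \<otimes>\<^bsub>G1\<^esub> p) (k \<otimes>\<^bsub>G1\<^esub> c) \<le> R''"
        using f.D1.close_vertex_cosets[OF v x v' x' _ close] by blast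
      then show False using id.finite_if_near_edge_coset[OF v x e] False by blast
    qed
    define Q where "Q = h <#\<^bsub>G2\<^esub> f.D2.H w"
    have Q: "Q \<in> vertex_cosets G2 \<G>2 T2 \<phi>2" unfolding Q_def vertex_cosets_def using w h by blast
    have Q_eq: "Q = (\<lambda>c. h \<otimes>\<^bsub>G2\<^esub> c) ` f.D2.H w" by (auto simp: Q_def l_coset_def)
    have onto: "\<exists>p\<in>f.D1.H v. f.D2.d (h \<otimes>\<^bsub>G2\<^esub> c) (f (x \<otimes>\<^bsub>G1\<^esub> p)) \<le> B + (a' * R' + b')" if c: "c \<in> f.D2.H w" for c
    proof -
      obtain p' where p': "p' \<in> f.D1.H v'" "f.D1.d (g (h \<otimes>\<^bsub>G2\<^esub> c)) (x' \<otimes>\<^bsub>G1\<^esub> p') \<le> R'" using R'[OF c] by blast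
      have "v' = v" "inv\<^bsub>G1\<^esub> x \<otimes>\<^bsub>G1\<^esub> x' \<in> f.D1.H v"
        using same by (auto simp: f.D1.same_def)
      then have p: "inv\<^bsub>G1\<^esub> x \<otimes>\<^bsub>G1\<^esub> x' \<otimes>\<^bsub>G1\<^esub> p' \<in> f.D1.H v"
        using subgroup.m_closed[OF f.D1.H_subgroup[OF v]] p' by blast
      have xp: "x \<otimes>\<^bsub>G1\<^esub> (inv\<^bsub>G1\<^esub> x \<otimes>\<^bsub>G1\<^esub> x' \<otimes>\<^bsub>G1\<^esub> p') = x' \<otimes>\<^bsub>G1\<^esub> p'"
        using f.D1.inv_mult_cancel[of x "x' \<otimes>\<^bsub>G1\<^esub> p'"] x x' Hv'[OF p'(1)] by (simp add: f.D1.m_assoc)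
      let ?y = "h \<otimes>\<^bsub>G2\<^esub> c" and ?z = "x' \<otimes>\<^bsub>G1\<^esub> p'"
      have carr: "?y \<in> carrier G2" "?z \<in> carrier G1" "g ?y \<in> carrier G1" "f (g ?y) \<in> carrier G2" "f ?z \<in> carrier G2"
        using h x' Hw[OF c] Hv'[OF p'(1)] f.f_closed g.f_closed by auto
      have "f.D2.d (f (g ?y)) (f ?z) \<le> a' * R' + b'"
        using f_up(3)[OF carr(3,2)] mult_left_mono[OF p'(2) a0'] by linarith
      moreover have "f.D2.d ?y (f ?z) \<le> f.D2.d ?y (f (g ?y)) + f.D2.d (f (g ?y)) (f ?z)"
        using carr by (intro f.D2.metric.triangle)
      moreover have "f.D2.d ?y (f (g ?y)) \<le> B" using fg[OF carr(1)] f.D2.metric.commute by metis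
      ultimately have "f.D2.d ?y (f ?z) \<le> B + (a' * R' + b')" by linarith
      then show ?thesis using p xp by (intro bexI[OF _ p]) simp
    qed
    have "hausdorff_distance (word_metric G2 S2) (f ` P) Q < \<infinity>"
    proof (rule hausdorff_distance_finite[where R = "max R (B + (a' * R' + b'))"], unfold mdist2)
      fix y assume "y \<in> f ` P"
      then show "\<exists>z\<in>Q. f.D2.d y z \<le> max R (B + (a' * R' + b'))"
        using R by (force simp: P Q_eq le_max_iff_disj)
    next
      fix z assume "z \<in> Q"
      then show "\<exists>y\<in>f ` P. f.D2.d z y \<le> max R (B + (a' * R' + b'))"
        using onto by (force simp: P Q_eq le_max_iff_disj)
    qed
    then show ?thesis using Q by blast
  qed
qed

section \<open>Quasi-isometries preserve the vertex groups\<close>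

lemma decomposition_pairI:
  assumes "decomposed_fg_group \<G>1 T1 G1 \<phi>1 S1" "decomposed_fg_group \<G>2 T2 G2 \<phi>2 S2"
    and "\<And>r. r \<ge> 0 \<Longrightarrow> \<gamma> r \<ge> 0" "vertex_groups_in \<G>1 (separation_class \<gamma>)"
    and edge: "\<And>e. e \<in> gog_arcs \<G>2 \<Longrightarrow> negligible_growth \<gamma> (relative_growth G2 S2 (edge_subgroup \<G>2 T2 \<phi>2 e))"
    and "quasi_isometry (word_metric G1 S1) (word_metric G2 S2) f"
  shows "decomposition_pair \<G>1 T1 G1 \<phi>1 S1 \<G>2 T2 G2 \<phi>2 S2 \<gamma> f"
proof -
  interpret D1: decomposed_fg_group \<G>1 T1 G1 \<phi>1 S1 by fact
  interpret D2: decomposed_fg_group \<G>2 T2 G2 \<phi>2 S2 by fact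
  have "negligible_growth \<gamma> (relative_growth G2 S2 (D2.K e))" if "e \<in> D2.A" for e
    unfolding D2.K_def using edge D2.rv_A[OF that] by blast
  then show ?thesis by unfold_locales (use assms in auto)
qed

theorem corollary1p17:
  fixes G1 :: "'g1 monoid" and G2 :: "'g2 monoid"
    and S1 :: "'g1 set" and S2 :: "'g2 set"
    and \<G>1 :: "('v1, 'e1, 'a1, 'b1) graph_of_groups"
    and \<G>2 :: "('v2, 'e2, 'a2, 'b2) graph_of_groups"
    and T1 :: "'e1 set" and T2 :: "'e2 set"
    and \<phi>1 :: "('v1, 'e1, 'a1) gog_letter list set \<Rightarrow> 'g1"
    and \<phi>2 :: "('v2, 'e2, 'a2) gog_letter list set \<Rightarrow> 'g2"
    and f :: "'g1 \<Rightarrow> 'g2"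
  assumes "group G1" and "group G2"
    and "finite_generating_set G1 S1" and "finite_generating_set G2 S2"
    and "finite_gog_decomposition G1 \<G>1 T1 \<phi>1" and "finite_gog_decomposition G2 \<G>2 T2 \<phi>2"
    and "(\<exists>d::nat. d \<ge> 1 \<and>
            vertex_groups_in \<G>1 (M_poly d) \<and> vertex_groups_in \<G>2 (M_poly d) \<and>
            edge_groups_fg_with G1 S1 \<G>1 T1 \<phi>1 (\<lambda>\<beta>. (\<lambda>r. real (\<beta> r)) \<in> o(\<lambda>r. r ^ (d - 1))) \<and>
            edge_groups_fg_with G2 S2 \<G>2 T2 \<phi>2 (\<lambda>\<beta>. (\<lambda>r. real (\<beta> r)) \<in> o(\<lambda>r. r ^ (d - 1))))
         \<or> (vertex_groups_in \<G>1 M_exp \<and> vertex_groups_in \<G>2 M_exp \<and>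
            edge_groups_fg_with G1 S1 \<G>1 T1 \<phi>1 subexponential \<and>
            edge_groups_fg_with G2 S2 \<G>2 T2 \<phi>2 subexponential)"
    and "has_finite_vertex_group \<G>1 \<longleftrightarrow> has_finite_vertex_group \<G>2"
    and "quasi_isometry (word_metric G1 S1) (word_metric G2 S2) f"
  shows "quasi_preserves (word_metric G1 S1) (word_metric G2 S2)
           (vertex_cosets G1 \<G>1 T1 \<phi>1) (vertex_cosets G2 \<G>2 T2 \<phi>2) f"
proof -
  obtain \<gamma> :: "real \<Rightarrow> real" where \<gamma>: "\<And>r. r \<ge> 0 \<Longrightarrow> \<gamma> r \<ge> 0"
    and class1: "vertex_groups_in \<G>1 (separation_class \<gamma>)" and class2: "vertex_groups_in \<G>2 (separation_class \<gamma>)"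
    and edge1: "\<And>e. e \<in> gog_arcs \<G>1 \<Longrightarrow> negligible_growth \<gamma> (relative_growth G1 S1 (edge_subgroup \<G>1 T1 \<phi>1 e))"
    and edge2: "\<And>e. e \<in> gog_arcs \<G>2 \<Longrightarrow> negligible_growth \<gamma> (relative_growth G2 S2 (edge_subgroup \<G>2 T2 \<phi>2 e))"
    using assms(7)
  proof (elim disjE exE conjE)
    fix d :: nat
    assume "d \<ge> 1" "vertex_groups_in \<G>1 (M_poly d)" "vertex_groups_in \<G>2 (M_poly d)"
      "edge_groups_fg_with G1 S1 \<G>1 T1 \<phi>1 (\<lambda>\<beta>. (\<lambda>r. real (\<beta> r)) \<in> o(\<lambda>r. r ^ (d - 1)))"
      "edge_groups_fg_with G2 S2 \<G>2 T2 \<phi>2 (\<lambda>\<beta>. (\<lambda>r. real (\<beta> r)) \<in> o(\<lambda>r. r ^ (d - 1)))"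
    then show ?thesis
      by (intro that[of "\<lambda>r. r ^ d"])
        (auto simp: M_poly_def edge_groups_fg_with_def intro: negligible_growth_polynomial)
  next
    assume "vertex_groups_in \<G>1 M_exp" "vertex_groups_in \<G>2 M_exp"
      "edge_groups_fg_with G1 S1 \<G>1 T1 \<phi>1 subexponential" "edge_groups_fg_with G2 S2 \<G>2 T2 \<phi>2 subexponential"
    then show ?thesis
      by (intro that[of exp])
        (auto simp: M_exp_def edge_groups_fg_with_def intro: negligible_growth_exponential)
  qed
  have D1: "decomposed_fg_group \<G>1 T1 G1 \<phi>1 S1" and D2: "decomposed_fg_group \<G>2 T2 G2 \<phi>2 S2"
    using decomposed_fg_groupI assms class1 class2 by blast+
  obtain g where g: "quasi_inverse (word_metric G1 S1) (word_metric G2 S2) f g"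
    using quasi_inverse_exists assms(9) by blast
  note ms = mspace_word_metric[OF assms(1,3)] mspace_word_metric[OF assms(2,4)]
  obtain B1 B2 where B1: "\<And>x. x \<in> carrier G1 \<Longrightarrow> word_dist G1 S1 (g (f x)) x \<le> B1"
    and B2: "\<And>y. y \<in> carrier G2 \<Longrightarrow> word_dist G2 S2 (f (g y)) y \<le> B2"
    using g unfolding quasi_inverse_def ms by blast
  have B: "x \<in> carrier G1 \<Longrightarrow> word_dist G1 S1 (g (f x)) x \<le> max B1 B2"
    "y \<in> carrier G2 \<Longrightarrow> word_dist G2 S2 (f (g y)) y \<le> max B1 B2" for x y
    using B1[of x] B2[of y] by auto
  have pf: "decomposition_pair \<G>1 T1 G1 \<phi>1 S1 \<G>2 T2 G2 \<phi>2 S2 \<gamma> f"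
    by (rule decomposition_pairI[OF D1 D2 \<gamma> class1 edge2 assms(9)])
  have pg: "decomposition_pair \<G>2 T2 G2 \<phi>2 S2 \<G>1 T1 G1 \<phi>1 S1 \<gamma> g"
    using g by (intro decomposition_pairI[OF D2 D1 \<gamma> class2 edge1]) (simp_all add: quasi_inverse_def)
  show ?thesis
    unfolding quasi_preserves_def
    using quasi_isometry_vertex_cosets[OF pf pg B] quasi_isometry_vertex_cosets[OF pg pf B(2,1)] assms(8) g
    by blast
qed

end
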